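(* Let $I$ and $I'$ be finite nonempty subsets of the set of vertices $\mathbb{V}$ of an essentially 1-dimensional periodic graph $\mathcal{G}=(\mathbb{V},\mathbb{E})$. Assume that the passage time distribution $P_\tau$ has an absolutely continuous component (with respect to Lebesgue measure). For any $m\ge0$, there exists a coupling of $\{\tau_e\}_{e\in\mathbb{E}_m^c}$ and $\{\tau'_e\}_{e\in\mathbb{E}_m^c}$ such that if $\{\tau_e\}_{e\in\mathbb{E}_m}$ and $\{\tau'_e\}_{e\in\mathbb{E}_m}$ each have distribution $P_\tau^{\mathbb{E}_m}$, then the marginal distributions of $\{\tau_e\}_{e\in\mathbb{E}}$ and $\{\tau'_e\}_{e\in\mathbb{E}}$ are given by the product measure $P_\tau^{\mathbb{E}}$, and such that if first-passage percolation is performed with $(I,\{\tau_e\}_{e\in\mathbb{E}})$ and $(I',\{\tau'_e\}_{e\in\mathbb{E}})$, respectively, then with probability one there exists an $N_c<\infty$ such that $$T(I,v_{n,i})=T'(I',v_{n,i})\quad\text{and}\quad B_t=B'_t$$ for all $i$, all $n\ge N_c$, and all $t\ge N_c$.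
   Context: Graphs. A connected graph $\mathcal{G}=(\mathbb{V},\mathbb{E})$ is an essentially 1-dimensional periodic graph if it is obtained as follows. Let $\{\mathcal{G}_n\}_{n\in\mathbb{Z}}$ be identical copies of a finite connected graph, with vertex sets $\mathbb{V}_{\mathcal{G}_n}=\{v_{n,1},\dots,v_{n,K}\}$ and edge sets $\mathbb{E}_{\mathcal{G}_n}=\{e_{n,1},\dots,e_{n,L}\}$. Fix a nonempty $J\subset\{1,\dots,K\}^2$ and, for every $n\in\mathbb{Z}$ and $(i,j)\in J$, add an edge $e(v_{n,i},v_{n+1,j})$ between $v_{n,i}$ and $v_{n+1,j}$. Vertices of $\mathbb{V}_{\mathcal{G}_n}$ are at level $n$. First-passage percolation. $\{\tau_e\}$ and $\{\tau'_e\}$ are families of non-negative passage times; $P_\tau$ is a probability distribution on $[0,\infty)$. A path is an alternating sequence of vertices and edges, each edge joining the preceding and following vertex. $T(\Gamma)=\sum_{e\in\Gamma}\tau_e$ (sum over the set of edges) and $T(U,V)=\inf\{T(\Gamma):\Gamma\text{ a path from }U\text{ to }V\}$ (brackets dropped for singletons); $T'$ is defined in the same way from $\{\tau'_e\}$. $B_t=\{v\in\mathbb{V}:T(I,v)\le t\}$ and $B'_t=\{v\in\mathbb{V}:T'(I',v)\le t\}$. $\mathbb{E}_n$ is the set of edges between level $-n$ and level $n$ (both endpoints at levels in $\{-n,\dots,n\}$), excluding edges with both endpoints at level $-n$ and edges with both endpoints at level $n$; $\mathbb{E}_n^c=\mathbb{E}\setminus\mathbb{E}_n$. A coupling of two random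 elements is a joint distribution having their laws as marginals (here the families on $\mathbb{E}_m^c$ are coupled, the families on $\mathbb{E}_m$ being given). "$P_\tau$ has an absolutely continuous component" means that the absolutely continuous part in its Lebesgue decomposition is nonzero. *)

theory Defs
  imports "HOL-Probability.Probability"
begin

text \<open>
  Undirected graphs, with parallel edges and loops permitted: a vertex set \<open>V\<close>, an edge set \<open>E\<close>
  and a map \<open>ends\<close> giving the set of one or two endpoints of an edge.
\<close>

definition is_path ::
    "'v set \<Rightarrow> 'e set \<Rightarrow> ('e \<Rightarrow> 'v set) \<Rightarrow> 'v list \<Rightarrow> 'e list \<Rightarrow> bool" where
  "is_path V E ends vs es \<longleftrightarrow>
     length vs = Suc (length es) \<and> set vs \<subseteq> V \<and> set es \<subseteq> E \<and>
     (\<forall>k<length es. ends (es ! k) = {vs ! k, vs ! Suc k})"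

definition connected_graph :: "'v set \<Rightarrow> 'e set \<Rightarrow> ('e \<Rightarrow> 'v set) \<Rightarrow> bool" where
  "connected_graph V E ends \<longleftrightarrow>
     V \<noteq> {} \<and> (\<forall>u\<in>V. \<forall>v\<in>V. \<exists>vs es. is_path V E ends vs es \<and> hd vs = u \<and> last vs = v)"


text \<open>
  The vertex \<open>v\<^bsub>n,i\<^esub>\<close> is the pair \<open>(n, i)\<close>. \<open>Inner n l\<close> is the edge \<open>e\<^bsub>n,l\<^esub>\<close> of the \<open>n\<close>-th copy, and
  \<open>Cross n i j\<close> is the added edge between \<open>v\<^bsub>n,i\<^esub>\<close> and \<open>v\<^bsub>n+1,j\<^esub>\<close>. The finite graph that is copied
  has vertices \<open>{1..K}\<close> and edges \<open>{1..L}\<close>, edge \<open>l\<close> having the endpoint set \<open>inc l\<close>.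
\<close>

type_synonym vertex = "int \<times> nat"

datatype edge = Inner int nat | Cross int nat nat

definition graph_verts :: "nat \<Rightarrow> vertex set" where
  "graph_verts K = UNIV \<times> {1..K}"

definition graph_edges :: "nat \<Rightarrow> (nat \<times> nat) set \<Rightarrow> edge set" where
  "graph_edges L J = {Inner n l | n l. l \<in> {1..L}} \<union> {Cross n i j | n i j. (i, j) \<in> J}"

fun edge_ends :: "(nat \<Rightarrow> nat set) \<Rightarrow> edge \<Rightarrow> vertex set" where
  "edge_ends inc (Inner n l) = Pair n ` inc l"
| "edge_ends inc (Cross n i j) = {(n, i), (n + 1, j)}"

text \<open>
  Connectedness of the whole periodic graph needs no separate assumption: the copies are connected
  and \<open>J \<noteq> {}\<close>.
\<close>

definition essentially_1d_periodic ::
    "nat \<Rightarrow> nat \<Rightarrow> (nat \<Rightarrow> nat set) \<Rightarrow> (nat \<times> nat) set \<Rightarrow> bool" where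
  "essentially_1d_periodic K L inc J \<longleftrightarrow>
     (\<forall>l\<in>{1..L}. \<exists>i\<in>{1..K}. \<exists>j\<in>{1..K}. inc l = {i, j}) \<and>
     connected_graph {1..K} {1..L} inc \<and>
     J \<subseteq> {1..K} \<times> {1..K} \<and> J \<noteq> {}"

definition edges_within ::
    "nat \<Rightarrow> (nat \<Rightarrow> nat set) \<Rightarrow> (nat \<times> nat) set \<Rightarrow> nat \<Rightarrow> edge set" where
  "edges_within L inc J m =
     {e \<in> graph_edges L J.
        fst ` edge_ends inc e \<subseteq> {- int m..int m} \<and>
        \<not> fst ` edge_ends inc e \<subseteq> {- int m} \<and>
        \<not> fst ` edge_ends inc e \<subseteq> {int m}}"


text \<open>
  The sum runs over the set of edges of the path, so repeated edges count once. The real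
  infimum is the intended one when the graph is connected, \<open>U\<close> and \<open>W\<close> contain vertices and the
  passage times are non-negative: the set of values is then nonempty and bounded below.
\<close>

definition passage_time ::
    "'v set \<Rightarrow> 'e set \<Rightarrow> ('e \<Rightarrow> 'v set) \<Rightarrow> ('e \<Rightarrow> real) \<Rightarrow> 'v set \<Rightarrow> 'v set \<Rightarrow> real" where
  "passage_time V E ends \<tau> U W =
     Inf {sum \<tau> (set es) | vs es. is_path V E ends vs es \<and> hd vs \<in> U \<and> last vs \<in> W}"

definition wet_region ::
    "'v set \<Rightarrow> 'e set \<Rightarrow> ('e \<Rightarrow> 'v set) \<Rightarrow> ('e \<Rightarrow> real) \<Rightarrow> 'v set \<Rightarrow> real \<Rightarrow> 'v set" where
  "wet_region V E ends \<tau> U t = {v \<in> V. passage_time V E ends \<tau> U {v} \<le> t}"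


definition lebesgue_decomposition :: "real measure \<Rightarrow> real measure \<Rightarrow> real measure \<Rightarrow> bool" where
  "lebesgue_decomposition P A S \<longleftrightarrow>
     sets A = sets borel \<and> sets S = sets borel \<and>
     (\<forall>X\<in>sets borel. emeasure P X = emeasure A X + emeasure S X) \<and>
     absolutely_continuous lborel A \<and>
     (\<exists>N\<in>null_sets lborel. emeasure S (UNIV - N) = 0)"

text \<open>The decomposition of a probability measure is unique, so \<open>\<exists>\<close> speaks about the decomposition.\<close>

definition has_ac_component :: "real measure \<Rightarrow> bool" where
  "has_ac_component P \<longleftrightarrow> (\<exists>A S. lebesgue_decomposition P A S \<and> emeasure A UNIV \<noteq> 0)"

definition is_coupling :: "'a measure \<Rightarrow> 'b measure \<Rightarrow> ('a \<times> 'b) measure \<Rightarrow> bool" where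
  "is_coupling M N Q \<longleftrightarrow>
     sets Q = sets (M \<Otimes>\<^sub>M N) \<and> distr Q M fst = M \<and> distr Q N snd = N"

text \<open>
  A coupling of the families on \<open>F\<close> when the families on \<open>D\<close> are given: a probability kernel which
  sends the pair \<open>(a, a')\<close> of families on \<open>D\<close> to a coupling of the two laws on \<open>F\<close>. The law on \<open>F\<close>
  of each single family is thus the product law whatever \<open>(a, a')\<close> is; only the dependence between
  the two families on \<open>F\<close> may be adjusted to \<open>(a, a')\<close>.
\<close>

definition coupling_given ::
    "real measure \<Rightarrow> 'e set \<Rightarrow> 'e set
      \<Rightarrow> (('e \<Rightarrow> real) \<times> ('e \<Rightarrow> real) \<Rightarrow> (('e \<Rightarrow> real) \<times> ('e \<Rightarrow> real)) measure) \<Rightarrow> bool" where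
  "coupling_given P D F \<kappa> \<longleftrightarrow>
     \<kappa> \<in> PiM D (\<lambda>_. P) \<Otimes>\<^sub>M PiM D (\<lambda>_. P) \<rightarrow>\<^sub>M
         prob_algebra (PiM F (\<lambda>_. P) \<Otimes>\<^sub>M PiM F (\<lambda>_. P)) \<and>
     (\<forall>x\<in>space (PiM D (\<lambda>_. P) \<Otimes>\<^sub>M PiM D (\<lambda>_. P)).
        is_coupling (PiM F (\<lambda>_. P)) (PiM F (\<lambda>_. P)) (\<kappa> x))"

text \<open>
  The joint law of the two full families on \<open>D \<union> F\<close>, when those on \<open>D\<close> have joint law \<open>Q\<close> and those
  on \<open>F\<close> are then drawn from the kernel \<open>\<kappa>\<close>.
\<close>

definition joint_law ::
    "real measure \<Rightarrow> 'e set \<Rightarrow> 'e set \<Rightarrow> (('e \<Rightarrow> real) \<times> ('e \<Rightarrow> real)) measure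
      \<Rightarrow> (('e \<Rightarrow> real) \<times> ('e \<Rightarrow> real) \<Rightarrow> (('e \<Rightarrow> real) \<times> ('e \<Rightarrow> real)) measure)
      \<Rightarrow> (('e \<Rightarrow> real) \<times> ('e \<Rightarrow> real)) measure" where
  "joint_law P D F Q \<kappa> =
     Q \<bind> (\<lambda>(a, a'). distr (\<kappa> (a, a'))
                    (PiM (D \<union> F) (\<lambda>_. P) \<Otimes>\<^sub>M PiM (D \<union> F) (\<lambda>_. P))
                    (\<lambda>(b, b'). (merge D F (a, b), merge D F (a', b'))))"

end

theory Submission
  imports Defs
begin


text \<open>
  Far out on either side of the graph, the difference \<open>T(I, v) - T'(I', v)\<close> of the two passage times
  does not depend on \<open>v\<close>. A coupling that steers these two constants to zero therefore makes the
  passage times agree at all but finitely many vertices, and once those vertices are wet in both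
  processes the wet regions agree as well (\<open>coalesce_wet\<close>).

  Gates. The absolutely continuous component contains two separated pieces of positive mass: there
  are \<open>\<alpha> < \<beta>0 \<le> \<beta>1\<close> such that times in \<open>[0, \<alpha>]\<close> and times in \<open>[\<beta>0, \<beta>1]\<close> both have positive
  probability. In a long block of consecutive levels choose a walk across the block with the fewest
  edges. If its edges take times at most \<open>\<alpha>\<close> and all other edges of the block take times in
  \<open>[\<beta>0, \<beta>1]\<close>, then every crossing of the block can be rerouted through an inner edge \<open>e\<close> of that
  walk without loss (\<open>block_gate\<close>): staying off the walk saves no edges, and every edge off the walk
  costs \<open>\<beta>0 - \<alpha>\<close> more. Hence \<open>T(I, v) = T(I, x) + \<tau> e + T(y, v)\<close> for the ends \<open>x\<close>, \<open>y\<close> of \<open>e\<close> whenever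
  \<open>I\<close> and \<open>v\<close> lie on different sides. Consequently a change of \<open>\<tau> e\<close> within \<open>[0, \<alpha>]\<close> shifts all
  passage times beyond the gate by the same amount and none in front of it (\<open>update_change\<close>), and
  two processes that see the same times beyond a gate have a constant difference there
  (\<open>change_far\<close>).

  The coupling. Both families use the same times outside \<open>E_m\<close>, except at gates. Let \<open>D\<close> be the
  constant difference on one side when all these times are equal, and write \<open>D = n \<delta>\<close> with an
  integer \<open>n\<close> and a small \<open>\<delta> > 0\<close>. At a gate the second family uses \<open>\<tau> e\<close>, \<open>\<tau> e + \<delta>\<close> or \<open>\<tau> e - \<delta>\<close>, the
  last two being equally likely; the difference then performs \<open>\<delta>\<close> times a lazy symmetric walk
  started at \<open>n\<close>. Such a walk hits zero almost surely (\<open>AE_hits\<close>), and from then on the second family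
  copies the first one. To change a time \<open>t\<close> to \<open>t + \<delta>\<close> without changing its law, the absolutely
  continuous component is used once more: on some compact set of positive Lebesgue measure, \<open>P\<close>
  dominates a multiple of Lebesgue measure, and for small \<open>\<delta>\<close> this set overlaps with its translate
  by \<open>\<delta>\<close> (\<open>positive_overlap\<close>), so that \<open>t\<close> and \<open>t + \<delta>\<close> can be interchanged (\<open>swap_preserves_marked\<close>).

  The second family has the right law although the number of interchanges depends on everything
  that happens: by the reflection principle, reversing the steps of a walk up to the first visit to
  \<open>n\<close> gives a walk that first visits \<open>- n\<close> at the same time (\<open>reflect_pres\<close>). The two sides of the graph
  do not disturb each other, since an interchange on one side leaves the passage times on the other
  side alone.
\<close>

section \<open>Walks within a budget\<close>

text \<open>
  A budget formulation of path costs. An edge that is used twice is paid twice, so that budgets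
  add up when walks are joined. This does not change the infimum over all walks, because loops can
  be cut out: see \<open>passage_time_eq_fpt\<close>.
\<close>

inductive reach :: "('e \<Rightarrow> 'v set) \<Rightarrow> 'e set \<Rightarrow> ('e \<Rightarrow> real) \<Rightarrow> 'v \<Rightarrow> 'v \<Rightarrow> real \<Rightarrow> bool"
  for ends S \<tau> u where
  stay: "0 \<le> c \<Longrightarrow> reach ends S \<tau> u u c"
| extend: "reach ends S \<tau> u v c \<Longrightarrow> f \<in> S \<Longrightarrow> ends f = {v, w} \<Longrightarrow> c + \<tau> f \<le> c' \<Longrightarrow>
    reach ends S \<tau> u w c'"

lemma reach_mono:
  assumes "reach ends S \<tau> u v c" "c \<le> c'" "S \<subseteq> S'" "\<And>f. f \<in> S \<Longrightarrow> \<tau>' f = \<tau> f"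
  shows "reach ends S' \<tau>' u v c'"
proof -
  have "\<forall>c'\<ge>c. reach ends S' \<tau>' u v c'"
    using assms(1)
  proof induction
    case (stay c) then show ?case by (auto intro: reach.stay)
  next
    case (extend v c f w c1)
    have "reach ends S' \<tau>' u w c'" if "c1 \<le> c'" for c'
      by (rule reach.extend[of _ _ _ _ v c f]) (use extend that assms in auto)
    then show ?case by blast
  qed
  then show ?thesis using assms by blast
qed

lemma reach_nonneg:
  assumes "reach ends S \<tau> u v c" "\<And>f. f \<in> S \<Longrightarrow> 0 \<le> \<tau> f"
  shows "0 \<le> c"
  using assms by (induction) (auto, smt (verit, best))

lemma reach_trans:
  assumes "reach ends S \<tau> v w c'" "reach ends S \<tau> u v c"
  shows "reach ends S \<tau> u w (c + c')"
  using assms(1)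
proof induction
  case (stay c') then show ?case using reach_mono[OF assms(2)] by auto
next
  case (extend v' c1 f w c2)
  show ?case by (rule reach.extend[OF extend(5,2,3)]) (use extend in auto)
qed

lemma reach_edge: "f \<in> S \<Longrightarrow> ends f = {v, w} \<Longrightarrow> \<tau> f \<le> c \<Longrightarrow> reach ends S \<tau> v w c"
  by (rule reach.extend[OF reach.stay[of 0]]) auto

lemma reach_sym: "reach ends S \<tau> u v c \<Longrightarrow> reach ends S \<tau> v u c"
proof (induction rule: reach.induct)
  case (stay c) then show ?case by (rule reach.stay)
next
  case (extend v c f w c')
  have "reach ends S \<tau> w v (\<tau> f)"
    using extend by (intro reach_edge[of f]) auto
  from reach_trans[OF extend(5) this] show ?case
    by (rule reach_mono) (use extend in auto)
qed

definition avoid :: "('e \<Rightarrow> 'v set) \<Rightarrow> 'e set \<Rightarrow> 'v set \<Rightarrow> 'e set" where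
  "avoid ends E A = {f \<in> E. ends f \<inter> A = {}}"

lemma reach_avoid_or_visit:
  assumes "reach ends E \<tau> u v c" "u \<notin> B"
  shows "(v \<notin> B \<and> reach ends (avoid ends E B) \<tau> u v c) \<or>
    (\<exists>b\<in>B. \<exists>c1 c2. reach ends E \<tau> u b c1 \<and> reach ends E \<tau> b v c2 \<and> c1 + c2 \<le> c)"
  using assms(1)
proof induction
  case (stay c) then show ?case using assms by (auto intro: reach.stay)
next
  case (extend v c f w c')
  consider "v \<notin> B" "reach ends (avoid ends E B) \<tau> u v c" "w \<notin> B" |
    "w \<in> B" |
    b c1 c2 where "b\<in>B" "reach ends E \<tau> u b c1" "reach ends E \<tau> b v c2" "c1 + c2 \<le> c"
    using extend.IH by blast
  then show ?case
  proof cases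
    case 1
    then have "reach ends (avoid ends E B) \<tau> u w c'"
      by (intro reach.extend[OF 1(2) _ extend(3,4)]) (use extend in \<open>auto simp: avoid_def\<close>)
    then show ?thesis using 1 by blast
  next
    case 2
    have "reach ends E \<tau> u w c'" by (rule reach.extend[OF extend(1,2,3,4)])
    then show ?thesis using 2 reach.stay[of 0 ends E \<tau> w] by (metis add.right_neutral order.refl)
  next
    case 3
    have "reach ends E \<tau> b w (c2 + \<tau> f)" by (rule reach.extend[OF 3(3) extend(2,3)]) auto
    then show ?thesis using 3 extend(4) by (intro disjI2 bexI[of _ b] exI[of _ c1] exI[of _ "c2+\<tau> f"]) auto
  qed
qed

section \<open>Gates\<close>

text \<open>
  A walk from \<open>A\<close> to \<open>B\<close> can be replaced by one that stays off \<open>B\<close> until it uses \<open>e\<close> from \<open>x\<close> to \<open>y\<close>, and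
  off \<open>A\<close> afterwards. The first part then depends only on the times in front of the gate, the second
  part only on those beyond it. The notion is symmetric under exchange of the two sides, so a gate
  serves both ends of the graph.
\<close>

definition gate ::
    "('e \<Rightarrow> 'v set) \<Rightarrow> 'e set \<Rightarrow> ('e \<Rightarrow> real) \<Rightarrow> 'e \<Rightarrow> 'v \<Rightarrow> 'v \<Rightarrow> 'v set \<Rightarrow> 'v set \<Rightarrow> bool" where
  "gate ends E \<tau> e x y A B \<longleftrightarrow>
     e \<in> E \<and> ends e = {x, y} \<and> x \<in> A \<and> y \<in> B \<and> A \<inter> B = {} \<and> (\<forall>f\<in>E. 0 \<le> \<tau> f) \<and>
     (\<forall>u\<in>A. \<forall>w\<in>B. \<forall>c. reach ends E \<tau> u w c \<longrightarrow>
        (\<exists>c1 c2. reach ends (avoid ends E B) \<tau> u x c1 \<and>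
                 reach ends (avoid ends E A) \<tau> y w c2 \<and> c1 + \<tau> e + c2 \<le> c))"

lemma gate_sym: "gate ends E \<tau> e x y A B \<Longrightarrow> gate ends E \<tau> e y x B A"
proof -
  assume g: "gate ends E \<tau> e x y A B"
  have "\<exists>c1 c2. reach ends (avoid ends E A) \<tau> u y c1 \<and> reach ends (avoid ends E B) \<tau> x w c2
      \<and> c1 + \<tau> e + c2 \<le> c"
    if uw: "u \<in> B" "w \<in> A" "reach ends E \<tau> u w c" for u w c
  proof -
    obtain c1 c2 where "reach ends (avoid ends E B) \<tau> w x c1" "reach ends (avoid ends E A) \<tau> y u c2"
      "c1 + \<tau> e + c2 \<le> c"
      using g uw(1,2) reach_sym[OF uw(3)] unfolding gate_def by blast
    then show ?thesis by (intro exI[of _ c2] exI[of _ c1]) (auto intro: reach_sym)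
  qed
  then show ?thesis using g unfolding gate_def by blast
qed

text \<open>
  An excursion to the other side comes to \<open>x\<close> before and after it. Cutting it out there only saves.
\<close>

lemma gate_same_side:
  assumes g: "gate ends E \<tau> e x y A B" and "u \<in> A" "w \<in> A" "reach ends E \<tau> u w c"
  shows "reach ends (avoid ends E B) \<tau> u w c"
proof -
  have nn: "f \<in> E \<Longrightarrow> 0 \<le> \<tau> f" for f using g by (auto simp: gate_def)
  have "u \<notin> B" using g assms by (auto simp: gate_def)
  from reach_avoid_or_visit[OF assms(4) this] show ?thesis
  proof (elim disjE bexE exE conjE)
    fix b c1 c2 assume b: "b \<in> B" "reach ends E \<tau> u b c1" "reach ends E \<tau> b w c2" "c1 + c2 \<le> c"
    obtain p1 p2 where p: "reach ends (avoid ends E B) \<tau> u x p1" "reach ends (avoid ends E A) \<tau> y b p2"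
      "p1 + \<tau> e + p2 \<le> c1"
      using g b assms unfolding gate_def by blast
    obtain q1 q2 where q: "reach ends (avoid ends E B) \<tau> w x q1" "reach ends (avoid ends E A) \<tau> y b q2"
      "q1 + \<tau> e + q2 \<le> c2"
      using g b assms reach_sym[OF b(3)] unfolding gate_def by blast
    have "0 \<le> p2" "0 \<le> q2" "0 \<le> \<tau> e"
      using reach_nonneg[OF p(2)] reach_nonneg[OF q(2)] nn g by (auto simp: avoid_def gate_def)
    then show ?thesis
      using reach_mono[OF reach_trans[OF reach_sym[OF q(1)] p(1)], of c] p(3) q(3) b(4) by auto
  qed
qed

text \<open>
  The jump lies between the last exit from \<open>A\<close> and the first entry into \<open>B\<close> after it.
\<close>

lemma jump_decomposition:
  assumes "reach ends H \<tau> u w c" "u \<in> A" "w \<in> B" "A \<inter> B = {}"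
  defines "X \<equiv> {f \<in> H. \<not> ends f \<subseteq> A \<and> \<not> ends f \<subseteq> B}"
  shows "\<exists>a\<in>A. \<exists>b\<in>B. \<exists>c1 c2 c3. reach ends H \<tau> u a c1 \<and> reach ends X \<tau> a b c2 \<and>
    reach ends (avoid ends H A) \<tau> b w c3 \<and> c1 + c2 + c3 \<le> c"
proof -
  have "w \<in> A \<or>
    (w \<notin> A \<and> w \<notin> B \<and> (\<exists>a\<in>A. \<exists>c1 c2. reach ends H \<tau> u a c1 \<and> reach ends X \<tau> a w c2 \<and> c1 + c2 \<le> c)) \<or>
    (w \<notin> A \<and> (\<exists>a\<in>A. \<exists>b\<in>B. \<exists>c1 c2 c3. reach ends H \<tau> u a c1 \<and> reach ends X \<tau> a b c2 \<and>
      reach ends (avoid ends H A) \<tau> b w c3 \<and> c1 + c2 + c3 \<le> c))"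
    using assms(1)
  proof induction
    case (stay c) then show ?case using assms by auto
  next
    case (extend v c f w c')
    have finish: ?case if "w \<notin> A" "a \<in> A" "reach ends H \<tau> u a c1" "reach ends X \<tau> a v c2" "c1 + c2 \<le> c"
      "f \<in> X" for a c1 c2
    proof -
      have r: "reach ends X \<tau> a w (c2 + \<tau> f)" by (rule reach.extend[OF that(4,6) extend(3)]) simp
      show ?thesis
      proof (cases "w \<in> B")
        case True
        have "c1 + (c2 + \<tau> f) + 0 \<le> c'" using that extend(4) by auto
        then show ?thesis using True that(1,2,3) r reach.stay[of 0 ends "avoid ends H A" \<tau> w] by blast
      next
        case False
        have "c1 + (c2 + \<tau> f) \<le> c'" using that extend(4) by auto
        then show ?thesis using False that(1,2,3) r by blast
      qed
    qed
    consider "w \<in> A" | "w \<notin> A" "v \<in> A" |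
      a c1 c2 where "w \<notin> A" "v \<notin> A" "v \<notin> B" "a \<in> A" "reach ends H \<tau> u a c1" "reach ends X \<tau> a v c2" "c1 + c2 \<le> c" |
      a b c1 c2 c3 where "w \<notin> A" "v \<notin> A" "a \<in> A" "b \<in> B" "reach ends H \<tau> u a c1" "reach ends X \<tau> a b c2"
        "reach ends (avoid ends H A) \<tau> b v c3" "c1 + c2 + c3 \<le> c"
      using extend.IH by blast
    then show ?case
    proof cases
      case 1 then show ?thesis by blast
    next
      case 2
      show ?thesis
        by (rule finish[OF 2 extend(1) reach.stay[of 0]]) (use 2 extend assms(4) in \<open>auto simp: X_def\<close>)
    next
      case 3
      show ?thesis by (rule finish[OF 3(1,4-7)]) (use 3 extend in \<open>auto simp: X_def\<close>)
    next
      case 4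
      have "reach ends (avoid ends H A) \<tau> b w (c3 + \<tau> f)"
        by (rule reach.extend[OF 4(7) _ extend(3)]) (use 4 extend in \<open>auto simp: avoid_def\<close>)
      moreover have "c1 + c2 + (c3 + \<tau> f) \<le> c'" using 4(8) extend(4) by auto
      ultimately show ?thesis using 4(1,3-6) by blast
    qed
  qed
  then show ?thesis using assms by blast
qed

text \<open>
  Only the jumps that do not use \<open>e\<close> have to be rerouted. They settle all walks without \<open>e\<close>; cutting at
  the last exit from \<open>A\<close> gives a second part off \<open>A\<close>, and the same argument with the sides exchanged
  gives a first part off \<open>B\<close>. A walk that uses \<open>e\<close> is cut at this edge. If it uses \<open>e\<close> from \<open>y\<close> to \<open>x\<close>,
  it has reached \<open>y\<close>, at the expense of a jump, and could have reached \<open>x\<close> for less.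
\<close>

lemma gateI:
  fixes ends :: "'e \<Rightarrow> 'v set" and E :: "'e set"
  assumes e: "e \<in> E" "ends e = {x, y}" and xy: "x \<in> A" "y \<in> B" "A \<inter> B = {}"
    and nn: "\<And>f. f \<in> E \<Longrightarrow> 0 \<le> \<tau> f" and al: "\<tau> e \<le> \<alpha>"
  defines "H \<equiv> E - {e}"
  defines "X \<equiv> {f \<in> H. \<not> ends f \<subseteq> A \<and> \<not> ends f \<subseteq> B}"
  assumes jump: "\<And>a b c. a \<in> A \<Longrightarrow> b \<in> B \<Longrightarrow> reach ends X \<tau> a b c \<Longrightarrow>
      \<exists>c1 c2. reach ends (avoid ends E B) \<tau> a x c1 \<and> reach ends (avoid ends E A) \<tau> y b c2 \<and> c1 + \<alpha> + c2 \<le> c"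
  shows "gate ends E \<tau> e x y A B"
proof -
  have sub: "avoid ends E A \<subseteq> H" "avoid ends E B \<subseteq> H" "avoid ends H A = avoid ends E A" "avoid ends H B = avoid ends E B"
    using e xy by (auto simp: avoid_def H_def)
  have X': "X = {f \<in> H. \<not> ends f \<subseteq> B \<and> \<not> ends f \<subseteq> A}" by (auto simp: X_def)
  have right: "\<exists>c1 c2. reach ends H \<tau> u x c1 \<and> reach ends (avoid ends E A) \<tau> y w c2 \<and> c1 + \<alpha> + c2 \<le> c"
    if uw: "u \<in> A" "w \<in> B" "reach ends H \<tau> u w c" for u w c
  proof -
    obtain a b c1 c2 c3 where d: "a \<in> A" "b \<in> B" "reach ends H \<tau> u a c1" "reach ends X \<tau> a b c2"
      "reach ends (avoid ends E A) \<tau> b w c3" "c1 + c2 + c3 \<le> c"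
      using jump_decomposition[OF uw(3,1,2) xy(3)] unfolding X_def sub by blast
    obtain d1 d2 where "reach ends (avoid ends E B) \<tau> a x d1" "reach ends (avoid ends E A) \<tau> y b d2" "d1 + \<alpha> + d2 \<le> c2"
      using jump[OF d(1,2,4)] by blast
    note d12 = this
    have "reach ends H \<tau> a x d1" by (rule reach_mono[OF d12(1) order.refl sub(2)]) simp
    note r1 = reach_trans[OF this d(3)] and r2 = reach_trans[OF d(5) d12(2)]
    show ?thesis using d(6) d12(3)
      by (intro exI[of _ "c1 + d1"] exI[of _ "d2 + c3"])
        (use r1 r2 in auto)
  qed
  have left: "\<exists>c1 c2. reach ends (avoid ends E B) \<tau> u x c1 \<and> reach ends H \<tau> y w c2 \<and> c1 + \<alpha> + c2 \<le> c"
    if uw: "u \<in> A" "w \<in> B" "reach ends H \<tau> u w c" for u w c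
  proof -
    obtain b a c1 c2 c3 where d: "b \<in> B" "a \<in> A" "reach ends H \<tau> w b c1" "reach ends X \<tau> b a c2"
      "reach ends (avoid ends E B) \<tau> a u c3" "c1 + c2 + c3 \<le> c"
      using jump_decomposition[OF reach_sym[OF uw(3)] uw(2,1)] xy(3) unfolding X' sub by blast
    obtain d1 d2 where "reach ends (avoid ends E B) \<tau> a x d1" "reach ends (avoid ends E A) \<tau> y b d2" "d1 + \<alpha> + d2 \<le> c2"
      using jump[OF d(2,1) reach_sym[OF d(4)]] by blast
    note d12 = this
    have "reach ends H \<tau> y b d2" by (rule reach_mono[OF d12(2) order.refl sub(1)]) simp
    note r1 = reach_trans[OF d12(1) reach_sym[OF d(5)]] and r2 = reach_trans[OF reach_sym[OF d(3)] this]
    show ?thesis using d(6) d12(3)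
      by (intro exI[of _ "c3 + d1"] exI[of _ "d2 + c1"])
        (use r1 r2 in auto)
  qed
  have al0: "0 \<le> \<alpha>" "0 \<le> \<tau> e" using nn[OF e(1)] al by auto
  have nnH: "0 \<le> c" if "reach ends H \<tau> u w c" for u w c
    using reach_nonneg[OF that] nn by (auto simp: H_def)
  have nnA: "0 \<le> c" if "reach ends (avoid ends E D) \<tau> u w c" for u w c D
    using reach_nonneg[OF that] nn by (auto simp: avoid_def)
  \<comment> \<open>Following the walk edge by edge, it can be kept, without higher cost, in one of two forms: no use of e, or exactly one, from x to y.\<close>
  have stop: "reach ends H \<tau> u w c \<or>
      (\<exists>c1 c2. reach ends H \<tau> u x c1 \<and> reach ends H \<tau> y w c2 \<and> c1 + \<tau> e + c2 \<le> c)"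
    if "u \<in> A" "reach ends E \<tau> u w c" for u w c
    using that(2)
  proof induction
    case (stay c) then show ?case by (auto intro: reach.stay)
  next
    case (extend v c f w c')
    show ?case
    proof (cases "f = e")
      case False
      then have fH: "f \<in> H" using extend by (auto simp: H_def)
      from extend.IH show ?thesis
      proof (elim disjE exE conjE)
        assume "reach ends H \<tau> u v c"
        from reach.extend[OF this fH extend(3,4)] show ?thesis by blast
      next
        fix c1 c2 assume *: "reach ends H \<tau> u x c1" "reach ends H \<tau> y v c2" "c1 + \<tau> e + c2 \<le> c"
        have "reach ends H \<tau> y w (c2 + \<tau> f)" by (rule reach.extend[OF *(2) fH extend(3)]) simp
        then show ?thesis using *(1,3) extend(4)
          by (intro disjI2 exI[of _ c1] exI[of _ "c2 + \<tau> f"]) auto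
      qed
    next
      case True
      then have vw: "(v = x \<and> w = y) \<or> (v = y \<and> w = x)" using extend(3) e by (auto simp: doubleton_eq_iff)
      have tx: "\<exists>c1. reach ends H \<tau> u x c1 \<and> c1 \<le> c"
        using extend.IH
      proof (elim disjE exE conjE)
        assume r: "reach ends H \<tau> u v c"
        show ?thesis
        proof (cases "v = x")
          case True then show ?thesis using r by auto
        next
          case False
          then have "reach ends H \<tau> u y c" using r vw by auto
          with right[OF that(1) xy(2)] obtain c1 c2 where "reach ends H \<tau> u x c1"
            "reach ends (avoid ends E A) \<tau> y y c2" "c1 + \<alpha> + c2 \<le> c" by blast
          with al0 nnA[of A y y c2] show ?thesis by (intro exI[of _ c1]) auto
        qed
      next
        fix c1 c2 assume *: "reach ends H \<tau> u x c1" "reach ends H \<tau> y v c2" "c1 + \<tau> e + c2 \<le> c"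
        with al0 nnH[of y v c2] show ?thesis by (intro exI[of _ c1]) auto
      qed
      then obtain c1 where c1: "reach ends H \<tau> u x c1" "c1 \<le> c" by blast
      from vw show ?thesis
      proof (elim disjE conjE)
        assume "w = y"
        then show ?thesis using c1 extend(4) True reach.stay[of 0 ends H \<tau> y]
          by (intro disjI2 exI[of _ c1] exI[of _ 0]) auto
      next
        assume "w = x"
        then show ?thesis using c1 extend(4) True al0 by (auto elim!: reach_mono)
      qed
    qed
  qed
  have "\<exists>c1 c2. reach ends (avoid ends E B) \<tau> u x c1 \<and> reach ends (avoid ends E A) \<tau> y w c2 \<and> c1 + \<tau> e + c2 \<le> c"
    if uw: "u \<in> A" "w \<in> B" "reach ends E \<tau> u w c" for u w c
  proof -
    obtain c1 c2 where c: "reach ends H \<tau> u x c1" "reach ends H \<tau> y w c2" "c1 + \<tau> e + c2 \<le> c"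
    proof -
      from stop[OF uw(1,3)] show ?thesis
      proof (elim disjE exE conjE)
        assume "reach ends H \<tau> u w c"
        from right[OF uw(1,2) this] obtain c1 c2 where "reach ends H \<tau> u x c1"
          "reach ends (avoid ends E A) \<tau> y w c2" "c1 + \<alpha> + c2 \<le> c" by blast
        moreover from this(2) have "reach ends H \<tau> y w c2" by (rule reach_mono[OF _ order.refl sub(1)]) simp
        ultimately show ?thesis using al by (intro that[of c1 c2]) auto
      qed (rule that)
    qed
    have "reach ends (avoid ends H B) \<tau> u x c1"
    proof -
      have "u \<notin> B" using uw xy by auto
      from reach_avoid_or_visit[OF c(1) this] show ?thesis
      proof (elim disjE bexE exE conjE)
        fix b p q assume b: "b \<in> B" "reach ends H \<tau> u b p" "reach ends H \<tau> b x q" "p + q \<le> c1"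
        from left[OF uw(1) b(1,2)] obtain p1 p2 where "reach ends (avoid ends E B) \<tau> u x p1"
          "reach ends H \<tau> y b p2" "p1 + \<alpha> + p2 \<le> p" by blast
        with nnH[OF this(2)] nnH[OF b(3)] al0 b(4) show ?thesis
          unfolding sub by (auto elim!: reach_mono)
      qed
    qed
    moreover have "reach ends (avoid ends H A) \<tau> y w c2"
    proof -
      have "y \<notin> A" using xy by auto
      from reach_avoid_or_visit[OF c(2) this] show ?thesis
      proof (elim disjE bexE exE conjE)
        fix b p q assume b: "b \<in> A" "reach ends H \<tau> y b p" "reach ends H \<tau> b w q" "p + q \<le> c2"
        from right[OF b(1) uw(2) b(3)] obtain p1 p2 where "reach ends H \<tau> b x p1"
          "reach ends (avoid ends E A) \<tau> y w p2" "p1 + \<alpha> + p2 \<le> q" by blast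
        with nnH[OF this(1)] nnH[OF b(2)] al0 b(4) show ?thesis
          unfolding sub by (auto elim!: reach_mono)
      qed
    qed
    ultimately show ?thesis using c(3) unfolding sub by blast
  qed
  then show ?thesis using e xy nn unfolding gate_def by blast
qed


section \<open>First-passage times as infima over walks\<close>

fun walk :: "('e \<Rightarrow> 'v set) \<Rightarrow> 'e set \<Rightarrow> 'v \<Rightarrow> ('e \<times> 'v) list \<Rightarrow> 'v \<Rightarrow> bool" where
  "walk ends S u [] v \<longleftrightarrow> u = v"
| "walk ends S u ((f, w) # p) v \<longleftrightarrow> f \<in> S \<and> ends f = {u, w} \<and> walk ends S w p v"

definition cost :: "('e \<Rightarrow> real) \<Rightarrow> ('e \<times> 'v) list \<Rightarrow> real" where
  "cost \<tau> p = (\<Sum>(f, w)\<leftarrow>p. \<tau> f)"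

lemma cost_simps [simp]: "cost \<tau> [] = 0" "cost \<tau> ((f, w) # p) = \<tau> f + cost \<tau> p"
  "cost \<tau> (p @ q) = cost \<tau> p + cost \<tau> q"
  by (auto simp: cost_def)

lemma walk_append: "walk ends S u (p @ q) v \<longleftrightarrow> (\<exists>w. walk ends S u p w \<and> walk ends S w q v)"
  by (induction ends S u p v rule: walk.induct) auto

lemma reach_walk: "walk ends S u p v \<Longrightarrow> reach ends S \<tau> u v (cost \<tau> p)"
proof (induction ends S u p v rule: walk.induct)
  case (1 ends S u v) then show ?case by (auto intro: reach.stay)
next
  case (2 ends S u f w p v)
  then show ?case using reach_trans[OF _ reach_edge[of f S ends u w \<tau> "\<tau> f"]] by auto
qed

lemma reach_iff_walk: "reach ends S \<tau> u v c \<longleftrightarrow> (\<exists>p. walk ends S u p v \<and> cost \<tau> p \<le> c)"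
proof
  show "reach ends S \<tau> u v c \<Longrightarrow> \<exists>p. walk ends S u p v \<and> cost \<tau> p \<le> c"
  proof (induction rule: reach.induct)
    case (stay c) then show ?case by (intro exI[of _ "[]"]) auto
  next
    case (extend v c f w c')
    then obtain p where "walk ends S u p v" "cost \<tau> p \<le> c" by blast
    with extend show ?case by (intro exI[of _ "p @ [(f, w)]"]) (auto simp: walk_append)
  qed
qed (auto intro: reach_mono[OF reach_walk])

text \<open>
  If the first edge occurs again later, either the whole loop up to that occurrence or everything
  between the two uses can be omitted.
\<close>

lemma walk_distinct:
  assumes "walk ends S u p v"
  shows "\<exists>q. walk ends S u q v \<and> distinct (map fst q) \<and> set (map fst q) \<subseteq> set (map fst p)"
  using assms
proof (induction ends S u p v rule: walk.induct)
  case (1 ends S u v) then show ?case by (intro exI[of _ "[]"]) auto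
next
  case (2 ends S u f w p v)
  then obtain q where q: "walk ends S w q v" "distinct (map fst q)" "set (map fst q) \<subseteq> set (map fst p)"
    by auto
  show ?case
  proof (cases "f \<in> set (map fst q)")
    case False
    with 2 q show ?thesis by (intro exI[of _ "(f, w) # q"]) auto
  next
    case True
    then obtain z q1 q2 where q12: "q = q1 @ (f, z) # q2" by (auto simp: in_set_conv_decomp)
    then have z: "walk ends S z q2 v" "z = u \<or> z = w"
      using q 2 by (auto simp: walk_append doubleton_eq_iff)
    then show ?thesis
    proof (elim disjE)
      assume "z = u" with z q q12 show ?thesis by (intro exI[of _ q2]) auto
    next
      assume "z = w" with z q q12 2 show ?thesis by (intro exI[of _ "(f, w) # q2"]) auto
    qed
  qed
qed

definition fpt :: "('e \<Rightarrow> 'v set) \<Rightarrow> 'e set \<Rightarrow> ('e \<Rightarrow> real) \<Rightarrow> 'v set \<Rightarrow> 'v \<Rightarrow> real" where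
  "fpt ends E \<tau> U v = (INF p\<in>{p. \<exists>u\<in>U. walk ends E u p v}. cost \<tau> p)"

lemma walk_is_path:
  assumes "walk ends E u p v" "u \<in> V" "\<And>f. f \<in> E \<Longrightarrow> ends f \<subseteq> V"
  shows "is_path V E ends (u # map snd p) (map fst p) \<and> last (u # map snd p) = v"
  using assms
proof (induction ends E u p v rule: walk.induct)
  case (1 ends E u v) then show ?case by (auto simp: is_path_def)
next
  case (2 ends E u f w p v)
  then have "w \<in> V" by auto
  with 2 have "is_path V E ends (w # map snd p) (map fst p) \<and> last (w # map snd p) = v" by auto
  with 2 show ?case by (auto simp: is_path_def nth_Cons split: nat.split)
qed

lemma is_path_walk:
  assumes "is_path V E ends vs es"
  shows "walk ends E (hd vs) (zip es (tl vs)) (last vs) \<and> map fst (zip es (tl vs)) = es"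
  using assms
proof (induction es arbitrary: vs)
  case Nil then show ?case by (cases vs) (auto simp: is_path_def)
next
  case (Cons f es)
  then obtain u w vs' where vs: "vs = u # w # vs'"
    unfolding is_path_def by (metis Suc_length_conv list.size(4) length_Cons)
  have "\<forall>k<length es. ends (es ! k) = {(w # vs') ! k, (w # vs') ! Suc k}"
  proof (intro allI impI)
    fix k assume "k < length es"
    then have "Suc k < length (f # es)" by simp
    with Cons.prems have "ends ((f # es) ! Suc k) = {vs ! Suc k, vs ! Suc (Suc k)}"
      unfolding is_path_def by blast
    then show "ends (es ! k) = {(w # vs') ! k, (w # vs') ! Suc k}" by (simp add: vs)
  qed
  moreover have "ends f = {u, w}" "f \<in> E" using Cons.prems by (auto simp: is_path_def vs)
  moreover have "is_path V E ends (w # vs') es"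
    using Cons.prems calculation(1) by (auto simp: is_path_def vs)
  from Cons.IH[OF this] show ?case using calculation by (auto simp: vs)
qed

lemma Inf_eq_if_dominated:
  fixes X Y :: "real set"
  assumes "\<And>y. y \<in> Y \<Longrightarrow> \<exists>x\<in>X. x \<le> y" "\<And>x. x \<in> X \<Longrightarrow> \<exists>y\<in>Y. y \<le> x"
    and "\<And>x. x \<in> X \<Longrightarrow> a \<le> x"  "\<And>y. y \<in> Y \<Longrightarrow> a \<le> y"
  shows "Inf X = Inf Y"
proof (cases "X = {}")
  case True then show ?thesis using assms(1) by (metis all_not_in_conv)
next
  case False
  then have "Y \<noteq> {}" using assms(2) by blast
  have "bdd_below X" by (rule bdd_belowI[of _ a]) (rule assms(3))
  moreover have "bdd_below Y" by (rule bdd_belowI[of _ a]) (rule assms(4))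
  ultimately have "bdd_below X" "bdd_below Y" .
  with False \<open>Y \<noteq> {}\<close> show ?thesis
    using assms by (intro antisym cInf_mono) auto
qed

lemma cost_nonneg: "walk ends E u p v \<Longrightarrow> (\<And>f. f \<in> E \<Longrightarrow> 0 \<le> \<tau> f) \<Longrightarrow> 0 \<le> cost \<tau> p"
  using reach_nonneg[OF reach_walk] by metis

text \<open>
  Paying an edge once or each time it is used makes no difference for walks without repeated edges,
  and by \<open>walk_distinct\<close> every walk contains such a walk.
\<close>

lemma passage_time_eq_fpt:
  assumes nn: "\<And>f. f \<in> E \<Longrightarrow> 0 \<le> \<tau> f" and V: "\<And>f. f \<in> E \<Longrightarrow> ends f \<subseteq> V" and U: "U \<subseteq> V"
  shows "passage_time V E ends \<tau> U {v} = fpt ends E \<tau> U v"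
  unfolding passage_time_def fpt_def
proof (rule Inf_eq_if_dominated[where a = 0])
  fix y assume "y \<in> cost \<tau> ` {p. \<exists>u\<in>U. walk ends E u p v}"
  then obtain u p where p: "u \<in> U" "walk ends E u p v" "y = cost \<tau> p" by auto
  have pE: "set (map fst p) \<subseteq> E" using p(2)
    by (induction ends E u p v rule: walk.induct) auto
  have c: "cost \<tau> p = sum_list (map \<tau> (map fst p))" by (simp add: cost_def o_def split_def)
  have "sum \<tau> (set (map fst p)) \<le> cost \<tau> p"
    unfolding c using pE by (induction p) (auto simp: sum.insert_if nn add_increasing)
  then show "\<exists>x\<in>{sum \<tau> (set es) |vs es. is_path V E ends vs es \<and> hd vs \<in> U \<and> last vs \<in> {v}}. x \<le> y"
  proof (intro bexI CollectI exI conjI)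
    show "is_path V E ends (u # map snd p) (map fst p)" "last (u # map snd p) \<in> {v}"
      using walk_is_path[OF p(2) _ V] p(1) U by auto
    show "hd (u # map snd p) \<in> U" using p(1) by simp
  qed (simp_all add: p(3))
next
  fix x assume "x \<in> {sum \<tau> (set es) |vs es. is_path V E ends vs es \<and> hd vs \<in> U \<and> last vs \<in> {v}}"
  then obtain vs es where x: "x = sum \<tau> (set es)" "is_path V E ends vs es" "hd vs \<in> U" "last vs = v" by auto
  from is_path_walk[OF x(2)] x(4) have p: "walk ends E (hd vs) (zip es (tl vs)) v" "map fst (zip es (tl vs)) = es"
    by auto
  from walk_distinct[OF p(1)] p(2) obtain q where q: "walk ends E (hd vs) q v" "distinct (map fst q)"
    "set (map fst q) \<subseteq> set es" by auto
  have "cost \<tau> q = sum_list (map \<tau> (map fst q))" by (simp add: cost_def o_def split_def)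
  also have "\<dots> = sum \<tau> (set (map fst q))" using q(2) by (rule sum_list_distinct_conv_sum_set)
  also have "\<dots> \<le> x" unfolding x(1) using q(3) x(2) nn by (intro sum_mono2) (auto simp: is_path_def)
  finally show "\<exists>y\<in>cost \<tau> ` {p. \<exists>u\<in>U. walk ends E u p v}. y \<le> x" using q(1) x(3) by blast
next
  fix x assume "x \<in> {sum \<tau> (set es) |vs es. is_path V E ends vs es \<and> hd vs \<in> U \<and> last vs \<in> {v}}"
  then show "0 \<le> x" using nn by (auto simp: is_path_def intro!: sum_nonneg)
next
  fix y assume "y \<in> cost \<tau> ` {p. \<exists>u\<in>U. walk ends E u p v}"
  then obtain u p where "walk ends E u p v" "y = cost \<tau> p" by auto
  then show "0 \<le> y" using cost_nonneg[OF _ nn] by simp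
qed

lemma fpt_le:
  assumes "reach ends E \<tau> u v c" "u \<in> U" "\<And>f. f \<in> E \<Longrightarrow> 0 \<le> \<tau> f"
  shows "fpt ends E \<tau> U v \<le> c"
proof -
  obtain p where p: "walk ends E u p v" "cost \<tau> p \<le> c" using assms(1) by (auto simp: reach_iff_walk)
  have "fpt ends E \<tau> U v \<le> cost \<tau> p" unfolding fpt_def
    using p assms(2) cost_nonneg[OF _ assms(3)] by (intro cINF_lower) (auto intro!: bdd_belowI[of _ 0])
  with p show ?thesis by simp
qed

lemma le_fptI:
  assumes "\<And>u c. u \<in> U \<Longrightarrow> reach ends E \<tau> u v c \<Longrightarrow> l \<le> c" "u \<in> U" "walk ends E u p v"
  shows "l \<le> fpt ends E \<tau> U v"
  unfolding fpt_def using assms by (intro cINF_greatest) (auto intro: reach_walk)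

lemma fpt_triangle:
  assumes "reach ends E \<tau> v w c" "u \<in> U" "walk ends E u p v" "\<And>f. f \<in> E \<Longrightarrow> 0 \<le> \<tau> f"
  shows "fpt ends E \<tau> U w \<le> fpt ends E \<tau> U v + c"
proof -
  have "fpt ends E \<tau> U w - c \<le> fpt ends E \<tau> U v"
    by (rule le_fptI[OF _ assms(2,3)]) (use fpt_le[OF reach_trans[OF assms(1)] _ assms(4)] in force)
  then show ?thesis by simp
qed

section \<open>First-passage times and gates\<close>

text \<open>
  Walks between vertices of \<open>A\<close> may be kept off \<open>B\<close>, where the two families may differ.
\<close>

lemma gate_fpt_near:
  assumes g: "gate ends E \<tau> e x y A B" and g': "gate ends E \<tau>' e x y A B"
    and eq: "\<And>f. f \<in> avoid ends E B \<Longrightarrow> \<tau> f = \<tau>' f"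
    and U: "U \<subseteq> A" "u \<in> U" "v \<in> A"
    and conn: "\<And>s t. s \<in> A \<union> B \<Longrightarrow> t \<in> A \<union> B \<Longrightarrow> \<exists>p. walk ends E s p t"
  shows "fpt ends E \<tau> U v = fpt ends E \<tau>' U v"
proof -
  have *: "fpt ends E \<tau>' U v \<le> fpt ends E \<tau> U v"
    if g: "gate ends E \<tau> e x y A B" and g': "gate ends E \<tau>' e x y A B"
    and eq: "\<And>f. f \<in> avoid ends E B \<Longrightarrow> \<tau>' f = \<tau> f" for \<tau> \<tau>'
  proof -
    obtain p where p: "walk ends E u p v" using conn[of u v] U by auto
    show ?thesis
    proof (rule le_fptI[OF _ U(2) p])
    fix u c assume u: "u \<in> U" "reach ends E \<tau> u v c"
    have "reach ends (avoid ends E B) \<tau> u v c"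
      using gate_same_side[OF g _ U(3) u(2)] u(1) U(1) by auto
    then have "reach ends E \<tau>' u v c" by (rule reach_mono) (auto simp: eq avoid_def)
    then show "fpt ends E \<tau>' U v \<le> c"
      by (rule fpt_le) (use g' u in \<open>auto simp: gate_def\<close>)
    qed
  qed
  show ?thesis using *[OF g g' eq[symmetric]] *[OF g' g eq] by simp
qed

text \<open>
  Either side equals \<open>T(U, x) + \<tau> e\<close> plus the time from \<open>y\<close> to \<open>v\<close> off \<open>A\<close>. The last term is the same for both
  families and cancels.
\<close>

lemma gate_fpt_far:
  assumes g: "gate ends E \<tau> e x y A B" and g': "gate ends E \<tau>' e x y A B"
    and eq: "\<And>f. f \<in> avoid ends E A \<Longrightarrow> \<tau> f = \<tau>' f"
    and U: "U \<subseteq> A" "u \<in> U" and U': "U' \<subseteq> A" "u' \<in> U'" and v: "v \<in> B"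
    and conn: "\<And>s t. s \<in> A \<union> B \<Longrightarrow> t \<in> A \<union> B \<Longrightarrow> \<exists>p. walk ends E s p t"
  shows "fpt ends E \<tau> U v - fpt ends E \<tau>' U' v
    = (fpt ends E \<tau> U x + \<tau> e) - (fpt ends E \<tau>' U' x + \<tau>' e)"
proof -
  have *: "fpt ends E \<tau>' U' v \<le> fpt ends E \<tau> U v + (fpt ends E \<tau>' U' x + \<tau>' e) - (fpt ends E \<tau> U x + \<tau> e)"
    if g: "gate ends E \<tau> e x y A B" and g': "gate ends E \<tau>' e x y A B"
    and eq: "\<And>f. f \<in> avoid ends E A \<Longrightarrow> \<tau>' f = \<tau> f"
    and U: "U \<subseteq> A" "u \<in> U" and U': "U' \<subseteq> A" "u' \<in> U'"
 for \<tau> \<tau>' U U' u u'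
  proof -
    have nn: "f \<in> E \<Longrightarrow> 0 \<le> \<tau> f" "f \<in> E \<Longrightarrow> 0 \<le> \<tau>' f" for f using g g' by (auto simp: gate_def)
    have e: "e \<in> E" "ends e = {x, y}" "x \<in> A" using g by (auto simp: gate_def)
    obtain p' where p': "walk ends E u' p' x" using conn[of u' x] U' e by auto
    have key: "fpt ends E \<tau>' U' v + (fpt ends E \<tau> U x + \<tau> e) \<le> c + (fpt ends E \<tau>' U' x + \<tau>' e)"
      if w: "w \<in> U" "reach ends E \<tau> w v c" for w c
    proof -
      obtain c1 c2 where c: "reach ends (avoid ends E B) \<tau> w x c1"
        "reach ends (avoid ends E A) \<tau> y v c2" "c1 + \<tau> e + c2 \<le> c"
        using g w v U(1) unfolding gate_def by blast
      have "fpt ends E \<tau> U x \<le> c1"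
        by (rule fpt_le[OF reach_mono[OF c(1)]]) (use w nn in \<open>auto simp: avoid_def\<close>)
      moreover have "reach ends E \<tau>' y v c2"
        by (rule reach_mono[OF c(2)]) (auto simp: eq, auto simp: avoid_def)
      then have "reach ends E \<tau>' x v (\<tau>' e + c2)"
        by (rule reach_trans[OF _ reach_edge]) (use e in auto)
      then have "fpt ends E \<tau>' U' v \<le> fpt ends E \<tau>' U' x + (\<tau>' e + c2)"
        by (rule fpt_triangle[OF _ U'(2) p']) (use nn in auto)
      ultimately show ?thesis using c(3) by simp
    qed
    obtain q where "walk ends E u q v" using conn[of u v] U v by auto
    have "fpt ends E \<tau>' U' v + (fpt ends E \<tau> U x + \<tau> e) - (fpt ends E \<tau>' U' x + \<tau>' e) \<le> fpt ends E \<tau> U v"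
      by (rule le_fptI[OF _ U(2) \<open>walk ends E u q v\<close>]) (use key in force)
    then show ?thesis by simp
  qed
  show ?thesis using *[OF g g' eq[symmetric] U U'] *[OF g' g eq U' U] by simp
qed


section \<open>The periodic graph\<close>

locale periodic_graph =
  fixes K L :: nat and inc :: "nat \<Rightarrow> nat set" and J :: "(nat \<times> nat) set"
  assumes periodic: "essentially_1d_periodic K L inc J"
begin

abbreviation "V \<equiv> graph_verts K"
abbreviation "E \<equiv> graph_edges L J"
abbreviation "ends \<equiv> edge_ends inc"

lemma J_sub: "J \<subseteq> {1..K} \<times> {1..K}" "J \<noteq> {}"
  using periodic by (auto simp: essentially_1d_periodic_def)

lemma ends_cases:
  assumes "f \<in> E"
  obtains n l i j where "f = Inner n l" "l \<in> {1..L}" "i \<in> {1..K}" "j \<in> {1..K}" "ends f = {(n, i), (n, j)}"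
  | n i j where "f = Cross n i j" "(i, j) \<in> J" "i \<in> {1..K}" "j \<in> {1..K}" "ends f = {(n, i), (n + 1, j)}"
proof -
  from assms consider n l where "f = Inner n l" "l \<in> {1..L}" | n i j where "f = Cross n i j" "(i, j) \<in> J"
    by (auto simp: graph_edges_def)
  then show ?thesis
  proof cases
    case 1
    then obtain i j where "i \<in> {1..K}" "j \<in> {1..K}" "inc l = {i, j}"
      using periodic unfolding essentially_1d_periodic_def by blast
    with 1 show ?thesis using that(1)[of n l i j] by auto
  next
    case 2 with J_sub show ?thesis using that(2)[of n i j] by auto
  qed
qed

lemma ends_sub: "f \<in> E \<Longrightarrow> ends f \<subseteq> V"
  by (erule ends_cases) (auto simp: graph_verts_def)

lemma ends_level: "f \<in> E \<Longrightarrow> ends f = {u, w} \<Longrightarrow> \<bar>fst u - fst w\<bar> \<le> 1"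
  by (erule ends_cases) (auto simp: doubleton_eq_iff)

lemma ends_doubleton: "f \<in> E \<Longrightarrow> \<exists>u w. ends f = {u, w} \<and> u \<in> V \<and> w \<in> V"
  by (erule ends_cases) (auto simp: graph_verts_def)

definition level_edges :: "int \<Rightarrow> edge set" where
  "level_edges n = {Inner n l |l. l \<in> {1..L}}"

lemma walk_copy: "walk inc {1..L} i p j \<Longrightarrow>
    walk ends (level_edges n) (n, i) (map (\<lambda>(l, k). (Inner n l, (n, k))) p) (n, j)"
  by (induction inc "{1..L}" i p j rule: walk.induct) (auto simp: level_edges_def)

text \<open>
  One constant serves all levels because the copies are identical. It bounds the price of a detour
  within a level in \<open>block_gate\<close>.
\<close>

lemma copy_diameter:
  "\<exists>C. \<forall>n. \<forall>i\<in>{1..K}. \<forall>j\<in>{1..K}. \<exists>p. walk ends (level_edges n) (n, i) p (n, j) \<and> length p \<le> C"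
proof -
  have "\<forall>i\<in>{1..K}. \<forall>j\<in>{1..K}. \<exists>p. walk inc {1..L} i p j"
    using periodic is_path_walk unfolding essentially_1d_periodic_def connected_graph_def by metis
  then obtain p where p: "\<And>i j. i \<in> {1..K} \<Longrightarrow> j \<in> {1..K} \<Longrightarrow> walk inc {1..L} i (p i j) j" by metis
  define C where "C = Max ((\<lambda>(i, j). length (p i j)) ` ({1..K} \<times> {1..K}))"
  have "length (p i j) \<le> C" if "i \<in> {1..K}" "j \<in> {1..K}" for i j
    unfolding C_def using that by (intro Max_ge) (auto intro!: image_eqI[of _ _ "(i, j)"])
  then show ?thesis using p walk_copy by (metis (no_types, lifting) length_map)
qed

lemma level_edges_sub: "level_edges n \<subseteq> E"
  by (auto simp: level_edges_def graph_edges_def)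

lemma connected:
  assumes "u \<in> V" "v \<in> V" shows "\<exists>p. walk ends E u p v"
proof -
  define c where "c u v \<longleftrightarrow> reach ends E (\<lambda>_. 0) u v 0" for u v
  have c_sym: "c u v \<Longrightarrow> c v u" for u v unfolding c_def by (rule reach_sym)
  have c_trans: "c u v \<Longrightarrow> c v w \<Longrightarrow> c u w" for u v w
    unfolding c_def using reach_trans[of ends E "\<lambda>_. 0" v w 0 u 0] by simp
  have copy: "c (n, i) (n, j)" if "i \<in> {1..K}" "j \<in> {1..K}" for n i j
  proof -
    obtain p where p: "walk ends (level_edges n) (n, i) p (n, j)" using copy_diameter \<open>i \<in> _\<close> \<open>j \<in> _\<close> by metis
    have "cost (\<lambda>_. 0) p = 0" by (induction p) auto
    then have "reach ends (level_edges n) (\<lambda>_. 0) (n, i) (n, j) 0"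
      using reach_walk[OF p, of "\<lambda>_. 0"] by simp
    then show ?thesis unfolding c_def by (rule reach_mono) (use level_edges_sub in auto)
  qed
  obtain a b where ab: "(a, b) \<in> J" using J_sub by auto
  then have ab': "a \<in> {1..K}" "b \<in> {1..K}" using J_sub by auto
  have up: "c (n, a) (n + 1, a)" for n
  proof -
    have "c (n, a) (n + 1, b)" unfolding c_def
      by (rule reach_edge[of "Cross n a b"]) (use ab in \<open>auto simp: graph_edges_def\<close>)
    then show ?thesis by (rule c_trans[OF _ copy]) (use ab' in auto)
  qed
  have ups: "c (n, a) (n + int k, a)" for n k
  proof (induction k)
    case 0
    show ?case by (simp add: c_def reach.stay)
  next
    case (Suc k)
    have "n + int (Suc k) = n + int k + 1" by simp
    with c_trans[OF Suc up[of "n + int k"]] show ?case by (simp only:)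
  qed
  have "c (n, a) (m, a)" for n m
  proof (cases "n \<le> m")
    case True then show ?thesis using ups[of n "nat (m - n)"] by simp
  next
    case False then show ?thesis using ups[of m "nat (n - m)"] c_sym by simp
  qed
  note across = this
  obtain n i m j where uv: "u = (n, i)" "v = (m, j)" "i \<in> {1..K}" "j \<in> {1..K}"
    using assms by (auto simp: graph_verts_def)
  have "c u v" unfolding uv(1,2)
    by (rule c_trans[OF copy[OF uv(3) ab'(1)] c_trans[OF across copy[OF ab'(1) uv(4)]]])
  then show ?thesis by (auto simp: c_def reach_iff_walk)
qed

definition block :: "int \<Rightarrow> nat \<Rightarrow> edge set" where
  "block z R = {f \<in> E. fst ` ends f \<subseteq> {z..z + int R}}"

text \<open>
  The number of edges is bounded uniformly in \<open>z\<close>, so the probability that a block carries a prescribed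
  pattern is bounded away from zero.
\<close>

lemma finite_block: "finite (block z R) \<and> card (block z R) \<le> (R + 1) * (L + card J)"
proof -
  let ?A = "(\<lambda>(n, l). Inner n l) ` ({z..z + int R} \<times> {1..L})"
  let ?B = "(\<lambda>(n, i, j). Cross n i j) ` ({z..z + int R} \<times> J)"
  have finJ: "finite J" using J_sub finite_subset by blast
  have sub: "block z R \<subseteq> ?A \<union> ?B"
  proof
    fix f assume "f \<in> block z R"
    then have "f \<in> E" "fst ` ends f \<subseteq> {z..z + int R}" by (auto simp: block_def)
    then show "f \<in> ?A \<union> ?B"
      by (elim ends_cases) (auto intro!: image_eqI[of _ _ "(_, _)"] image_eqI[of _ _ "(_, _, _)"])
  qed
  have fin: "finite (?A \<union> ?B)" using finJ by auto
  have "card (block z R) \<le> card (?A \<union> ?B)" using sub fin by (rule card_mono[rotated])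
  also have "\<dots> \<le> card ?A + card ?B" by (rule card_Un_le)
  also have "\<dots> \<le> card ({z..z + int R} \<times> {1..L}) + card ({z..z + int R} \<times> J)"
    using finJ by (intro add_mono card_image_le) auto
  also have "\<dots> = (R + 1) * (L + card J)" by (simp add: card_cartesian_product nat_add_distrib add_mult_distrib2)
  finally show ?thesis using finite_subset[OF sub fin] by simp
qed

text \<open>
  The distance in number of edges from the levels up to \<open>z\<close>. It vanishes there and changes by at most
  one along an edge, so it bounds the number of edges of any walk from below.
\<close>

definition hop :: "int \<Rightarrow> vertex \<Rightarrow> nat" where
  "hop z w = (LEAST n. \<exists>u p. u \<in> V \<and> fst u \<le> z \<and> walk ends E u p w \<and> length p = n)"

lemma hop_le: "u \<in> V \<Longrightarrow> fst u \<le> z \<Longrightarrow> walk ends E u p w \<Longrightarrow> hop z w \<le> length p"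
  unfolding hop_def by (rule Least_le) blast

lemma hop_walk:
  assumes "w \<in> V"
  obtains u p where "u \<in> V" "fst u \<le> z" "walk ends E u p w" "length p = hop z w"
proof -
  have "(z, snd w) \<in> V" using assms by (auto simp: graph_verts_def)
  then obtain p where "walk ends E (z, snd w) p w" using connected assms by blast
  with \<open>(z, snd w) \<in> V\<close> have "\<exists>n u p. u \<in> V \<and> fst u \<le> z \<and> walk ends E u p w \<and> length p = n"
    by (intro exI[of _ "length p"] exI[of _ "(z, snd w)"] exI[of _ p]) simp
  from LeastI_ex[OF this] show ?thesis using that unfolding hop_def by blast
qed

lemma hop_0: "w \<in> V \<Longrightarrow> fst w \<le> z \<Longrightarrow> hop z w = 0"
  using hop_le[of w z "[]" w] by simp

lemma hop_edge:
  assumes "f \<in> E" "ends f = {v, w}" shows "hop z w \<le> Suc (hop z v)"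
proof -
  have "v \<in> V" using ends_sub[OF assms(1)] assms(2) by auto
  then obtain u p where u: "u \<in> V" "fst u \<le> z" "walk ends E u p v" "length p = hop z v"
    using hop_walk[of v z] by blast
  have "walk ends E u (p @ [(f, w)]) w" unfolding walk_append using u(3) assms by (intro exI[of _ v]) simp
  from hop_le[OF u(1,2) this] u(4) show ?thesis by simp
qed

lemma hop_level:
  assumes "w \<in> V"
  shows "fst w \<le> z + int (hop z w)"
proof -
  have "fst w \<le> fst u + int (length p)" if "walk ends E u p w" for u p
    using that
  proof (induction p arbitrary: u)
    case (Cons a p)
    obtain f v where "a = (f, v)" by (cases a)
    with Cons have "f \<in> E" "ends f = {u, v}" "fst w \<le> fst v + int (length p)" by auto
    with ends_level[of f u v] \<open>a = (f, v)\<close> show ?case by (simp add: abs_le_iff)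
  qed simp
  note level = this
  obtain u p where "fst u \<le> z" "walk ends E u p w" "length p = hop z w"
    using hop_walk[OF assms, of z] by blast
  with level[of u p] show ?thesis by simp
qed

text \<open>
  A walk with the fewest edges from the levels up to \<open>z\<close> to the levels from \<open>z + R\<close> on. Minimality keeps it
  strictly between these levels except at its ends.
\<close>

lemma geodesic:
  assumes "2 \<le> R"
  obtains l g ge where "R \<le> l" "\<And>i. i < l \<Longrightarrow> ge i \<in> E" "\<And>i. i < l \<Longrightarrow> ends (ge i) = {g i, g (Suc i)}"
    "\<And>i. i \<le> l \<Longrightarrow> g i \<in> V" "\<And>i. i \<le> l \<Longrightarrow> hop z (g i) = i" "fst (g 0) = z" "fst (g l) = z + int R"
    "\<And>i. 0 < i \<Longrightarrow> i < l \<Longrightarrow> z < fst (g i) \<and> fst (g i) < z + int R"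
    "\<And>w. w \<in> V \<Longrightarrow> z + int R \<le> fst w \<Longrightarrow> l \<le> hop z w"
proof -
  define T where "T = {w \<in> V. z + int R \<le> fst w}"
  obtain a b where "(a, b) \<in> J" using J_sub by auto
  then have "(z + int R, a) \<in> T" using J_sub by (auto simp: T_def graph_verts_def)
  then obtain w where w: "w \<in> T" "\<And>v. v \<in> T \<Longrightarrow> hop z w \<le> hop z v"
    using ex_has_least_nat[of "\<lambda>w. w \<in> T" _ "hop z"] by blast
  define l where "l = hop z w"
  obtain u p where u: "u \<in> V" "fst u \<le> z" "walk ends E u p w" "length p = l"
    using hop_walk[of w z] w by (auto simp: T_def l_def)
  define g where "g i = (u # map snd p) ! i" for i
  define ge where "ge i = fst (p ! i)" for i
  have pth: "is_path V E ends (u # map snd p) (map fst p)" "last (u # map snd p) = w"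
    using walk_is_path[OF u(3,1)] ends_sub by auto
  have ge: "ge i \<in> E" "ends (ge i) = {g i, g (Suc i)}" if "i < l" for i
    using pth(1) u(4) \<open>i < l\<close> unfolding is_path_def g_def ge_def by (auto simp: subset_iff)
  have gV: "g i \<in> V" if "i \<le> l" for i
  proof -
    have "(u # map snd p) ! i \<in> set (u # map snd p)" by (rule nth_mem) (use that u(4) in auto)
    then show ?thesis using pth(1) unfolding is_path_def g_def by blast
  qed
  have g0: "g 0 = u" and gl: "g l = w"
    using pth(2) u(4) by (auto simp: g_def last_conv_nth)
  have up: "hop z (g i) \<le> i" if "i \<le> l" for i
    using that
  proof (induction i)
    case 0 then show ?case using hop_0[OF u(1,2)] g0 by simp
  next
    case (Suc i) then show ?case using hop_edge[OF ge(1,2), of i z] by simp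
  qed
  have down: "hop z w \<le> hop z (g i) + (l - i)" if "i \<le> l" for i
    using that
  proof (induction rule: inc_induct)
    case base then show ?case using gl by simp
  next
    case (step n) then show ?case using hop_edge[OF ge(1,2), of n z] by simp
  qed
  have hop: "hop z (g i) = i" if "i \<le> l" for i using up[OF that] down[OF that] that by (simp add: l_def)
  have Rl: "R \<le> l" using hop_level[of w z] w by (auto simp: T_def l_def)
  have inner: "z < fst (g i) \<and> fst (g i) < z + int R" if "0 < i" "i < l" for i
  proof (rule conjI; rule ccontr)
    assume "\<not> z < fst (g i)"
    then show False using hop_0[of "g i" z] gV[of i] hop[of i] that by auto
  next
    assume "\<not> fst (g i) < z + int R"
    then have "g i \<in> T" using gV[of i] that by (auto simp: T_def)
    from w(2)[OF this] hop[of i] that show False by (simp add: l_def)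
  qed
  have "fst (g 0) = z" using ends_level[OF ge(1,2), of 0] inner[of 1] u(2) g0 Rl assms by auto
  moreover have "fst (g l) = z + int R"
    using ends_level[OF ge(1,2), of "l - 1"] inner[of "l - 1"] w(1) gl Rl assms by (auto simp: T_def)
  moreover have "l \<le> hop z w" if "w \<in> V" "z + int R \<le> fst w" for w
    using w(2)[of w] that by (simp add: T_def l_def)
  ultimately show ?thesis using that[of l ge g] Rl ge gV hop inner by blast
qed

end


section \<open>Blocks that contain a gate\<close>

lemma reach_touches:
  assumes "reach ends S \<tau> u v c" "u \<noteq> v"
  shows "(\<exists>f\<in>S. u \<in> ends f) \<and> (\<exists>f\<in>S. v \<in> ends f)"
  using assms by induction auto

lemma cost_le:
  assumes "walk ends S u p v" "\<And>f. f \<in> S \<Longrightarrow> \<tau> f \<le> b" shows "cost \<tau> p \<le> real (length p) * b"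
  using assms by (induction ends S u p v rule: walk.induct) (auto simp: algebra_simps add_mono)

context periodic_graph begin

text \<open>
  \<open>\<Gamma>\<close> is the geodesic across the block, \<open>e\<close> one of its edges with at least
  \<open>r\<close> edges on either side; \<open>A\<close> consists of everything to the left of the
  block and the geodesic up to \<open>x\<close>, and \<open>B\<close> of the rest of the geodesic and everything to the right.
  All edges of a jump from \<open>A\<close> to \<open>B\<close> without \<open>e\<close> lie in the block off the geodesic, so a jump from \<open>a\<close> to \<open>b\<close> costs at
  least \<open>\<beta>0 (hop b - hop a)\<close>. Following the geodesic instead costs at most \<open>\<alpha>\<close> per edge, plus the price
  \<open>C \<beta>1\<close> of a walk within the first or last level for each of the two ends that is not on the geodesic.
  In the latter case the jump has at least \<open>r\<close> edges, and the gain on that many edges pays for two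
  detours.
\<close>

lemma block_gate:
  fixes \<alpha> \<beta>0 \<beta>1 :: real
  assumes \<alpha>: "0 \<le> \<alpha>" "\<alpha> < \<beta>0" "\<beta>0 \<le> \<beta>1"
  obtains R :: nat where
    "\<And>z. \<exists>e x y A B \<Gamma>. e \<in> block z R \<and> x \<in> V \<and> y \<in> V \<and>
      {v \<in> V. fst v \<le> z} \<subseteq> A \<and> A \<subseteq> {v \<in> V. fst v < z + int R} \<and>
      {v \<in> V. z + int R \<le> fst v} \<subseteq> B \<and> B \<subseteq> {v \<in> V. z < fst v} \<and>
      (\<forall>\<tau>. (\<forall>f\<in>E. 0 \<le> \<tau> f) \<longrightarrow> \<tau> e \<le> \<alpha> \<longrightarrow>
         (\<forall>f\<in>block z R - {e}. if f \<in> \<Gamma> then \<tau> f \<le> \<alpha> else \<beta>0 \<le> \<tau> f \<and> \<tau> f \<le> \<beta>1) \<longrightarrow>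
         gate ends E \<tau> e x y A B)"
proof -
  obtain C where C: "\<And>n i j. i \<in> {1..K} \<Longrightarrow> j \<in> {1..K} \<Longrightarrow>
      \<exists>p. walk ends (level_edges n) (n, i) p (n, j) \<and> length p \<le> C"
    using copy_diameter by blast
  \<comment> \<open>r edges on each side of e gain r (\<beta>0 - \<alpha>), which is to cover two detours of price C \<beta>1.\<close>
  obtain r0 :: nat where r0: "2 * real C * \<beta>1 / (\<beta>0 - \<alpha>) \<le> real r0" using real_arch_simple by blast
  define r where "r = Suc r0"
  have r: "2 * (real C * \<beta>1) \<le> real r * (\<beta>0 - \<alpha>)" "1 \<le> r"
  proof -
    have "2 * real C * \<beta>1 / (\<beta>0 - \<alpha>) \<le> real r" using r0 by (simp add: r_def)
    then show "2 * (real C * \<beta>1) \<le> real r * (\<beta>0 - \<alpha>)" using \<alpha> by (simp add: pos_divide_le_eq)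
  qed (simp add: r_def)
  have Cb: "0 \<le> real C * \<beta>1" using \<alpha> by simp
  define R where "R = 2 * r + 1"
  have "\<exists>e x y A B \<Gamma>. e \<in> block z R \<and> x \<in> V \<and> y \<in> V \<and>
      {v \<in> V. fst v \<le> z} \<subseteq> A \<and> A \<subseteq> {v \<in> V. fst v < z + int R} \<and>
      {v \<in> V. z + int R \<le> fst v} \<subseteq> B \<and> B \<subseteq> {v \<in> V. z < fst v} \<and>
      (\<forall>\<tau>. (\<forall>f\<in>E. 0 \<le> \<tau> f) \<longrightarrow> \<tau> e \<le> \<alpha> \<longrightarrow>
         (\<forall>f\<in>block z R - {e}. if f \<in> \<Gamma> then \<tau> f \<le> \<alpha> else \<beta>0 \<le> \<tau> f \<and> \<tau> f \<le> \<beta>1) \<longrightarrow>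
         gate ends E \<tau> e x y A B)" for z
  proof -
    obtain l g ge where geo: "R \<le> l" "\<And>i. i < l \<Longrightarrow> ge i \<in> E" "\<And>i. i < l \<Longrightarrow> ends (ge i) = {g i, g (Suc i)}"
      "\<And>i. i \<le> l \<Longrightarrow> g i \<in> V" "\<And>i. i \<le> l \<Longrightarrow> hop z (g i) = i" "fst (g 0) = z" "fst (g l) = z + int R"
      "\<And>i. 0 < i \<Longrightarrow> i < l \<Longrightarrow> z < fst (g i) \<and> fst (g i) < z + int R"
      "\<And>w. w \<in> V \<Longrightarrow> z + int R \<le> fst w \<Longrightarrow> l \<le> hop z w"
    proof -
      have "2 \<le> R" using r(2) by (simp add: R_def)
      then show thesis by (rule geodesic[where z = z]) (rule that)
    qed
    define A where "A = {v \<in> V. fst v \<le> z} \<union> g ` {..r}"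
    define B where "B = {v \<in> V. z + int R \<le> fst v} \<union> g ` {r<..l}"
    define \<Gamma> where "\<Gamma> = ge ` {..<l}"
    have rl: "r + r + 1 \<le> l" using geo(1) by (simp add: R_def)
    have glev: "z \<le> fst (g i) \<and> fst (g i) \<le> z + int R" if "i \<le> l" for i
      using geo(6,7) geo(8)[of i] that by (cases "i = 0"; cases "i = l") auto
    have A1: "fst (g i) < z + int R" if "i \<le> r" for i
      using geo(6) geo(8)[of i] that rl r by (cases "i = 0") (auto simp: R_def)
    have B1: "z < fst (g i)" if "r < i" "i \<le> l" for i
      using geo(7) geo(8)[of i] that rl r by (cases "i = l") (auto simp: R_def)
    have A: "{v \<in> V. fst v \<le> z} \<subseteq> A" "A \<subseteq> {v \<in> V. fst v < z + int R}"
      using A1 geo(4) rl r by (auto simp: A_def R_def)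
    have B: "{v \<in> V. z + int R \<le> fst v} \<subseteq> B" "B \<subseteq> {v \<in> V. z < fst v}"
      using B1 geo(4) rl r by (auto simp: B_def R_def)
    have AB: "A \<inter> B = {}"
    proof -
      have False if v: "v \<in> A" "v \<in> B" for v
      proof (cases "v \<in> g ` {r<..l}")
        case True
        then obtain k where k: "v = g k" "r < k" "k \<le> l" by auto
        from v(1) have "v \<in> g ` {..r}" using B1[OF k(2,3)] k(1) by (auto simp: A_def)
        then obtain i where "v = g i" "i \<le> r" by auto
        then show False using k geo(5)[of i] geo(5)[of k] by simp
      next
        case False
        then have "z + int R \<le> fst v" using v(2) by (auto simp: B_def)
        moreover have "fst v < z + int R" using v(1) A(2) by blast
        ultimately show False by simp
      qed
      then show ?thesis by blast
    qed
    define e where "e = ge r"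
    have e: "e \<in> E" "ends e = {g r, g (Suc r)}" using geo(2,3)[of r] rl by (auto simp: e_def)
    have xy: "g r \<in> A" "g (Suc r) \<in> B" using rl by (auto simp: A_def B_def)
    have eblock: "e \<in> block z R" using e glev[of r] glev[of "Suc r"] rl by (auto simp: block_def)
    have "gate ends E \<tau> e (g r) (g (Suc r)) A B"
      if nn: "\<forall>f\<in>E. 0 \<le> \<tau> f" and te: "\<tau> e \<le> \<alpha>" and
      pat: "\<forall>f\<in>block z R - {e}. if f \<in> \<Gamma> then \<tau> f \<le> \<alpha> else \<beta>0 \<le> \<tau> f \<and> \<tau> f \<le> \<beta>1" for \<tau>
    proof (rule gateI[where \<alpha> = \<alpha> and ends = ends and E = E and e = e, OF e xy AB])
      show "\<tau> e \<le> \<alpha>" by (rule te)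
      show "0 \<le> \<tau> f" if "f \<in> E" for f using nn that by simp
      fix a b c
      let ?X = "{f \<in> E - {e}. \<not> ends f \<subseteq> A \<and> \<not> ends f \<subseteq> B}"
      assume a: "a \<in> A" and b: "b \<in> B" and abc: "reach ends ?X \<tau> a b c"
      have Xblock: "f \<in> block z R" "\<beta>0 \<le> \<tau> f" if fX: "f \<in> ?X" for f
      proof -
        obtain u w where uw: "ends f = {u, w}" "u \<in> V" "w \<in> V" using ends_doubleton[of f] fX by blast
        then have l: "\<bar>fst u - fst w\<bar> \<le> 1" using ends_level[of f u w] fX by auto
        have "\<not> (fst u \<le> z \<and> fst w \<le> z)" "\<not> (z + int R \<le> fst u \<and> z + int R \<le> fst w)"
          using fX uw A(1) B(1) by auto
        then show fb: "f \<in> block z R" using fX l uw unfolding block_def by auto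
        have "f \<notin> \<Gamma>"
        proof
          assume "f \<in> \<Gamma>"
          then obtain i where i: "f = ge i" "i < l" by (auto simp: \<Gamma>_def)
          then consider "i < r" | "r < i" using fX by (fastforce simp: e_def)
          then show False
          proof cases
            case 1 then have "ends f \<subseteq> A" using geo(3)[OF i(2)] i by (auto simp: A_def)
            with fX show False by auto
          next
            case 2 then have "ends f \<subseteq> B" using geo(3)[OF i(2)] i by (auto simp: B_def)
            with fX show False by auto
          qed
        qed
        then show "\<beta>0 \<le> \<tau> f" using pat fb fX by auto
      qed
      have c1: "\<beta>0 * (real (hop z b) - real (hop z a)) \<le> c"
        using abc
      proof induction
        case (stay c) then show ?case by simp
      next
        case (extend v c f w c')
        have "hop z w \<le> Suc (hop z v)" using hop_edge[of f v w] extend by auto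
        then have "\<beta>0 * (real (hop z w) - real (hop z a)) \<le> \<beta>0 * (real (hop z v) - real (hop z a) + 1)"
          using \<alpha> by (intro mult_left_mono) auto
        then show ?case using extend.IH extend.hyps(4) Xblock(2)[OF extend.hyps(2)] by (simp add: algebra_simps)
      qed
      have "a \<noteq> b" using a b AB by auto
      from reach_touches[OF abc this] obtain fa fb where f: "fa \<in> ?X" "a \<in> ends fa" "fb \<in> ?X" "b \<in> ends fb" by blast
      have la: "z \<le> fst a" using Xblock(1)[OF f(1)] f(2) by (auto simp: block_def)
      have lb: "fst b \<le> z + int R" using Xblock(1)[OF f(3)] f(4) by (auto simp: block_def)
      have small: "\<tau> (ge i) \<le> \<alpha>" if "i < l" for i
      proof (cases "ge i = e")
        case False
        have "ge i \<in> block z R" using geo(2,3)[OF that] glev[of i] glev[of "Suc i"] that by (auto simp: block_def)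
        then show ?thesis using pat False that by (auto simp: \<Gamma>_def)
      qed (use te in simp)
      have segA: "reach ends (avoid ends E B) \<tau> (g i) (g r) (real (r - i) * \<alpha>)" if "i \<le> r" for i
        using that
      proof (induction rule: inc_induct)
        case base then show ?case by (auto intro: reach.stay)
      next
        case (step n)
        have "g n \<in> A" "g (Suc n) \<in> A" using step by (auto simp: A_def)
        then have "ends (ge n) \<inter> B = {}" using geo(3)[of n] step rl AB by auto
        then have "ge n \<in> avoid ends E B" using geo(2)[of n] step rl by (auto simp: avoid_def)
        then have "reach ends (avoid ends E B) \<tau> (g n) (g (Suc n)) \<alpha>"
          by (rule reach_edge) (use geo(3)[of n] small[of n] step rl in auto)
        from reach_trans[OF step.IH this] step(1,2) rl show ?case
          by (simp add: of_nat_diff algebra_simps)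
      qed
      have segB: "reach ends (avoid ends E A) \<tau> (g (Suc r)) (g k) (real (k - Suc r) * \<alpha>)" if "Suc r \<le> k" "k \<le> l" for k
        using that
      proof (induction rule: dec_induct)
        case base then show ?case by (auto intro: reach.stay)
      next
        case (step n)
        have "g n \<in> B" "g (Suc n) \<in> B" using step by (auto simp: B_def)
        then have "ends (ge n) \<inter> A = {}" using geo(3)[of n] step rl AB by auto
        then have "ge n \<in> avoid ends E A" using geo(2)[of n] step rl by (auto simp: avoid_def)
        then have "reach ends (avoid ends E A) \<tau> (g n) (g (Suc n)) \<alpha>"
          by (rule reach_edge) (use geo(3)[of n] small[of n] step rl in auto)
        from reach_trans[OF this step.IH] step show ?case
          by (simp add: of_nat_diff algebra_simps)
      qed
      have lev: "reach ends {f \<in> E. fst ` ends f \<subseteq> {n}} \<tau> u v (real C * \<beta>1)"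
        if uv: "u \<in> V" "v \<in> V" "fst u = n" "fst v = n" and n: "n = z \<or> n = z + int R" for u v n
      proof -
        obtain p where p: "walk ends (level_edges n) u p v" "length p \<le> C"
          using C[of "snd u" "snd v" n] uv by (auto simp: graph_verts_def)
        have le: "f \<in> E" "fst ` ends f \<subseteq> {n}" if "f \<in> level_edges n" for f
          using that by (auto simp: level_edges_def graph_edges_def)
        have "\<tau> f \<le> \<beta>1" if "f \<in> level_edges n" for f
        proof (cases "f = e")
          case True
          then show ?thesis using te \<alpha> by simp
        next
          case False
          have "f \<in> block z R" using le[OF that] n unfolding block_def by fastforce
          then have "if f \<in> \<Gamma> then \<tau> f \<le> \<alpha> else \<beta>0 \<le> \<tau> f \<and> \<tau> f \<le> \<beta>1" using pat False by blast
          then show ?thesis using \<alpha> by (cases "f \<in> \<Gamma>") auto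
        qed
        then have "cost \<tau> p \<le> real (length p) * \<beta>1" by (rule cost_le[OF p(1)])
        also have "\<dots> \<le> real C * \<beta>1" using p(2) \<alpha> by (intro mult_right_mono) auto
        finally show ?thesis using le
          by (intro reach_mono[OF reach_walk[OF p(1)]]) auto
      qed
      \<comment> \<open>ca is the price of getting from a to x, and cb that of getting from y to b.\<close>
      have "\<exists>ca k. reach ends (avoid ends E B) \<tau> a (g r) ca \<and> hop z a = k \<and> k \<le> r \<and>
          (ca = (real r - real k) * \<alpha> \<or> k = 0 \<and> ca = real C * \<beta>1 + real r * \<alpha>)"
      proof (cases "a \<in> g ` {..r}")
        case True
        then obtain i where i: "a = g i" "i \<le> r" by auto
        then show ?thesis using segA[OF i(2)] geo(5)[of i] rl
          by (intro exI[of _ "(real r - real i) * \<alpha>"]) (auto simp: of_nat_diff)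
      next
        case False
        then have "fst a = z" "a \<in> V" using a la by (auto simp: A_def)
        with lev[of a "g 0" z] geo(4)[of 0] geo(6) have "reach ends {f \<in> E. fst ` ends f \<subseteq> {z}} \<tau> a (g 0) (real C * \<beta>1)"
          by auto
        then have "reach ends (avoid ends E B) \<tau> a (g 0) (real C * \<beta>1)"
        proof (rule reach_mono)
          have "fst v \<noteq> z" if "v \<in> B" for v using B(2) that by auto
          then show "{f \<in> E. fst ` ends f \<subseteq> {z}} \<subseteq> avoid ends E B"
            unfolding avoid_def by blast
        qed simp_all
        from reach_trans[OF segA[of 0] this] show ?thesis using hop_0[of a z] \<open>fst a = z\<close> \<open>a \<in> V\<close>
          by (intro exI[of _ "real C * \<beta>1 + real r * \<alpha>"]) auto
      qed
      then obtain ca where ca: "reach ends (avoid ends E B) \<tau> a (g r) ca" "hop z a \<le> r"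
        "ca = (real r - real (hop z a)) * \<alpha> \<or> hop z a = 0 \<and> ca = real C * \<beta>1 + real r * \<alpha>" by blast
      have "\<exists>cb k. reach ends (avoid ends E A) \<tau> (g (Suc r)) b cb \<and> Suc r \<le> k \<and> k \<le> hop z b \<and>
          (cb = (real k - real r - 1) * \<alpha> \<or> k = l \<and> cb = real C * \<beta>1 + (real l - real r - 1) * \<alpha>)"
      proof (cases "b \<in> g ` {r<..l}")
        case True
        then obtain k where k: "b = g k" "Suc r \<le> k" "k \<le> l" by auto
        then show ?thesis using segB[OF k(2,3)] geo(5)[of k] rl
          by (intro exI[of _ "(real k - real r - 1) * \<alpha>"] exI[of _ k]) (auto simp: of_nat_diff algebra_simps)
      next
        case False
        then have bb: "fst b = z + int R" "b \<in> V" using b lb by (auto simp: B_def)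
        with lev[of "g l" b "z + int R"] geo(4)[of l] geo(7)
        have "reach ends {f \<in> E. fst ` ends f \<subseteq> {z + int R}} \<tau> (g l) b (real C * \<beta>1)" by auto
        then have "reach ends (avoid ends E A) \<tau> (g l) b (real C * \<beta>1)"
        proof (rule reach_mono)
          have "fst v \<noteq> z + int R" if "v \<in> A" for v using A(2) that by auto
          then show "{f \<in> E. fst ` ends f \<subseteq> {z + int R}} \<subseteq> avoid ends E A"
            unfolding avoid_def by blast
        qed simp_all
        from reach_trans[OF this segB[of l]] show ?thesis using geo(9)[of b] bb rl
          by (intro exI[of _ "real C * \<beta>1 + (real l - real r - 1) * \<alpha>"] exI[of _ l]) (auto simp: of_nat_diff algebra_simps)
      qed
      then obtain cb k where cb: "reach ends (avoid ends E A) \<tau> (g (Suc r)) b cb" "Suc r \<le> k" "k \<le> hop z b"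
          "cb = (real k - real r - 1) * \<alpha> \<or> k = l \<and> cb = real C * \<beta>1 + (real l - real r - 1) * \<alpha>" by blast
      define h where "h = hop z a"
      have n: "\<beta>0 * (real k - real h) \<le> c"
      proof -
        have "\<beta>0 * (real k - real h) \<le> \<beta>0 * (real (hop z b) - real (hop z a))"
          using cb(3) \<alpha> by (intro mult_left_mono) (auto simp: h_def)
        with c1 show ?thesis by simp
      qed
      have "\<alpha> * (real k - real h) + (ca + \<alpha> + cb - \<alpha> * (real k - real h)) \<le> c"
      proof -
        have gap: "(\<beta>0 - \<alpha>) * real r \<le> (\<beta>0 - \<alpha>) * (real k - real h)" if "h = 0 \<or> k = l"
          using that cb(2) ca(2) rl \<alpha> by (intro mult_left_mono) (auto simp: h_def)
        have pos: "0 \<le> (\<beta>0 - \<alpha>) * (real k - real h)"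
          using cb(2) ca(2) \<alpha> by (intro mult_nonneg_nonneg) (auto simp: h_def)
        have ca': "ca = (real r - real h) * \<alpha> \<or> h = 0 \<and> ca = real C * \<beta>1 + real r * \<alpha>" using ca(3) by (simp add: h_def)
        have "ca + \<alpha> + cb - \<alpha> * (real k - real h) \<le> (\<beta>0 - \<alpha>) * (real k - real h)"
          using ca' cb(4)
        proof (elim disjE conjE)
          assume "ca = (real r - real h) * \<alpha>" "cb = (real k - real r - 1) * \<alpha>"
          then have "ca + \<alpha> + cb - \<alpha> * (real k - real h) = 0" by (simp add: algebra_simps)
          with pos show ?thesis by simp
        next
          assume "ca = (real r - real h) * \<alpha>" "k = l" "cb = real C * \<beta>1 + (real l - real r - 1) * \<alpha>"
          then have "ca + \<alpha> + cb - \<alpha> * (real k - real h) = real C * \<beta>1" by (simp add: algebra_simps)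
          with gap \<open>k = l\<close> r(1) Cb show ?thesis by (simp add: mult.commute)
        next
          assume "h = 0" "ca = real C * \<beta>1 + real r * \<alpha>" "cb = (real k - real r - 1) * \<alpha>"
          then have "ca + \<alpha> + cb - \<alpha> * (real k - real h) = real C * \<beta>1" by (simp add: algebra_simps)
          with gap \<open>h = 0\<close> r(1) Cb show ?thesis by (simp add: mult.commute)
        next
          assume "h = 0" "ca = real C * \<beta>1 + real r * \<alpha>" "k = l" "cb = real C * \<beta>1 + (real l - real r - 1) * \<alpha>"
          then have "ca + \<alpha> + cb - \<alpha> * (real k - real h) = 2 * (real C * \<beta>1)" by (simp add: algebra_simps)
          with gap \<open>h = 0\<close> r(1) Cb show ?thesis by (simp add: mult.commute)
        qed
        then have "\<alpha> * (real k - real h) + (ca + \<alpha> + cb - \<alpha> * (real k - real h)) \<le> \<beta>0 * (real k - real h)"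
          by (simp add: algebra_simps)
        with n show ?thesis by simp
      qed
      then show "\<exists>c1 c2. reach ends (avoid ends E B) \<tau> a (g r) c1 \<and> reach ends (avoid ends E A) \<tau> (g (Suc r)) b c2 \<and> c1 + \<alpha> + c2 \<le> c"
        using ca(1) cb(1) by (intro exI[of _ ca] exI[of _ cb]) auto
    qed
    then show ?thesis using eblock A B geo(4)[of r] geo(4)[of "Suc r"] rl
      by (intro exI[of _ e] exI[of _ "g r"] exI[of _ "g (Suc r)"] exI[of _ A] exI[of _ B] exI[of _ \<Gamma>]) auto
  qed
  then show ?thesis by (rule that)
qed

end


section \<open>Symmetric walks and reflection\<close>

text \<open>
  The maps \<open>\<theta> j\<close> preserve the measure and reverse the \<open>j\<close>-th step alone: given everything else, the two
  signs of a nonzero step are equally likely. This makes the partial sums a martingale that is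
  constant while the steps vanish.
\<close>

locale flip_walk = prob_space M for M :: "'a measure" +
  fixes \<theta> :: "nat \<Rightarrow> 'a \<Rightarrow> 'a" and \<xi> :: "nat \<Rightarrow> 'a \<Rightarrow> int"
  assumes \<theta>_meas [measurable]: "\<And>j. \<theta> j \<in> M \<rightarrow>\<^sub>M M"
    and \<theta>_pres: "\<And>j. distr M M (\<theta> j) = M"
    and \<xi>_meas [measurable]: "\<And>j. \<xi> j \<in> M \<rightarrow>\<^sub>M count_space UNIV"
    and \<xi>_range: "\<And>j \<omega>. \<omega> \<in> space M \<Longrightarrow> \<xi> j \<omega> \<in> {-1, 0, 1}"
    and \<xi>_flip: "\<And>i j \<omega>. \<omega> \<in> space M \<Longrightarrow> \<xi> i (\<theta> j \<omega>) = (if i = j then - \<xi> i \<omega> else \<xi> i \<omega>)"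
    and \<xi>_inf: "AE \<omega> in M. infinite {j. \<xi> j \<omega> \<noteq> 0}"
begin

definition S :: "nat \<Rightarrow> 'a \<Rightarrow> int" where "S k \<omega> = (\<Sum>j<k. \<xi> j \<omega>)"

lemma S_meas [measurable]: "S k \<in> M \<rightarrow>\<^sub>M count_space UNIV"
  unfolding S_def[abs_def] by (induction k) (simp_all add: measurable_compose_countable)

text \<open>
  The walk \<open>N - S k\<close>, stopped when it leaves the open interval from \<open>0\<close> to \<open>m\<close>.
\<close>

primrec Z :: "int \<Rightarrow> int \<Rightarrow> nat \<Rightarrow> 'a \<Rightarrow> int" where
  "Z N m 0 \<omega> = N"
| "Z N m (Suc k) \<omega> = (if 0 < Z N m k \<omega> \<and> Z N m k \<omega> < m then Z N m k \<omega> - \<xi> k \<omega> else Z N m k \<omega>)"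

lemma Z_meas [measurable]: "Z N m k \<in> M \<rightarrow>\<^sub>M count_space UNIV"
  by (induction k) (simp_all add: measurable_compose_countable)

lemma Z_range: "0 < N \<Longrightarrow> N \<le> m \<Longrightarrow> \<omega> \<in> space M \<Longrightarrow> 0 \<le> Z N m k \<omega> \<and> Z N m k \<omega> \<le> m"
proof (induction k)
  case (Suc k) then show ?case using \<xi>_range[of \<omega> k] by auto
qed simp

lemma Z_flip: "\<omega> \<in> space M \<Longrightarrow> i \<le> k \<Longrightarrow> Z N m i (\<theta> k \<omega>) = Z N m i \<omega>"
  by (induction i) (auto simp: \<xi>_flip)

lemma Z_inv:
  assumes "0 < N" "N \<le> m" "\<omega> \<in> space M"
  shows "Z N m k \<omega> = N - S k \<omega> \<or> (\<exists>i\<le>k. S i \<omega> = N) \<or> Z N m k \<omega> = m"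
proof (induction k)
  case 0 then show ?case by (simp add: S_def)
next
  case (Suc k)
  show ?case
  proof (cases "\<exists>i\<le>k. S i \<omega> = N")
    case True then show ?thesis using le_SucI by blast
  next
    case False
    then have "S k \<omega> \<noteq> N" by blast
    with Suc False Z_range[OF assms, of k] show ?thesis by (auto simp: S_def)
  qed
qed

lemma flip_expectation:
  fixes h :: "'a \<Rightarrow> real"
  assumes [measurable]: "h \<in> borel_measurable M" and inv: "\<And>\<omega>. \<omega> \<in> space M \<Longrightarrow> h (\<theta> k \<omega>) = h \<omega>"
  shows "(\<integral>\<omega>. h \<omega> * \<xi> k \<omega> \<partial>M) = 0"
proof -
  have "(\<integral>\<omega>. h \<omega> * \<xi> k \<omega> \<partial>M) = (\<integral>\<omega>. h \<omega> * \<xi> k \<omega> \<partial>(distr M M (\<theta> k)))" by (simp add: \<theta>_pres)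
  also have "\<dots> = (\<integral>\<omega>. h (\<theta> k \<omega>) * \<xi> k (\<theta> k \<omega>) \<partial>M)" by (subst integral_distr) auto
  also have "\<dots> = (\<integral>\<omega>. - (h \<omega> * \<xi> k \<omega>) \<partial>M)"
    by (rule Bochner_Integration.integral_cong) (auto simp: inv \<xi>_flip)
  finally show ?thesis by simp
qed

lemma int_bounded:
  fixes f :: "'a \<Rightarrow> int"
  assumes [measurable]: "f \<in> M \<rightarrow>\<^sub>M count_space UNIV" and "\<And>\<omega>. \<omega> \<in> space M \<Longrightarrow> \<bar>f \<omega>\<bar> \<le> b"
  shows "integrable M (\<lambda>\<omega>. real_of_int (f \<omega>))"
proof (rule integrable_const_bound[where B = b])
  show "AE \<omega> in M. norm (real_of_int (f \<omega>)) \<le> b" using assms(2) by (intro AE_I2) (simp add: of_int_abs[symmetric] del: of_int_abs)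
qed measurable

definition act :: "int \<Rightarrow> int \<Rightarrow> nat \<Rightarrow> 'a \<Rightarrow> int" where
  "act N m k \<omega> = (if 0 < Z N m k \<omega> \<and> Z N m k \<omega> < m then 1 else 0)"

lemma act_meas [measurable]: "act N m k \<in> M \<rightarrow>\<^sub>M count_space UNIV"
  unfolding act_def[abs_def] by measurable

lemma Z_Suc: "Z N m (Suc k) \<omega> = Z N m k \<omega> - act N m k \<omega> * \<xi> k \<omega>"
  by (simp add: act_def)

context
  fixes N m :: int
  assumes N: "0 < N" "N \<le> m"
begin

lemma bounds: "\<omega> \<in> space M \<Longrightarrow> \<bar>Z N m k \<omega>\<bar> \<le> m" "\<omega> \<in> space M \<Longrightarrow> \<bar>\<xi> k \<omega>\<bar> \<le> 1" "\<bar>act N m k \<omega>\<bar> \<le> 1"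
  using Z_range[OF N, of \<omega> k] \<xi>_range[of \<omega> k] by (auto simp: act_def)

lemma prod_bound: "\<bar>a\<bar> \<le> b \<Longrightarrow> \<bar>c\<bar> \<le> d \<Longrightarrow> \<bar>a * c\<bar> \<le> b * d" for a b c d :: int
  unfolding abs_mult by (intro mult_mono) auto

lemma expectation_Z: "expectation (\<lambda>\<omega>. real_of_int (Z N m k \<omega>)) = N"
proof (induction k)
  case (Suc k)
  have "expectation (\<lambda>\<omega>. real_of_int (act N m k \<omega>) * \<xi> k \<omega>) = 0"
    by (rule flip_expectation) (auto simp: act_def Z_flip)
  moreover have "integrable M (\<lambda>\<omega>. real_of_int (Z N m k \<omega>))" by (rule int_bounded[OF _ bounds(1)]) auto
  moreover have "integrable M (\<lambda>\<omega>. real_of_int (act N m k \<omega> * \<xi> k \<omega>))"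
    by (rule int_bounded[OF _ prod_bound[OF bounds(3,2)]]) auto
  ultimately show ?case using Suc by (simp add: Z_Suc del: Z.simps)
qed (simp add: prob_space)

lemma expectation_Z2: "expectation (\<lambda>\<omega>. real_of_int (Z N m k \<omega> * Z N m k \<omega>)) =
    N * N + (\<Sum>j<k. expectation (\<lambda>\<omega>. real_of_int (act N m j \<omega> * (\<xi> j \<omega> * \<xi> j \<omega>))))"
proof (induction k)
  case (Suc k)
  have eq: "Z N m (Suc k) \<omega> * Z N m (Suc k) \<omega> = Z N m k \<omega> * Z N m k \<omega> + act N m k \<omega> * (\<xi> k \<omega> * \<xi> k \<omega>)
      - 2 * (act N m k \<omega> * Z N m k \<omega> * \<xi> k \<omega>)" for \<omega>
    by (simp add: act_def algebra_simps)
  have "expectation (\<lambda>\<omega>. real_of_int (act N m k \<omega> * Z N m k \<omega>) * \<xi> k \<omega>) = 0"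
    by (rule flip_expectation) (auto simp: act_def Z_flip)
  moreover have "integrable M (\<lambda>\<omega>. real_of_int (Z N m k \<omega> * Z N m k \<omega>))"
    by (rule int_bounded[OF _ prod_bound[OF bounds(1,1)]]) auto
  moreover have "integrable M (\<lambda>\<omega>. real_of_int (act N m k \<omega> * (\<xi> k \<omega> * \<xi> k \<omega>)))"
    by (rule int_bounded[OF _ prod_bound[OF bounds(3) prod_bound[OF bounds(2,2)]]]) auto
  moreover have "integrable M (\<lambda>\<omega>. real_of_int (act N m k \<omega> * Z N m k \<omega> * \<xi> k \<omega>))"
    by (rule int_bounded[OF _ prod_bound[OF prod_bound[OF bounds(3,1)] bounds(2)]]) auto
  ultimately show ?case using Suc unfolding eq by (simp del: Z.simps)
qed (simp add: prob_space)

text \<open>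
  Each nonzero step taken before stopping raises the second moment of the stopped walk by its
  probability. The second moment stays below \<open>m * m\<close>, so almost surely only finitely many nonzero
  steps are taken, whereas there are infinitely many of them.
\<close>

lemma AE_stops: "AE \<omega> in M. \<exists>k. act N m k \<omega> = 0"
proof -
  let ?f = "\<lambda>j \<omega>. ennreal (real_of_int (act N m j \<omega> * (\<xi> j \<omega> * \<xi> j \<omega>)))"
  have sq: "\<bar>\<xi> j \<omega> * \<xi> j \<omega>\<bar> = \<xi> j \<omega> * \<xi> j \<omega>" for j \<omega> by simp
  have int: "integrable M (\<lambda>\<omega>. real_of_int (act N m k \<omega> * (\<xi> k \<omega> * \<xi> k \<omega>)))" for k
    by (rule int_bounded[OF _ prod_bound[OF bounds(3) prod_bound[OF bounds(2,2)]]]) auto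
  have nn: "0 \<le> real_of_int (act N m k \<omega> * (\<xi> k \<omega> * \<xi> k \<omega>))" for k \<omega>
    by (auto simp: act_def)
  have "(\<Sum>j<k. \<integral>\<^sup>+\<omega>. ?f j \<omega> \<partial>M) \<le> ennreal (m * m)" for k
  proof -
    have "(\<Sum>j<k. \<integral>\<^sup>+\<omega>. ?f j \<omega> \<partial>M) = (\<Sum>j<k. ennreal (expectation (\<lambda>\<omega>. real_of_int (act N m j \<omega> * (\<xi> j \<omega> * \<xi> j \<omega>)))))"
      by (intro sum.cong refl nn_integral_eq_integral int AE_I2 nn)
    also have "\<dots> = ennreal (\<Sum>j<k. expectation (\<lambda>\<omega>. real_of_int (act N m j \<omega> * (\<xi> j \<omega> * \<xi> j \<omega>))))"
      using nn by (intro sum_ennreal Bochner_Integration.integral_nonneg) auto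
    also have "\<dots> \<le> ennreal (m * m)"
    proof (rule ennreal_leI)
      have "expectation (\<lambda>\<omega>. real_of_int (Z N m k \<omega> * Z N m k \<omega>)) \<le> expectation (\<lambda>\<omega>. real_of_int (m * m))"
      proof (rule integral_mono)
        show "integrable M (\<lambda>\<omega>. real_of_int (Z N m k \<omega> * Z N m k \<omega>))"
          by (rule int_bounded[OF _ prod_bound[OF bounds(1,1)]]) auto
        fix \<omega> assume "\<omega> \<in> space M"
        from prod_bound[OF bounds(1,1)[OF this], of k k]
        show "real_of_int (Z N m k \<omega> * Z N m k \<omega>) \<le> real_of_int (m * m)" by linarith
      qed simp
      then show "(\<Sum>j<k. expectation (\<lambda>\<omega>. real_of_int (act N m j \<omega> * (\<xi> j \<omega> * \<xi> j \<omega>)))) \<le> m * m"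
        unfolding expectation_Z2 using N by (simp add: prob_space) (smt (verit, best) mult_pos_pos of_int_0_less_iff)
    qed
    finally show ?thesis .
  qed
  then have "(\<Sum>j. \<integral>\<^sup>+\<omega>. ?f j \<omega> \<partial>M) \<le> ennreal (m * m)"
    by (intro suminf_le_const) auto
  then have "(\<integral>\<^sup>+\<omega>. (\<Sum>j. ?f j \<omega>) \<partial>M) \<noteq> \<infinity>"
    by (subst nn_integral_suminf) (auto simp: top_unique)
  then have "AE \<omega> in M. (\<Sum>j. ?f j \<omega>) \<noteq> \<infinity>" by (rule nn_integral_PInf_AE[rotated]) simp
  with \<xi>_inf show ?thesis
  proof eventually_elim
    case (elim \<omega>)
    show ?case
    proof (rule ccontr)
      assume "\<nexists>k. act N m k \<omega> = 0"
      then have act: "act N m k \<omega> = 1" for k by (auto simp: act_def split: if_splits)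
      define B where "B = {j. \<xi> j \<omega> \<noteq> 0}"
      have "of_nat n \<le> (\<Sum>j. ?f j \<omega>)" for n
      proof -
        obtain F where F: "F \<subseteq> B" "finite F" "card F = n"
          using elim(1) infinite_arbitrarily_large unfolding B_def by metis
        have "of_nat n = (\<Sum>j\<in>F. (1::ennreal))" using F by simp
        also have "\<dots> \<le> (\<Sum>j\<in>F. ?f j \<omega>)"
        proof (rule sum_mono)
          fix j assume "j \<in> F"
          then have "\<xi> j \<omega> \<noteq> 0" using F by (auto simp: B_def)
          then have "1 \<le> \<xi> j \<omega> * \<xi> j \<omega>" by (smt (verit) mult_pos_pos mult_neg_neg)
          then have "1 \<le> real_of_int (\<xi> j \<omega> * \<xi> j \<omega>)" by linarith
          then show "1 \<le> ?f j \<omega>" unfolding act using ennreal_leI by fastforce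
        qed
        also have "\<dots> \<le> (\<Sum>j. ?f j \<omega>)" using F by (intro sum_le_suminf) auto
        finally show ?thesis .
      qed
      then have "(\<Sum>j. ?f j \<omega>) = \<infinity>"
        using ennreal_Ex_less_of_nat infinity_ennreal_def leD less_top by metis
      with elim(2) show False by simp
    qed
  qed
qed

text \<open>
  The stopped walk keeps the mean \<open>N\<close>, hence ends at \<open>m\<close> with probability at most \<open>N / m\<close>; and it ends at
  \<open>m\<close> unless \<open>S\<close> hits \<open>N\<close>.
\<close>

lemma prob_avoid: "prob {\<omega> \<in> space M. \<forall>k. S k \<omega> \<noteq> N} \<le> real_of_int N / real_of_int m"
proof -
  let ?A = "\<lambda>k. {\<omega> \<in> space M. Z N m k \<omega> = m}"
  have inc: "incseq ?A" by (rule incseq_SucI) auto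
  have Ak: "prob (?A k) \<le> N / m" for k
  proof -
    have "expectation (\<lambda>\<omega>. real_of_int m * indicator (?A k) \<omega>) \<le> expectation (\<lambda>\<omega>. real_of_int (Z N m k \<omega>))"
    proof (rule integral_mono)
      show "integrable M (\<lambda>\<omega>. real_of_int m * indicator (?A k) \<omega>)"
        by (intro integrable_mult_right integrable_real_indicator) (auto simp: emeasure_eq_measure)
      show "integrable M (\<lambda>\<omega>. real_of_int (Z N m k \<omega>))" by (rule int_bounded[OF _ bounds(1)]) auto
      show "real_of_int m * indicator (?A k) \<omega> \<le> real_of_int (Z N m k \<omega>)" if "\<omega> \<in> space M" for \<omega>
        using Z_range[OF N that, of k] by (auto simp: indicator_def)
    qed
    then have "m * prob (?A k) \<le> N" by (simp add: expectation_Z)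
    then show ?thesis using N by (simp add: field_simps)
  qed
  have "prob {\<omega> \<in> space M. \<forall>k. S k \<omega> \<noteq> N} \<le> prob (\<Union>k. ?A k)"
  proof (rule finite_measure_mono_AE)
    show "AE \<omega> in M. \<omega> \<in> {\<omega> \<in> space M. \<forall>k. S k \<omega> \<noteq> N} \<longrightarrow> \<omega> \<in> (\<Union>k. ?A k)"
      using AE_stops
    proof eventually_elim
      case (elim \<omega>)
      then obtain k where "act N m k \<omega> = 0" by blast
      then have "Z N m k \<omega> \<le> 0 \<or> m \<le> Z N m k \<omega>" by (auto simp: act_def split: if_splits)
      then show ?case using Z_inv[OF N, of \<omega> k] Z_range[OF N, of \<omega> k] N by fastforce
    qed
  qed measurable
  also have "\<dots> \<le> N / m"
    by (rule LIMSEQ_le_const2[OF finite_Lim_measure_incseq[OF _ inc]]) (use Ak in auto)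
  finally show ?thesis .
qed

end

lemma AE_hits_pos:
  assumes "0 < N" shows "AE \<omega> in M. \<exists>k. S k \<omega> = N"
proof -
  let ?B = "{\<omega> \<in> space M. \<forall>k. S k \<omega> \<noteq> N}"
  have "(\<lambda>i. real_of_int N / real i) \<longlonglongrightarrow> 0" by (rule lim_const_over_n)
  moreover have "\<forall>\<^sub>F i in sequentially. prob ?B \<le> real_of_int N / real i"
    using eventually_ge_at_top[of "nat N"] by eventually_elim (use prob_avoid[OF assms, of "int _"] in auto)
  ultimately have "prob ?B \<le> 0" by (rule tendsto_lowerbound) simp
  then have "prob ?B = 0" using measure_nonneg[of M ?B] by simp
  then have "AE \<omega> in M. \<omega> \<notin> ?B" by (subst AE_iff_measurable[OF _ refl]) (auto simp: emeasure_eq_measure)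
  with AE_space show ?thesis by eventually_elim auto
qed

lemma flip_walk_uminus: "flip_walk M \<theta> (\<lambda>j \<omega>. - \<xi> j \<omega>)"
proof unfold_locales
  show "(\<lambda>\<omega>. - \<xi> j \<omega>) \<in> M \<rightarrow>\<^sub>M count_space UNIV" for j by measurable
  show "- \<xi> j \<omega> \<in> {-1, 0, 1}" if "\<omega> \<in> space M" for j \<omega> using \<xi>_range[OF that, of j] by auto
qed (use \<xi>_inf in \<open>auto simp: \<theta>_pres \<xi>_flip\<close>)

lemma AE_hits: "AE \<omega> in M. \<exists>k. S k \<omega> = N"
proof -
  consider "N = 0" | "0 < N" | "N < 0" by linarith
  then show ?thesis
  proof cases
    case 1
    have "S 0 \<omega> = 0" for \<omega> by (simp add: S_def)
    then show ?thesis unfolding 1 by blast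
  next
    case 2 then show ?thesis by (rule AE_hits_pos)
  next
    case 3
    interpret neg: flip_walk M \<theta> "\<lambda>j \<omega>. - \<xi> j \<omega>" by (rule flip_walk_uminus)
    have "neg.S k \<omega> = - S k \<omega>" for k \<omega> by (simp add: neg.S_def S_def sum_negf)
    then show ?thesis using neg.AE_hits_pos[of "- N"] 3 by simp
  qed
qed

text \<open>
  \<open>\<Theta> k\<close> reverses the first \<open>k\<close> steps.
\<close>

primrec \<Theta> :: "nat \<Rightarrow> 'a \<Rightarrow> 'a" where
  "\<Theta> 0 \<omega> = \<omega>"
| "\<Theta> (Suc k) \<omega> = \<theta> k (\<Theta> k \<omega>)"

lemma \<Theta>_meas [measurable]: "\<Theta> k \<in> M \<rightarrow>\<^sub>M M"
  by (induction k) (simp_all add: measurable_compose)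

lemma \<Theta>_pres: "distr M M (\<Theta> k) = M"
proof (induction k)
  case 0
  have "\<Theta> 0 = (\<lambda>\<omega>. \<omega>)" by auto
  then show ?case by (simp add: distr_id2)
next
  case (Suc k)
  have "distr M M (\<Theta> (Suc k)) = distr (distr M M (\<Theta> k)) M (\<theta> k)"
    by (subst distr_distr) (auto simp: comp_def intro!: distr_cong)
  also have "\<dots> = M" by (simp only: Suc \<theta>_pres)
  finally show ?case .
qed

lemma \<Theta>_space: "\<omega> \<in> space M \<Longrightarrow> \<Theta> k \<omega> \<in> space M"
  using \<Theta>_meas[of k] by (rule measurable_space)

lemma \<xi>_\<Theta>: "\<omega> \<in> space M \<Longrightarrow> \<xi> i (\<Theta> k \<omega>) = (if i < k then - \<xi> i \<omega> else \<xi> i \<omega>)"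
  by (induction k) (auto simp: \<xi>_flip \<Theta>_space)

lemma S_\<Theta>: "\<omega> \<in> space M \<Longrightarrow> i \<le> k \<Longrightarrow> S i (\<Theta> k \<omega>) = - S i \<omega>"
  unfolding S_def by (simp add: \<xi>_\<Theta> sum_negf[symmetric] del: sum_negf)

definition first_hit :: "('a \<Rightarrow> int) \<Rightarrow> nat \<Rightarrow> 'a \<Rightarrow> bool" where
  "first_hit n k \<omega> \<longleftrightarrow> S k \<omega> = n \<omega> \<and> (\<forall>i<k. S i \<omega> \<noteq> n \<omega>)"

definition reflect :: "('a \<Rightarrow> int) \<Rightarrow> 'a \<Rightarrow> 'a" where
  "reflect n \<omega> = (if \<exists>k. S k \<omega> = n \<omega> then \<Theta> (LEAST k. S k \<omega> = n \<omega>) \<omega> else \<omega>)"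

lemma first_hit_ex: "(\<exists>k. first_hit n k \<omega>) \<longleftrightarrow> (\<exists>k. S k \<omega> = n \<omega>)"
  unfolding first_hit_def using exists_least_iff[of "\<lambda>k. S k \<omega> = n \<omega>"] by auto

lemma first_hit_unique: "first_hit n k \<omega> \<Longrightarrow> first_hit n i \<omega> \<Longrightarrow> i = k"
  unfolding first_hit_def by (metis linorder_neqE_nat)

lemma reflect_first_hit: "first_hit n k \<omega> \<Longrightarrow> reflect n \<omega> = \<Theta> k \<omega>"
proof -
  assume h: "first_hit n k \<omega>"
  then have "(LEAST k. S k \<omega> = n \<omega>) = k"
    by (intro Least_equality) (auto simp: first_hit_def not_less[symmetric])
  with h show ?thesis by (auto simp: reflect_def first_hit_def)
qed

context
  fixes n :: "'a \<Rightarrow> int"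
  assumes n_meas [measurable]: "n \<in> M \<rightarrow>\<^sub>M count_space UNIV"
    and n_inv: "\<forall>j. \<forall>\<omega>\<in>space M. n (\<theta> j \<omega>) = n \<omega>"
begin

lemma n_\<Theta>: "\<omega> \<in> space M \<Longrightarrow> n (\<Theta> k \<omega>) = n \<omega>"
  by (induction k) (auto simp: n_inv \<Theta>_space)

lemma AE_first_hit: "AE \<omega> in M. \<exists>k. first_hit n k \<omega>"
proof -
  have "AE \<omega> in M. \<forall>N. \<exists>k. S k \<omega> = N" using AE_hits by (subst AE_all_countable) auto
  then show ?thesis by eventually_elim (auto simp: first_hit_ex)
qed

lemma first_hit_meas [measurable]: "Measurable.pred M (first_hit n k)"
  unfolding first_hit_def[abs_def] by measurable

lemma reflect_meas [measurable]: "reflect n \<in> M \<rightarrow>\<^sub>M M"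
proof -
  have [measurable]: "(\<lambda>\<omega>. LEAST k. S k \<omega> = n \<omega>) \<in> M \<rightarrow>\<^sub>M count_space UNIV" by measurable
  have "(\<lambda>\<omega>. \<Theta> (LEAST k. S k \<omega> = n \<omega>) \<omega>) \<in> M \<rightarrow>\<^sub>M M"
    by (rule measurable_compose_countable[of "\<lambda>k \<omega>. \<Theta> k \<omega>"]) measurable
  then show ?thesis unfolding reflect_def[abs_def] by measurable
qed

end

text \<open>
  The reflection principle. On the event that \<open>n\<close> is first hit at time \<open>k\<close>, the map is \<open>\<Theta> k\<close>, and it takes this
  event to the event that \<open>- n\<close> is first hit at time \<open>k\<close>. Both families of events exhaust the space up to
  null sets.
\<close>

lemma reflect_pres:
  assumes n [measurable]: "n \<in> M \<rightarrow>\<^sub>M count_space UNIV"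
    and n_inv: "\<forall>j. \<forall>\<omega>\<in>space M. n (\<theta> j \<omega>) = n \<omega>"
  shows "distr M M (reflect n) = M"
proof (rule measure_eqI)
  note [measurable] = reflect_meas[OF n n_inv] first_hit_meas[OF n n_inv]
  let ?n = "\<lambda>\<omega>. - n \<omega>"
  have n' [measurable]: "?n \<in> M \<rightarrow>\<^sub>M count_space UNIV" by measurable
  have n'_inv: "\<forall>j. \<forall>\<omega>\<in>space M. ?n (\<theta> j \<omega>) = ?n \<omega>" using n_inv by simp
  note [measurable] = first_hit_meas[OF n' n'_inv]
  fix X assume "X \<in> sets (distr M M (reflect n))"
  then have X [measurable]: "X \<in> sets M" by simp
  have split: "emeasure M Y = (\<Sum>k. emeasure M {\<omega> \<in> space M. first_hit n' k \<omega> \<and> \<omega> \<in> Y})"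
    if Y [measurable]: "Y \<in> sets M" and m [measurable]: "n' \<in> M \<rightarrow>\<^sub>M count_space UNIV"
      and i: "\<forall>j. \<forall>\<omega>\<in>space M. n' (\<theta> j \<omega>) = n' \<omega>" for Y n'
  proof -
    note [measurable] = first_hit_meas[OF m i]
    have "emeasure M Y = emeasure M (\<Union>k. {\<omega> \<in> space M. first_hit n' k \<omega> \<and> \<omega> \<in> Y})"
      by (rule emeasure_eq_AE) (use AE_first_hit[OF m i] AE_space in \<open>eventually_elim, auto\<close>)
    also have "\<dots> = (\<Sum>k. emeasure M {\<omega> \<in> space M. first_hit n' k \<omega> \<and> \<omega> \<in> Y})"
      by (rule suminf_emeasure[symmetric]) (auto simp: disjoint_family_on_def dest: first_hit_unique)
    finally show ?thesis .
  qed
  have "emeasure (distr M M (reflect n)) X = emeasure M (reflect n -` X \<inter> space M)"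
    by (rule emeasure_distr) measurable
  also have "\<dots> = (\<Sum>k. emeasure M {\<omega> \<in> space M. first_hit n k \<omega> \<and> \<omega> \<in> reflect n -` X \<inter> space M})"
    by (rule split[OF _ n n_inv]) measurable
  also have "\<dots> = (\<Sum>k. emeasure M {\<omega> \<in> space M. first_hit ?n k \<omega> \<and> \<omega> \<in> X})"
  proof (rule suminf_cong)
    fix k
    have "first_hit ?n k (\<Theta> k \<omega>) = first_hit n k \<omega>" if "\<omega> \<in> space M" for \<omega>
      using that by (auto simp: first_hit_def S_\<Theta> n_\<Theta>[OF n n_inv])
    then have "{\<omega> \<in> space M. first_hit n k \<omega> \<and> \<omega> \<in> reflect n -` X \<inter> space M} =
        \<Theta> k -` {\<omega> \<in> space M. first_hit ?n k \<omega> \<and> \<omega> \<in> X} \<inter> space M"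
      by (auto simp: reflect_first_hit \<Theta>_space)
    also have "emeasure M \<dots> = emeasure (distr M M (\<Theta> k)) {\<omega> \<in> space M. first_hit ?n k \<omega> \<and> \<omega> \<in> X}"
      by (subst emeasure_distr) auto
    finally show "emeasure M {\<omega> \<in> space M. first_hit n k \<omega> \<and> \<omega> \<in> reflect n -` X \<inter> space M} =
        emeasure M {\<omega> \<in> space M. first_hit ?n k \<omega> \<and> \<omega> \<in> X}" by (simp add: \<Theta>_pres)
  qed
  also have "\<dots> = emeasure M X" by (rule split[OF X n' n'_inv, symmetric])
  finally show "emeasure (distr M M (reflect n)) X = emeasure M X" .
qed simp

end


section \<open>The absolutely continuous component\<close>

lemma emeasure_lebesgue_borel: "X \<in> sets borel \<Longrightarrow> emeasure lebesgue X = emeasure lborel X"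
  by (simp add: emeasure_completion)

text \<open>
  Steinhaus' argument: small translates of \<open>K\<close> remain in an open set \<open>U\<close> of measure less than twice that of
  \<open>K\<close>, which has no room for two disjoint copies of \<open>K\<close>.
\<close>

lemma positive_overlap:
  fixes K :: "real set"
  assumes K: "compact K" "0 < emeasure lborel K"
  obtains \<delta>0 where "0 < \<delta>0" "\<And>\<delta>. 0 < \<delta> \<Longrightarrow> \<delta> \<le> \<delta>0 \<Longrightarrow> 0 < emeasure lborel {t \<in> K. t + \<delta> \<in> K}"
proof -
  have Kb [measurable]: "K \<in> sets borel" using K(1) by (simp add: borel_compact)
  have fin: "emeasure lborel K < \<infinity>" using emeasure_compact_finite[OF K(1)] by simp
  define e where "e = enn2real (emeasure lborel K)"
  have e: "0 < e" "ennreal e = emeasure lborel K" using K(2) fin by (auto simp: e_def enn2real_positive_iff)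
  obtain U where U: "open U" "K \<subseteq> U" "U - K \<in> lmeasurable" "emeasure lebesgue (U - K) < ennreal e"
    using sets_lebesgue_outer_open[of K e] e(1) Kb by auto
  have "\<exists>d>0. \<forall>x\<in>K. \<forall>y\<in>- U. d \<le> dist x y"
    using U K by (intro separate_compact_closed) auto
  then obtain d where d: "0 < d" "\<And>x y. x \<in> K \<Longrightarrow> y \<notin> U \<Longrightarrow> d \<le> dist x y" by auto
  have "0 < emeasure lborel {t \<in> K. t + \<delta> \<in> K}" if \<delta>: "0 < \<delta>" "\<delta> \<le> d / 2" for \<delta>
  proof (rule ccontr)
    assume "\<not> ?thesis"
    then have z: "emeasure lborel {t \<in> K. t + \<delta> \<in> K} = 0" by simp
    have shift: "emeasure lborel {s. s - \<delta> \<in> X} = emeasure lborel X" if [measurable]: "X \<in> sets borel" for X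
    proof -
      have "{s. s - \<delta> \<in> X} = (+) (- \<delta>) -` X \<inter> space lborel" by auto
      then have "emeasure lborel {s. s - \<delta> \<in> X} = emeasure (distr lborel borel ((+) (- \<delta>))) X"
        by (subst emeasure_distr) auto
      then show ?thesis by (simp add: lborel_distr_plus)
    qed
    define W where "W = {t \<in> K. t + \<delta> \<in> K}"
    have W [measurable]: "W \<in> sets borel" unfolding W_def by measurable
    have W' [measurable]: "{s. s - \<delta> \<in> W} \<in> sets borel" by measurable
    have Ud: "U - K \<in> sets borel" using U(1) by simp
    have "emeasure lborel K = emeasure lborel {s. s - \<delta> \<in> K}" by (simp add: shift)
    also have "\<dots> \<le> emeasure lborel ((U - K) \<union> {s. s - \<delta> \<in> W})"
    proof (rule emeasure_mono)
      have "s \<in> U" if "s - \<delta> \<in> K" for s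
        using d(2)[OF that, of s] d(1) \<delta> by (auto simp: dist_real_def)
      then show "{s. s - \<delta> \<in> K} \<subseteq> (U - K) \<union> {s. s - \<delta> \<in> W}" by (auto simp: W_def)
    qed (use Ud W' in auto)
    also have "\<dots> \<le> emeasure lborel (U - K) + emeasure lborel {s. s - \<delta> \<in> W}"
      using Ud W' by (intro emeasure_subadditive) auto
    also have "\<dots> = emeasure lborel (U - K)" by (subst shift) (use z W in \<open>auto simp: W_def\<close>)
    also have "\<dots> < emeasure lborel K" using U(4) e(2) emeasure_lebesgue_borel[OF Ud] by simp
    finally show False by simp
  qed
  then show ?thesis using d(1) that[of "d / 2"] by auto
qed

text \<open>
  The distribution function of Lebesgue measure on \<open>K\<close> is continuous; \<open>a\<close> and \<open>b\<close> are points where it takes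
  one and two thirds of its final value.
\<close>

lemma split_measure:
  fixes K :: "real set"
  assumes K: "compact K" "0 < emeasure lborel K"
  obtains a b where "a < b" "0 < emeasure lborel (K \<inter> {..a})" "0 < emeasure lborel (K \<inter> {b..})"
proof -
  have Kb [measurable]: "K \<in> sets borel" using K(1) by (simp add: borel_compact)
  have Kf: "K \<in> fmeasurable lborel" using emeasure_compact_finite[OF K(1)] by (intro fmeasurableI) auto
  have f: "K \<inter> X \<in> fmeasurable lborel" if "X \<in> sets borel" for X
    using fmeasurable_Int_fmeasurable[OF Kf, of X] that by simp
  define F where "F t = measure lborel (K \<inter> {..t})" for t
  define m where "m = measure lborel K"
  have m: "0 < m" using K(2) Kf by (simp add: m_def emeasure_eq_measure2)
  obtain l u where lu: "K \<subseteq> {l..u}"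
    using compact_imp_bounded[OF K(1)] by (metis bounded_subset_cbox_symmetric cbox_interval)
  have lip: "F t - F s \<le> t - s" "F s \<le> F t" if "s \<le> t" for s t
  proof -
    have "F t \<le> measure lborel ((K \<inter> {..s}) \<union> {s..t})"
      unfolding F_def by (intro measure_mono_fmeasurable fmeasurable.Un f) (auto intro!: fmeasurableI simp: emeasure_lborel_Icc_eq)
    also have "\<dots> \<le> F s + measure lborel {s..t}"
      unfolding F_def by (intro measure_Un_le) auto
    finally show "F t - F s \<le> t - s" using that by simp
    show "F s \<le> F t" unfolding F_def using that by (intro measure_mono_fmeasurable f) auto
  qed
  have cont: "continuous_on {l - 1..u} F"
  proof (rule lipschitz_on_continuous_on[of 1], rule lipschitz_onI)
    fix s t show "dist (F s) (F t) \<le> 1 * dist s t"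
      using lip[of s t] lip[of t s] by (cases "s \<le> t") (auto simp: dist_real_def)
  qed simp
  have F0: "F (l - 1) = 0" "F u = m"
  proof -
    have "K \<inter> {..l - 1} = {}" "K \<inter> {..u} = K" using lu by auto
    then show "F (l - 1) = 0" "F u = m" by (simp_all add: F_def m_def)
  qed
  have "K \<noteq> {}" using K(2) by auto
  then have "l - 1 \<le> u" using lu by auto
  then have ex: "\<exists>t. F t = y" if "0 \<le> y" "y \<le> m" for y
    using IVT'[of F "l - 1" y u] cont F0 that by auto
  obtain a b where ab: "F a = m / 3" "F b = 2 * m / 3" using ex[of "m/3"] ex[of "2*m/3"] m by auto
  have "a < b" using lip(2)[of b a] ab m by (cases "a < b") auto
  moreover have "0 < emeasure lborel (K \<inter> {..a})"
    using ab m f[of "{..a}"] by (auto simp: emeasure_eq_measure2 F_def)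
  moreover have "0 < emeasure lborel (K \<inter> {b..})"
  proof -
    have "m = measure lborel ((K \<inter> {..b}) \<union> (K \<inter> {b..}))" unfolding m_def by (rule arg_cong2[where f = measure]) auto
    also have "\<dots> \<le> F b + measure lborel (K \<inter> {b..})" unfolding F_def by (rule measure_Un_le) auto
    finally show ?thesis using ab m f[of "{b..}"] by (auto simp: emeasure_eq_measure2)
  qed
  ultimately show ?thesis by (rule that)
qed

text \<open>
  The set where the density exceeds a small constant has positive measure; a compact part of it is
  split into a lower piece \<open>K\<close>, where times will be interchanged, and an upper piece, which supplies the
  slow edges of a block.
\<close>

lemma ac_component_structure:
  assumes P: "real_distribution P" and nonneg: "AE x in P. 0 \<le> x" and ac: "has_ac_component P"
  obtains c K \<alpha> \<beta>0 \<beta>1 where "0 < c" "compact K" "K \<subseteq> {0..\<alpha>}" "0 \<le> \<alpha>" "\<alpha> < \<beta>0" "\<beta>0 \<le> \<beta>1"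
    "0 < emeasure lborel K" "\<And>X. X \<in> sets borel \<Longrightarrow> ennreal c * emeasure lborel (X \<inter> K) \<le> emeasure P X"
    "0 < emeasure P {\<beta>0..\<beta>1}"
proof -
  interpret real_distribution P by (rule P)
  obtain A N where AS: "lebesgue_decomposition P A N" "emeasure A UNIV \<noteq> 0"
    using ac by (auto simp: has_ac_component_def)
  have sA: "sets A = sets lborel" and PA: "\<And>X. X \<in> sets borel \<Longrightarrow> emeasure A X \<le> emeasure P X"
    and Aac: "absolutely_continuous lborel A"
    using AS(1) by (auto simp: lebesgue_decomposition_def)
  obtain f where f [measurable]: "f \<in> borel_measurable lborel" and fA: "density lborel f = A"
    using sigma_finite_measure.Radon_Nikodym[OF sigma_finite_lborel Aac sA] by blast
  have AX: "emeasure A X = (\<integral>\<^sup>+x. f x * indicator X x \<partial>lborel)" if "X \<in> sets borel" for X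
    unfolding fA[symmetric] using that by (intro emeasure_density) auto
  define D where "D n = {x \<in> {0..real n}. 1 / real (Suc n) \<le> f x}" for n
  have D [measurable]: "D n \<in> sets borel" for n unfolding D_def by measurable
  have "\<exists>n. emeasure lborel (D n) \<noteq> 0"
  proof (rule ccontr)
    assume "\<nexists>n. emeasure lborel (D n) \<noteq> 0"
    then have "AE x in lborel. \<forall>n. x \<notin> D n"
      by (subst AE_all_countable) (auto intro!: AE_not_in simp: null_sets_def)
    moreover have "AE x in lborel. \<not> (x < 0 \<and> f x \<noteq> 0)"
    proof -
      have "emeasure P {x. x < 0} = 0" using nonneg by (subst (asm) AE_iff_measurable[OF _ refl]) (auto simp: not_le)
      then have "emeasure A {x. x < 0} = 0" using PA[of "{x. x < 0}"] by auto
      then have "(\<integral>\<^sup>+x. f x * indicator {x. x < 0} x \<partial>lborel) = 0" using AX[of "{x. x < 0}"] by simp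
      then have "AE x in lborel. f x * indicator {x. x < 0} x = 0" by (subst (asm) nn_integral_0_iff_AE) auto
      then show ?thesis by eventually_elim (auto simp: indicator_def)
    qed
    ultimately have "AE x in lborel. f x = 0"
    proof eventually_elim
      case (elim x)
      show ?case
      proof (rule ccontr)
        assume fx: "f x \<noteq> 0"
        then have x: "0 \<le> x" using elim(2) by auto
        obtain k where k: "inverse (real (Suc k)) < enn2real (min 1 (f x))"
        proof -
          have "0 < min 1 (f x)" "min 1 (f x) < \<top>" using fx by (auto simp: zero_less_iff_neq_zero min_less_iff_disj)
          then have "0 < enn2real (min 1 (f x))" by (simp add: enn2real_positive_iff)
          then show ?thesis using reals_Archimedean that by blast
        qed
        define n where "n = max k (nat \<lceil>x\<rceil>)"
        have "1 / real (Suc n) \<le> inverse (real (Suc k))" by (simp add: n_def field_simps)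
        also have "\<dots> \<le> enn2real (min 1 (f x))" using k by simp
        finally have "ennreal (1 / real (Suc n)) \<le> ennreal (enn2real (min 1 (f x)))" by (rule ennreal_leI)
        also have "\<dots> = min 1 (f x)" by (rule ennreal_enn2real) (simp add: min_less_iff_disj)
        finally have "ennreal (1 / real (Suc n)) \<le> f x" by simp
        moreover have "x \<le> real n" unfolding n_def by linarith
        ultimately show False using elim(1) x by (auto simp: D_def)
      qed
    qed
    moreover have "emeasure A UNIV = (\<integral>\<^sup>+x. f x * indicator UNIV x \<partial>lborel)" by (rule AX) simp
    ultimately have "emeasure A UNIV = 0" by (simp add: nn_integral_0_iff_AE)
    with AS(2) show False by simp
  qed
  then obtain n where n: "emeasure lborel (D n) \<noteq> 0" by blast
  define c where "c = 1 / real (Suc n)"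
  have Dfin: "emeasure lborel (D n) < \<infinity>"
  proof -
    have "emeasure lborel (D n) \<le> emeasure lborel {0..real n}" by (rule emeasure_mono) (auto simp: D_def)
    also have "\<dots> < \<infinity>" by simp
    finally show ?thesis .
  qed
  define e where "e = enn2real (emeasure lborel (D n))"
  have "0 < emeasure lborel (D n)" using n by (simp add: zero_less_iff_neq_zero)
  with Dfin have e: "0 < e" "ennreal e = emeasure lborel (D n)" by (auto simp: e_def enn2real_positive_iff)
  have "D n \<in> sets lebesgue" using D[of n] by simp
  then obtain T where T0: "closed T" "T \<subseteq> D n" "D n - T \<in> lmeasurable" "emeasure lebesgue (D n - T) < ennreal e"
    using e(1) by (rule sets_lebesgue_inner_closed)
  note T = T0(1,2,4)
  have Tb [measurable]: "T \<in> sets borel" using T(1) by simp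
  have Tc: "compact T"
  proof -
    have "T \<subseteq> {0..real n}" using T(2) by (auto simp: D_def)
    then show ?thesis using T(1) bounded_subset[OF bounded_closed_interval] by (auto simp: compact_eq_bounded_closed)
  qed
  have "0 < emeasure lborel T"
  proof (rule ccontr)
    assume "\<not> ?thesis"
    then have "emeasure lborel T = 0" by simp
    moreover have "emeasure lborel (D n) \<le> emeasure lborel (D n - T) + emeasure lborel T"
      by (rule order.trans[OF emeasure_mono emeasure_subadditive]) auto
    ultimately show False using T(3) e(2) emeasure_lebesgue_borel[of "D n - T"] by simp
  qed
  from split_measure[OF Tc this] obtain a b where ab: "a < b" "0 < emeasure lborel (T \<inter> {..a})" "0 < emeasure lborel (T \<inter> {b..})" .
  have T0: "0 \<le> x" "x \<le> real n" if "x \<in> T" for x using that T(2) by (auto simp: D_def)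
  have key: "ennreal c * emeasure lborel (X \<inter> T) \<le> emeasure P X" if [measurable]: "X \<in> sets borel" for X
  proof -
    have "ennreal c * emeasure lborel (X \<inter> T) = (\<integral>\<^sup>+x. ennreal c * indicator (X \<inter> T) x \<partial>lborel)"
      by (simp add: nn_integral_cmult)
    also have "\<dots> \<le> (\<integral>\<^sup>+x. f x * indicator X x \<partial>lborel)"
      using T(2) by (intro nn_integral_mono) (auto simp: indicator_def D_def c_def)
    also have "\<dots> = emeasure A X" by (simp add: AX)
    finally show ?thesis using PA[of X] by simp
  qed
  have c: "0 < c" by (simp add: c_def)
  have ne: "T \<inter> {..a} \<noteq> {}" "T \<inter> {b..} \<noteq> {}" using ab(2,3) by auto
  show ?thesis
  proof (rule that[of c "T \<inter> {..a}" a b "real n"])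
    show "0 \<le> a" "b \<le> real n" using ne T0 by (auto intro: order.trans)
    show "compact (T \<inter> {..a})" using Tc by (intro compact_Int_closed) auto
    show "T \<inter> {..a} \<subseteq> {0..a}" using T0 by auto
    show "ennreal c * emeasure lborel (X \<inter> (T \<inter> {..a})) \<le> emeasure P X" if "X \<in> sets borel" for X
    proof -
      have "emeasure lborel (X \<inter> (T \<inter> {..a})) \<le> emeasure lborel (X \<inter> T)" using that by (intro emeasure_mono) auto
      then show ?thesis using key[OF that] by (meson mult_left_mono order.trans zero_le)
    qed
    have "T \<inter> {b..} = {b..real n} \<inter> T" using T0 by auto
    then have "0 < ennreal c * emeasure lborel ({b..real n} \<inter> T)" using ab(3) c by (simp add: ennreal_zero_less_mult_iff)
    then show "0 < emeasure P {b..real n}" using key[of "{b..real n}"] by simp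
  qed (use ab c in auto)
qed


section \<open>Marked passage times\<close>

text \<open>
  A passage time together with a mark. Times with mark \<open>None\<close> are never moved.
\<close>

type_synonym marked = "real \<times> bool option"

text \<open>
  With mark \<open>Some b\<close>, cells \<open>[k \<delta>, (k + 1) \<delta>)\<close> are paired with one of their two neighbours, according to the
  parity of \<open>k\<close> and to \<open>b\<close>, and \<open>t\<close> moves to the corresponding point of the partner cell if both points
  lie in \<open>K\<close>. The pairing makes this an involution; a single mark would miss some of the pairs \<open>t\<close>, \<open>t + \<delta>\<close>
  in \<open>K\<close>, possibly all that carry mass.
\<close>

definition shift_dir :: "real set \<Rightarrow> real \<Rightarrow> marked \<Rightarrow> int" where
  "shift_dir K \<delta> w = (case w of (t, None) \<Rightarrow> 0 | (t, Some b) \<Rightarrow>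
     if t \<in> K \<and> t + \<delta> \<in> K \<and> (even \<lfloor>t / \<delta>\<rfloor> \<longleftrightarrow> b) then 1
     else if t \<in> K \<and> t - \<delta> \<in> K \<and> (even \<lfloor>t / \<delta>\<rfloor> \<longleftrightarrow> \<not> b) then - 1 else 0)"

definition swap :: "real set \<Rightarrow> real \<Rightarrow> marked \<Rightarrow> marked" where
  "swap K \<delta> w = (fst w + \<delta> * of_int (shift_dir K \<delta> w), snd w)"

lemma shift_dir_range: "shift_dir K \<delta> w \<in> {-1, 0, 1}"
  by (auto simp: shift_dir_def split: prod.splits option.splits)

lemma fst_swap: "fst (swap K \<delta> w) = fst w + \<delta> * of_int (shift_dir K \<delta> w)"
  by (simp add: swap_def)

lemma swap_outside: "fst w \<notin> K \<Longrightarrow> shift_dir K \<delta> w = 0 \<and> swap K \<delta> w = w"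
  by (cases w) (auto simp: shift_dir_def swap_def split: option.splits)

lemma swap_in: "fst w \<in> K \<Longrightarrow> fst (swap K \<delta> w) \<in> K"
  by (cases w) (auto simp: shift_dir_def swap_def split: option.splits)

lemma floor_shift: "0 < \<delta> \<Longrightarrow> \<lfloor>(t + \<delta>) / \<delta>\<rfloor> = \<lfloor>t / \<delta>\<rfloor> + 1" "0 < \<delta> \<Longrightarrow> \<lfloor>(t - \<delta>) / \<delta>\<rfloor> = \<lfloor>t / \<delta>\<rfloor> - 1"
  for t \<delta> :: real
  by (simp_all add: add_divide_distrib diff_divide_distrib)

lemma shift_dir_swap: "0 < \<delta> \<Longrightarrow> shift_dir K \<delta> (swap K \<delta> w) = - shift_dir K \<delta> w"
proof (cases w)
  case (Pair t c)
  assume "0 < \<delta>"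
  note fl = floor_shift[OF this]
  show ?thesis
  proof (cases c)
    case None then show ?thesis by (simp add: Pair shift_dir_def swap_def)
  next
    case (Some b)
    consider (up) "t \<in> K" "t + \<delta> \<in> K" "even \<lfloor>t / \<delta>\<rfloor> \<longleftrightarrow> b"
      | (dn) "t \<in> K" "t - \<delta> \<in> K" "even \<lfloor>t / \<delta>\<rfloor> \<longleftrightarrow> \<not> b"
      | (no) "shift_dir K \<delta> w = 0"
      by (cases "t \<in> K \<and> t + \<delta> \<in> K \<and> (even \<lfloor>t / \<delta>\<rfloor> \<longleftrightarrow> b)";
          cases "t \<in> K \<and> t - \<delta> \<in> K \<and> (even \<lfloor>t / \<delta>\<rfloor> \<longleftrightarrow> \<not> b)")
        (auto simp: Pair Some shift_dir_def)
    then show ?thesis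
    proof cases
      case up
      then have "shift_dir K \<delta> w = 1" by (simp add: Pair Some shift_dir_def)
      moreover have "shift_dir K \<delta> (t + \<delta>, Some b) = - 1" using up fl by (auto simp: shift_dir_def)
      ultimately show ?thesis by (simp add: swap_def Pair Some)
    next
      case dn
      then have "shift_dir K \<delta> w = - 1" by (auto simp: Pair Some shift_dir_def)
      moreover have "shift_dir K \<delta> (t - \<delta>, Some b) = 1" using dn fl by (auto simp: shift_dir_def)
      ultimately show ?thesis by (simp add: swap_def Pair Some)
    next
      case no then show ?thesis by (simp add: swap_def)
    qed
  qed
qed

abbreviation marked_space :: "marked measure" where
  "marked_space \<equiv> borel \<Otimes>\<^sub>M count_space UNIV"

lemma shift_dir_measurable [measurable]:
  assumes [measurable]: "K \<in> sets borel" "d \<in> borel_measurable N" "w \<in> N \<rightarrow>\<^sub>M marked_space"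
  shows "(\<lambda>x. shift_dir K (d x) (w x)) \<in> N \<rightarrow>\<^sub>M count_space UNIV"
proof -
  define g :: "bool option \<Rightarrow> _ \<Rightarrow> int" where "g b x = (case b of None \<Rightarrow> 0 | Some b \<Rightarrow>
     if fst (w x) \<in> K \<and> fst (w x) + d x \<in> K \<and> (even \<lfloor>fst (w x) / d x\<rfloor> \<longleftrightarrow> b) then 1
     else if fst (w x) \<in> K \<and> fst (w x) - d x \<in> K \<and> (even \<lfloor>fst (w x) / d x\<rfloor> \<longleftrightarrow> \<not> b) then - 1 else 0)" for b x
  have "g b \<in> N \<rightarrow>\<^sub>M count_space UNIV" for b
    unfolding g_def by (cases b) measurable
  then have "(\<lambda>x. g (snd (w x)) x) \<in> N \<rightarrow>\<^sub>M count_space UNIV"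
    by (rule measurable_compose_countable) measurable
  also have "(\<lambda>x. g (snd (w x)) x) = (\<lambda>x. shift_dir K (d x) (w x))"
    by (auto simp: g_def shift_dir_def split: prod.splits option.splits)
  finally show ?thesis .
qed

lemma swap_measurable [measurable]:
  assumes [measurable]: "K \<in> sets borel" "d \<in> borel_measurable N" "w \<in> N \<rightarrow>\<^sub>M marked_space"
  shows "(\<lambda>x. swap K (d x) (w x)) \<in> N \<rightarrow>\<^sub>M marked_space"
  unfolding swap_def by measurable

lemma nn_integral_shift: "f \<in> borel_measurable borel \<Longrightarrow> (\<integral>\<^sup>+x. f (x + \<delta>) \<partial>lborel) = (\<integral>\<^sup>+x. f x \<partial>lborel)" for \<delta> :: real
  using nn_integral_real_affine[of f 1 \<delta>] by (simp add: add.commute)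

text \<open>
  The points that move up and those that move down are translates of each other by \<open>\<delta>\<close>.
\<close>

lemma swap_preserves_lborel:
  fixes g :: "real \<Rightarrow> ennreal"
  assumes [measurable]: "K \<in> sets borel" "g \<in> borel_measurable borel" and \<delta>: "0 < \<delta>"
  shows "(\<integral>\<^sup>+t. g (fst (swap K \<delta> (t, c))) * indicator K t \<partial>lborel) = (\<integral>\<^sup>+t. g t * indicator K t \<partial>lborel)"
proof (cases c)
  case None
  then show ?thesis by (simp add: swap_def shift_dir_def)
next
  case (Some b)
  define U where "U = {t \<in> K. t + \<delta> \<in> K \<and> (even \<lfloor>t / \<delta>\<rfloor> \<longleftrightarrow> b)}"
  define W where "W = {t \<in> K. t - \<delta> \<in> K \<and> (even \<lfloor>t / \<delta>\<rfloor> \<longleftrightarrow> \<not> b)}"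
  define R where "R = K - U - W"
  have U [measurable]: "U \<in> sets borel" unfolding U_def by measurable
  have W [measurable]: "W \<in> sets borel" unfolding W_def by measurable
  have R [measurable]: "R \<in> sets borel" unfolding R_def by measurable
  note fl = floor_shift[OF \<delta>]
  have WU: "t + \<delta> \<in> W \<longleftrightarrow> t \<in> U" for t using fl(1)[of t] by (auto simp: U_def W_def)
  have ind: "indicator K t = (indicator U t + indicator W t + indicator R t :: ennreal)" for t
    by (auto simp: indicator_def U_def W_def R_def)
  have sw: "g (fst (swap K \<delta> (t, c))) * indicator K t =
      g (t + \<delta>) * indicator U t + g (t - \<delta>) * indicator W t + g t * indicator R t" for t
    by (auto simp: swap_def shift_dir_def Some U_def W_def R_def indicator_def)
  have "(\<integral>\<^sup>+t. g (t - \<delta>) * indicator W t \<partial>lborel) = (\<integral>\<^sup>+t. g (t + \<delta> - \<delta>) * indicator W (t + \<delta>) \<partial>lborel)"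
    by (rule nn_integral_shift[symmetric, of "\<lambda>t. g (t - \<delta>) * indicator W t"]) measurable
  then have 1: "(\<integral>\<^sup>+t. g (t - \<delta>) * indicator W t \<partial>lborel) = (\<integral>\<^sup>+t. g t * indicator U t \<partial>lborel)"
    using WU by (simp add: indicator_def)
  have "(\<integral>\<^sup>+t. g t * indicator W t \<partial>lborel) = (\<integral>\<^sup>+t. g (t + \<delta>) * indicator W (t + \<delta>) \<partial>lborel)"
    by (rule nn_integral_shift[symmetric, of "\<lambda>t. g t * indicator W t"]) measurable
  then have 2: "(\<integral>\<^sup>+t. g (t + \<delta>) * indicator U t \<partial>lborel) = (\<integral>\<^sup>+t. g t * indicator W t \<partial>lborel)"
    using WU by (simp add: indicator_def)
  show ?thesis unfolding sw unfolding ind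
    by (simp add: nn_integral_add distrib_left 1 2 add.commute)
qed

locale swap_space = prob_space P for P :: "real measure" +
  fixes c :: real and K :: "real set"
  assumes setsP: "sets P = sets borel" and c: "0 < c" and K [measurable]: "K \<in> sets borel"
    and finK: "emeasure lborel K < \<infinity>"
    and dom: "\<And>X. X \<in> sets borel \<Longrightarrow> ennreal c * emeasure lborel (X \<inter> K) \<le> emeasure P X"
begin

lemma exists_fraction: "\<exists>h \<in> borel_measurable P. (\<forall>t. h t \<le> 1) \<and> density P h = density lborel (\<lambda>t. ennreal c * indicator K t)"
proof -
  note [measurable_cong] = setsP
  let ?N = "density lborel (\<lambda>t. ennreal c * indicator K t)"
  have N: "emeasure ?N X = ennreal c * emeasure lborel (X \<inter> K)" if [measurable]: "X \<in> sets borel" for X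
  proof -
    have "emeasure ?N X = (\<integral>\<^sup>+t. ennreal c * indicator (X \<inter> K) t \<partial>lborel)"
      by (subst emeasure_density) (auto intro!: nn_integral_cong simp: indicator_def)
    then show ?thesis by (simp add: nn_integral_cmult)
  qed
  have "absolutely_continuous P ?N"
    unfolding absolutely_continuous_def
  proof
    fix X assume "X \<in> null_sets P"
    then have X: "X \<in> sets borel" "emeasure P X = 0" using setsP by (auto simp: null_sets_def)
    then have "emeasure ?N X = 0" using N[OF X(1)] dom[OF X(1)] by simp
    then show "X \<in> null_sets ?N" using X by (auto simp: null_sets_def)
  qed
  then obtain h where h [measurable]: "h \<in> borel_measurable P" and hN: "density P h = ?N"
    using Radon_Nikodym[of ?N] setsP by auto
  define X where "X = {t. 1 < h t}"
  have X [measurable]: "X \<in> sets borel" using h unfolding X_def by (simp add: measurable_cong_sets[OF setsP refl])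
  have "AE t in P. h t \<le> 1"
  proof -
    have fin: "emeasure P X \<noteq> \<infinity>" by simp
    have "(\<integral>\<^sup>+t. h t * indicator X t \<partial>P) = emeasure ?N X" unfolding hN[symmetric] using setsP by (subst emeasure_density) auto
    also have "\<dots> \<le> emeasure P X" using N[OF X] dom[OF X] by simp
    also have "\<dots> = (\<integral>\<^sup>+t. indicator X t \<partial>P)" using setsP by simp
    finally have le: "(\<integral>\<^sup>+t. h t * indicator X t \<partial>P) \<le> (\<integral>\<^sup>+t. indicator X t \<partial>P)" .
    have "(\<integral>\<^sup>+t. h t * indicator X t - indicator X t \<partial>P) = (\<integral>\<^sup>+t. h t * indicator X t \<partial>P) - (\<integral>\<^sup>+t. indicator X t \<partial>P)"
    proof (rule nn_integral_diff)
      have "(\<integral>\<^sup>+t. indicator X t \<partial>P) = emeasure P X" using setsP by (intro nn_integral_indicator) auto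
      then show "(\<integral>\<^sup>+t. indicator X t \<partial>P) \<noteq> \<infinity>" using fin by simp
      show "AE t in P. indicator X t \<le> h t * indicator X t" by (auto simp: X_def indicator_def)
    qed (use setsP in measurable)
    also have "\<dots> = 0"
    proof (rule diff_eq_0_ennreal[OF _ le])
      have "(\<integral>\<^sup>+t. indicator X t \<partial>P) = emeasure P X" using setsP by (intro nn_integral_indicator) auto
      then have "(\<integral>\<^sup>+t. indicator X t \<partial>P) < \<top>" using fin by (simp add: less_top[symmetric])
      with le show "(\<integral>\<^sup>+t. h t * indicator X t \<partial>P) < \<top>" by (rule order.strict_trans1)
    qed
    finally have "AE t in P. h t * indicator X t - indicator X t = 0"
      using setsP by (subst (asm) nn_integral_0_iff_AE) auto
    then show ?thesis
    proof eventually_elim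
      case (elim t)
      show ?case
      proof (rule ccontr)
        assume "\<not> h t \<le> 1"
        with elim show False by (auto simp: X_def diff_eq_0_iff_ennreal)
      qed
    qed
  qed
  then have "density P (\<lambda>t. min 1 (h t)) = density P h"
    by (intro density_cong) (auto elim!: eventually_mono simp: min_def)
  with hN show ?thesis by (intro bexI[of _ "\<lambda>t. min 1 (h t)"]) auto
qed

text \<open>
  The density with respect to \<open>P\<close> of the part \<open>c\<close> times Lebesgue measure on \<open>K\<close> that \<open>P\<close> dominates.
\<close>

definition fraction :: "real \<Rightarrow> ennreal" where
  "fraction = (SOME h. h \<in> borel_measurable P \<and> (\<forall>t. h t \<le> 1) \<and>
     density P h = density lborel (\<lambda>t. ennreal c * indicator K t))"

lemma fraction: "fraction \<in> borel_measurable P" "fraction t \<le> 1" "density P fraction = density lborel (\<lambda>t. ennreal c * indicator K t)"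
  using someI_ex[of "\<lambda>h. h \<in> borel_measurable P \<and> (\<forall>t. h t \<le> 1) \<and>
     density P h = density lborel (\<lambda>t. ennreal c * indicator K t)"] exists_fraction
  unfolding fraction_def[symmetric] by auto

lemma fraction_borel [measurable]: "fraction \<in> borel_measurable borel"
  using fraction(1) by (simp add: measurable_cong_sets[OF setsP refl])

text \<open>
  Given the time \<open>t\<close>, each of the marks \<open>Some True\<close> and \<open>Some False\<close> has probability \<open>fraction t / 2\<close>. Hence the
  times with such a mark are distributed as a multiple of Lebesgue measure on \<open>K\<close>, which is what the
  interchange preserves.
\<close>

definition weight :: "marked \<Rightarrow> ennreal" where
  "weight m = (case snd m of None \<Rightarrow> 1 - fraction (fst m) | Some b \<Rightarrow> fraction (fst m) / 2)"

definition marked :: "marked measure" where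
  "marked = density (P \<Otimes>\<^sub>M count_space UNIV) weight"

lemma sets_marked [simp, measurable_cong]: "sets marked = sets marked_space"
  unfolding marked_def sets_density by (rule sets_pair_measure_cong[OF setsP refl])

lemma space_marked [simp]: "space marked = UNIV"
  using sets_eq_imp_space_eq[OF sets_marked] by (simp add: space_pair_measure)

lemma nn_integral_marked:
  assumes g: "g \<in> borel_measurable marked_space"
  shows "(\<integral>\<^sup>+m. g m \<partial>marked) = (\<integral>\<^sup>+t. g (t, None) * (1 - fraction t) \<partial>P) +
    (\<Sum>b\<in>UNIV. ennreal (c / 2) * (\<integral>\<^sup>+t. g (t, Some b) * indicator K t \<partial>lborel))"
proof -
  note [measurable] = g and [measurable_cong] = setsP
  have [measurable]: "(\<lambda>t. g (t, x)) \<in> borel_measurable borel" for x by measurable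
  interpret C: sigma_finite_measure "count_space (UNIV :: bool option set)"
    by (rule sigma_finite_measure_count_space_finite) simp
  have weight [measurable]: "weight \<in> borel_measurable (P \<Otimes>\<^sub>M count_space UNIV)"
  proof -
    have "(\<lambda>m. (case x of None \<Rightarrow> 1 - fraction (fst m) | Some b \<Rightarrow> fraction (fst m) / 2)) \<in> borel_measurable (P \<Otimes>\<^sub>M count_space (UNIV :: bool option set))" for x :: "bool option"
      by (cases x) simp_all
    then show ?thesis unfolding weight_def by (rule measurable_compose_countable) measurable
  qed
  have U: "(UNIV :: bool option set) = {None, Some True, Some False}" by (auto simp: UNIV_option_conv UNIV_bool)
  have part: "(\<integral>\<^sup>+t. g (t, Some b) * (fraction t / 2) \<partial>P) = ennreal (c / 2) * (\<integral>\<^sup>+t. g (t, Some b) * indicator K t \<partial>lborel)" for b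
  proof -
    have "(\<integral>\<^sup>+t. g (t, Some b) * (fraction t / 2) \<partial>P) = (\<integral>\<^sup>+t. fraction t * (g (t, Some b) / 2) \<partial>P)"
      by (intro nn_integral_cong) (simp add: divide_ennreal_def mult_ac)
    also have "\<dots> = (\<integral>\<^sup>+t. g (t, Some b) / 2 \<partial>density P fraction)" by (subst nn_integral_density) auto
    also have "\<dots> = (\<integral>\<^sup>+t. ennreal c * indicator K t * (g (t, Some b) / 2) \<partial>lborel)"
      unfolding fraction(3) by (subst nn_integral_density) auto
    also have "\<dots> = (\<integral>\<^sup>+t. ennreal (c / 2) * (g (t, Some b) * indicator K t) \<partial>lborel)"
    proof (rule nn_integral_cong)
      have "ennreal (c / 2) = ennreal c / 2" using c by (simp add: divide_ennreal[symmetric])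
      then show "ennreal c * indicator K t * (g (t, Some b) / 2) = ennreal (c / 2) * (g (t, Some b) * indicator K t)" for t
        by (simp add: divide_ennreal_def mult_ac)
    qed
    finally show ?thesis by (simp add: nn_integral_cmult)
  qed
  have "(\<integral>\<^sup>+m. g m \<partial>marked) = (\<integral>\<^sup>+m. weight m * g m \<partial>(P \<Otimes>\<^sub>M count_space UNIV))"
    unfolding marked_def by (subst nn_integral_density) auto
  also have "\<dots> = (\<integral>\<^sup>+t. \<integral>\<^sup>+x. weight (t, x) * g (t, x) \<partial>count_space UNIV \<partial>P)"
    by (subst C.nn_integral_fst[symmetric]) auto
  also have "\<dots> = (\<integral>\<^sup>+t. g (t, None) * (1 - fraction t) + (g (t, Some True) * (fraction t / 2) + g (t, Some False) * (fraction t / 2)) \<partial>P)"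
    by (intro nn_integral_cong, subst nn_integral_count_space_finite) (simp_all add: U weight_def mult.commute)
  also have "\<dots> = (\<integral>\<^sup>+t. g (t, None) * (1 - fraction t) \<partial>P) +
     ((\<integral>\<^sup>+t. g (t, Some True) * (fraction t / 2) \<partial>P) + (\<integral>\<^sup>+t. g (t, Some False) * (fraction t / 2) \<partial>P))"
    by (subst nn_integral_add, simp, simp, subst nn_integral_add) auto
  finally show ?thesis by (simp add: part UNIV_bool add.commute)
qed

lemma distr_fst_marked: "distr marked P fst = P"
proof (rule measure_eqI)
  note [measurable_cong] = setsP
  fix X assume "X \<in> sets (distr marked P fst)"
  then have X [measurable]: "X \<in> sets borel" using setsP by simp
  have [measurable]: "X \<in> sets P" using setsP X by simp
  have half: "2 * (ennreal (c / 2) * a) = ennreal c * a" for a :: ennreal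
  proof -
    have "ennreal c = 2 * ennreal (c / 2)" using c by (simp add: ennreal_mult'[symmetric] flip: ennreal_numeral)
    then show ?thesis by (simp add: mult.assoc)
  qed
  have "emeasure (distr marked P fst) X = (\<integral>\<^sup>+m. indicator X (fst m) \<partial>marked)"
    using setsP by (subst nn_integral_indicator[symmetric], simp, subst nn_integral_distr) auto
  also have "\<dots> = (\<integral>\<^sup>+t. indicator X t * (1 - fraction t) \<partial>P) + ennreal c * (\<integral>\<^sup>+t. indicator X t * indicator K t \<partial>lborel)"
    by (subst nn_integral_marked) (auto simp: UNIV_bool half)
  also have "ennreal c * (\<integral>\<^sup>+t. indicator X t * indicator K t \<partial>lborel) = (\<integral>\<^sup>+t. indicator X t \<partial>density lborel (\<lambda>t. ennreal c * indicator K t))"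
    by (subst nn_integral_density) (auto simp: nn_integral_cmult[symmetric] mult_ac intro!: nn_integral_cong)
  also have "\<dots> = (\<integral>\<^sup>+t. fraction t * indicator X t \<partial>P)"
    unfolding fraction(3)[symmetric] by (subst nn_integral_density) auto
  also have "(\<integral>\<^sup>+t. indicator X t * (1 - fraction t) \<partial>P) + (\<integral>\<^sup>+t. fraction t * indicator X t \<partial>P) = (\<integral>\<^sup>+t. indicator X t \<partial>P)"
  proof -
    have eq: "indicator X t * (1 - fraction t) + fraction t * indicator X t = indicator X t" for t
      using fraction(2)[of t] by (auto simp: indicator_def diff_add_cancel_ennreal)
    have "(\<integral>\<^sup>+t. indicator X t * (1 - fraction t) \<partial>P) + (\<integral>\<^sup>+t. fraction t * indicator X t \<partial>P) =
        (\<integral>\<^sup>+t. indicator X t * (1 - fraction t) + fraction t * indicator X t \<partial>P)"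
      by (rule nn_integral_add[symmetric]) measurable
    then show ?thesis by (simp only: eq)
  qed
  finally show "emeasure (distr marked P fst) X = emeasure P X" by simp
qed simp

lemma prob_marked: "prob_space marked"
proof
  have "emeasure marked (space marked) = emeasure (distr marked P fst) (space P)"
    using setsP sets_eq_imp_space_eq[OF setsP] by (subst emeasure_distr) (auto cong: measurable_cong_sets)
  then show "emeasure marked (space marked) = 1" by (simp add: distr_fst_marked emeasure_space_1)
qed

lemma swap_preserves_marked:
  assumes \<delta>: "0 < \<delta>"
  shows "distr marked marked (swap K \<delta>) = marked"
proof (rule measure_eqI)
  note [measurable_cong] = setsP
  have sw [measurable]: "swap K \<delta> \<in> marked_space \<rightarrow>\<^sub>M marked_space" by measurable
  fix X assume "X \<in> sets (distr marked marked (swap K \<delta>))"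
  then have X [measurable]: "X \<in> sets marked_space" by simp
  have "emeasure (distr marked marked (swap K \<delta>)) X = (\<integral>\<^sup>+m. indicator X (swap K \<delta> m) \<partial>marked)"
    by (subst nn_integral_indicator[symmetric], simp, subst nn_integral_distr) auto
  also have "\<dots> = (\<integral>\<^sup>+m. indicator X m \<partial>marked)"
  proof -
    have sn: "swap K \<delta> (t, None) = (t, None)" for t by (simp add: swap_def shift_dir_def)
    have "swap K \<delta> (t, x) = (fst (swap K \<delta> (t, x)), x)" for t x by (simp add: swap_def)
    then have "(\<integral>\<^sup>+t. indicator X (swap K \<delta> (t, Some b)) * indicator K t \<partial>lborel) = (\<integral>\<^sup>+t. indicator X (t, Some b) * indicator K t \<partial>lborel)" for b
      using swap_preserves_lborel[OF K _ \<delta>, of "\<lambda>t. indicator X (t, Some b)" "Some b"] by simp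
    then show ?thesis using nn_integral_marked[of "\<lambda>m. indicator X (swap K \<delta> m)"] nn_integral_marked[of "\<lambda>m. indicator X m"]
      by (simp add: sn del: nn_integral_indicator)
  qed
  finally show "emeasure (distr marked marked (swap K \<delta>)) X = emeasure marked X" by simp
qed simp

text \<open>
  For every pair \<open>t\<close>, \<open>t + \<delta>\<close> in \<open>K\<close> one of the two marks moves \<open>t\<close> upwards.
\<close>

lemma swap_positive:
  assumes \<delta>: "0 < \<delta>" and pos: "0 < emeasure lborel {t \<in> K. t + \<delta> \<in> K}"
  shows "0 < emeasure marked {m. shift_dir K \<delta> m \<noteq> 0}"
proof -
  note [measurable_cong] = setsP
  let ?U = "\<lambda>b. {t \<in> K. t + \<delta> \<in> K \<and> (even \<lfloor>t / \<delta>\<rfloor> \<longleftrightarrow> b)}"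
  have "(\<lambda>m. shift_dir K \<delta> m) \<in> marked_space \<rightarrow>\<^sub>M count_space UNIV" by measurable
  from measurable_sets[OF this, of "- {0}"]
  have [measurable]: "{m. shift_dir K \<delta> m \<noteq> 0} \<in> sets marked_space"
    by (simp add: vimage_def space_pair_measure)
  have U [measurable]: "?U b \<in> sets borel" for b by measurable
  have "emeasure lborel {t \<in> K. t + \<delta> \<in> K} \<le> emeasure lborel (?U True) + emeasure lborel (?U False)"
    by (rule order.trans[OF emeasure_mono emeasure_subadditive]) auto
  with pos have "0 < emeasure lborel (?U True) + emeasure lborel (?U False)" by simp
  then have "0 < ennreal (c / 2) * (emeasure lborel (?U True) + emeasure lborel (?U False))"
    using c by (simp add: ennreal_zero_less_mult_iff)
  also have "\<dots> = (\<Sum>b\<in>UNIV. ennreal (c / 2) * (\<integral>\<^sup>+t. indicator (?U b) t \<partial>lborel))"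
    by (simp add: UNIV_bool distrib_left add.commute)
  also have "\<dots> \<le> (\<Sum>b\<in>UNIV. ennreal (c / 2) * (\<integral>\<^sup>+t. indicator {m. shift_dir K \<delta> m \<noteq> 0} (t, Some b) * indicator K t \<partial>lborel))"
    by (intro sum_mono mult_left_mono nn_integral_mono) (auto simp: indicator_def shift_dir_def)
  also have "\<dots> \<le> (\<integral>\<^sup>+m. indicator {m. shift_dir K \<delta> m \<noteq> 0} m \<partial>marked)"
    by (subst nn_integral_marked) auto
  finally show ?thesis by simp
qed

end


section \<open>Product measures\<close>

lemma distr_PiM_map:
  assumes N: "prob_space N" and g [measurable]: "g \<in> N \<rightarrow>\<^sub>M N'"
  shows "distr (PiM F (\<lambda>_. N)) (PiM F (\<lambda>_. N')) (\<lambda>\<omega>. \<lambda>f\<in>F. g (\<omega> f)) = PiM F (\<lambda>_. distr N N' g)"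
proof (rule measure_eqI_PiM_infinite[symmetric, OF refl])
  interpret N: prob_space N by (rule N)
  have N': "prob_space (distr N N' g)" by (rule N.prob_space_distr) (rule g)
  interpret PN: prob_space "PiM F (\<lambda>_. distr N N' g)" by (rule prob_space_PiM) (rule N')
  show "finite_measure (PiM F (\<lambda>_. distr N N' g))" by unfold_locales
  show "sets (distr (PiM F (\<lambda>_. N)) (PiM F (\<lambda>_. N')) (\<lambda>\<omega>. \<lambda>f\<in>F. g (\<omega> f))) = sets (PiM F (\<lambda>_. distr N N' g))"
    by (simp cong: sets_PiM_cong)
  fix A J assume J: "finite J" "J \<subseteq> F" and A: "\<And>i. i \<in> J \<Longrightarrow> A i \<in> sets (distr N N' g)"
  then have A': "i \<in> J \<Longrightarrow> A i \<in> sets N'" for i by simp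
  let ?T = "\<lambda>\<omega>. \<lambda>f\<in>F. g (\<omega> f)"
  have T: "?T \<in> PiM F (\<lambda>_. N) \<rightarrow>\<^sub>M PiM F (\<lambda>_. N')" by measurable
  have "?T -` prod_emb F (\<lambda>_. distr N N' g) J (Pi\<^sub>E J A) \<inter> space (PiM F (\<lambda>_. N)) =
      prod_emb F (\<lambda>_. N) J (Pi\<^sub>E J (\<lambda>i. g -` A i \<inter> space N))"
    using J measurable_space[OF g] by (auto simp: prod_emb_def space_PiM PiE_iff subset_iff)
  moreover have "prod_emb F (\<lambda>_. distr N N' g) J (Pi\<^sub>E J A) = prod_emb F (\<lambda>_. N') J (Pi\<^sub>E J A)"
    by (simp add: prod_emb_def)
  ultimately have "emeasure (distr (PiM F (\<lambda>_. N)) (PiM F (\<lambda>_. N')) ?T) (prod_emb F (\<lambda>_. distr N N' g) J (Pi\<^sub>E J A)) =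
      emeasure (PiM F (\<lambda>_. N)) (prod_emb F (\<lambda>_. N) J (Pi\<^sub>E J (\<lambda>i. g -` A i \<inter> space N)))"
    using J A' by (subst emeasure_distr[OF T]) (auto intro!: sets_PiM_I)
  also have "\<dots> = (\<Prod>i\<in>J. emeasure N (g -` A i \<inter> space N))"
    using J A' by (intro emeasure_PiM_emb N measurable_sets[OF g]) auto
  also have "\<dots> = (\<Prod>i\<in>J. emeasure (distr N N' g) (A i))"
    using A' by (intro prod.cong refl emeasure_distr[symmetric]) auto
  also have "\<dots> = emeasure (PiM F (\<lambda>_. distr N N' g)) (prod_emb F (\<lambda>_. distr N N' g) J (Pi\<^sub>E J A))"
    using J A by (intro emeasure_PiM_emb[symmetric] N') auto
  finally show "emeasure (PiM F (\<lambda>_. distr N N' g)) (prod_emb F (\<lambda>_. distr N N' g) J (Pi\<^sub>E J A)) =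
      emeasure (distr (PiM F (\<lambda>_. N)) (PiM F (\<lambda>_. N')) ?T) (prod_emb F (\<lambda>_. distr N N' g) J (Pi\<^sub>E J A))" by simp
qed

lemma distr_PiM_merge:
  assumes N: "prob_space N" and disj: "D \<inter> F = {}"
  shows "distr (PiM D (\<lambda>_. N) \<Otimes>\<^sub>M PiM F (\<lambda>_. N)) (PiM (D \<union> F) (\<lambda>_. N)) (merge D F) = PiM (D \<union> F) (\<lambda>_. N)"
proof (rule measure_eqI_PiM_infinite[symmetric, OF refl])
  interpret U: prob_space "PiM (D \<union> F) (\<lambda>_. N)" by (rule prob_space_PiM) (rule N)
  interpret PF: prob_space "PiM F (\<lambda>_. N)" by (rule prob_space_PiM) (rule N)
  show "finite_measure (PiM (D \<union> F) (\<lambda>_. N))" by unfold_locales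
  fix A J assume J: "finite J" "J \<subseteq> D \<union> F" and A: "\<And>i. i \<in> J \<Longrightarrow> A i \<in> sets N"
  have As: "A i \<subseteq> space N" if "i \<in> J" for i using A[OF that] by (rule sets.sets_into_space)
  let ?E = "\<lambda>H. prod_emb H (\<lambda>_. N) (J \<inter> H) (Pi\<^sub>E (J \<inter> H) A)"
  have "merge D F -` prod_emb (D \<union> F) (\<lambda>_. N) J (Pi\<^sub>E J A) \<inter> space (PiM D (\<lambda>_. N) \<Otimes>\<^sub>M PiM F (\<lambda>_. N)) = ?E D \<times> ?E F"
  proof (intro set_eqI iffI)
    fix x assume "x \<in> merge D F -` prod_emb (D \<union> F) (\<lambda>_. N) J (Pi\<^sub>E J A) \<inter> space (PiM D (\<lambda>_. N) \<Otimes>\<^sub>M PiM F (\<lambda>_. N))"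
    then show "x \<in> ?E D \<times> ?E F" using disj
      by (cases x) (auto simp: prod_emb_def space_pair_measure space_PiM PiE_iff merge_def split: if_splits)
  next
    fix x assume "x \<in> ?E D \<times> ?E F"
    then show "x \<in> merge D F -` prod_emb (D \<union> F) (\<lambda>_. N) J (Pi\<^sub>E J A) \<inter> space (PiM D (\<lambda>_. N) \<Otimes>\<^sub>M PiM F (\<lambda>_. N))"
      using J disj by (cases x) (auto simp: prod_emb_def space_pair_measure space_PiM PiE_iff merge_def extensional_def)
  qed
  then have "emeasure (distr (PiM D (\<lambda>_. N) \<Otimes>\<^sub>M PiM F (\<lambda>_. N)) (PiM (D \<union> F) (\<lambda>_. N)) (merge D F)) (prod_emb (D \<union> F) (\<lambda>_. N) J (Pi\<^sub>E J A)) =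
      emeasure (PiM D (\<lambda>_. N) \<Otimes>\<^sub>M PiM F (\<lambda>_. N)) (?E D \<times> ?E F)"
    using J A by (subst emeasure_distr) (auto intro!: sets_PiM_I)
  also have "\<dots> = emeasure (PiM D (\<lambda>_. N)) (?E D) * emeasure (PiM F (\<lambda>_. N)) (?E F)"
    using J A by (intro PF.emeasure_pair_measure_Times sets_PiM_I) auto
  also have "\<dots> = (\<Prod>i\<in>J \<inter> D. emeasure N (A i)) * (\<Prod>i\<in>J \<inter> F. emeasure N (A i))"
    using J A by (intro arg_cong2[where f = "(*)"] emeasure_PiM_emb N) auto
  also have "\<dots> = (\<Prod>i\<in>(J \<inter> D) \<union> (J \<inter> F). emeasure N (A i))"
    using J disj by (intro prod.union_disjoint[symmetric]) auto
  also have "(J \<inter> D) \<union> (J \<inter> F) = J" using J by auto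
  also have "(\<Prod>i\<in>J. emeasure N (A i)) = emeasure (PiM (D \<union> F) (\<lambda>_. N)) (prod_emb (D \<union> F) (\<lambda>_. N) J (Pi\<^sub>E J A))"
    using J A by (intro emeasure_PiM_emb[symmetric] N) auto
  finally show "emeasure (PiM (D \<union> F) (\<lambda>_. N)) (prod_emb (D \<union> F) (\<lambda>_. N) J (Pi\<^sub>E J A)) =
     emeasure (distr (PiM D (\<lambda>_. N) \<Otimes>\<^sub>M PiM F (\<lambda>_. N)) (PiM (D \<union> F) (\<lambda>_. N)) (merge D F)) (prod_emb (D \<union> F) (\<lambda>_. N) J (Pi\<^sub>E J A))"
    by simp
qed simp

text \<open>
  By Fubini the other coordinates may be kept fixed. The new value at \<open>e\<close> may depend on them as long as
  it has the law \<open>N\<close> for each of their values.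
\<close>

lemma distr_PiM_update:
  assumes N: "prob_space N" and e: "e \<in> F" and h [measurable]: "h \<in> PiM F (\<lambda>_. N) \<rightarrow>\<^sub>M N"
    and pres: "\<And>\<rho>. \<rho> \<in> space (PiM (F - {e}) (\<lambda>_. N)) \<Longrightarrow> distr N N (\<lambda>w. h ((\<rho>)(e := w))) = N"
  shows "distr (PiM F (\<lambda>_. N)) (PiM F (\<lambda>_. N)) (\<lambda>\<omega>. (\<omega>)(e := h \<omega>)) = PiM F (\<lambda>_. N)"
proof (rule measure_eqI)
  interpret N: prob_space N by (rule N)
  let ?M = "PiM F (\<lambda>_. N)" and ?R = "PiM (F - {e}) (\<lambda>_. N)"
  interpret R: prob_space ?R by (rule prob_space_PiM) (rule N)
  interpret NR: pair_sigma_finite N ?R ..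
  have F: "insert e (F - {e}) = F" using e by auto
  have M: "distr (N \<Otimes>\<^sub>M ?R) ?M (\<lambda>(w, \<rho>). (\<rho>)(e := w)) = ?M"
    using distr_pair_PiM_eq_PiM[of "F - {e}" "\<lambda>_. N" e] N unfolding F by blast
  have upd [measurable]: "(\<lambda>(w, \<rho>). (\<rho>)(e := w)) \<in> N \<Otimes>\<^sub>M ?R \<rightarrow>\<^sub>M ?M"
    using measurable_add_dim[of e "F - {e}" "\<lambda>_. N"] unfolding F
    by (subst measurable_pair_swap_iff) (simp add: split_def comp_def)
  have upd' [measurable]: "(\<lambda>w. (\<rho>)(e := w)) \<in> N \<rightarrow>\<^sub>M ?M" if "\<rho> \<in> space ?R" for \<rho>
    using measurable_compose[OF measurable_Pair2'[OF that] upd] by (simp add: measurable_compose split_def)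
  have T [measurable]: "(\<lambda>\<omega>. (\<omega>)(e := h \<omega>)) \<in> ?M \<rightarrow>\<^sub>M ?M"
    using e by (intro measurable_fun_upd[where J = F]) auto
  fix X assume "X \<in> sets (distr ?M ?M (\<lambda>\<omega>. (\<omega>)(e := h \<omega>)))"
  then have X [measurable]: "X \<in> sets ?M" by simp
  have int: "(\<integral>\<^sup>+\<omega>. g \<omega> \<partial>?M) = (\<integral>\<^sup>+\<rho>. \<integral>\<^sup>+w. g ((\<rho>)(e := w)) \<partial>N \<partial>?R)"
    if g [measurable]: "g \<in> borel_measurable ?M" for g :: "_ \<Rightarrow> ennreal"
  proof -
    have "(\<integral>\<^sup>+\<omega>. g \<omega> \<partial>?M) = (\<integral>\<^sup>+x. g ((\<lambda>(w, \<rho>). (\<rho>)(e := w)) x) \<partial>(N \<Otimes>\<^sub>M ?R))"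
      by (subst M[symmetric], subst nn_integral_distr) auto
    also have "\<dots> = (\<integral>\<^sup>+\<rho>. \<integral>\<^sup>+w. g ((\<rho>)(e := w)) \<partial>N \<partial>?R)"
      by (subst NR.nn_integral_snd[symmetric]) auto
    finally show ?thesis .
  qed
  have "emeasure (distr ?M ?M (\<lambda>\<omega>. (\<omega>)(e := h \<omega>))) X = (\<integral>\<^sup>+\<omega>. indicator X ((\<omega>)(e := h \<omega>)) \<partial>?M)"
    by (subst nn_integral_indicator[symmetric], simp, subst nn_integral_distr) auto
  also have "\<dots> = (\<integral>\<^sup>+\<rho>. \<integral>\<^sup>+w. indicator X ((\<rho>)(e := h ((\<rho>)(e := w)))) \<partial>N \<partial>?R)"
    by (subst int) (auto intro!: nn_integral_cong)
  also have "\<dots> = (\<integral>\<^sup>+\<rho>. \<integral>\<^sup>+w. indicator X ((\<rho>)(e := w)) \<partial>N \<partial>?R)"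
  proof (rule nn_integral_cong)
    fix \<rho> assume \<rho>: "\<rho> \<in> space ?R"
    note [measurable] = upd'[OF \<rho>]
    have "(\<integral>\<^sup>+w. indicator X ((\<rho>)(e := w)) \<partial>N) = (\<integral>\<^sup>+w. indicator X ((\<rho>)(e := w)) \<partial>(distr N N (\<lambda>w. h ((\<rho>)(e := w)))))"
      by (simp add: pres[OF \<rho>])
    also have "\<dots> = (\<integral>\<^sup>+w. indicator X ((\<rho>)(e := h ((\<rho>)(e := w)))) \<partial>N)"
      by (subst nn_integral_distr) auto
    finally show "(\<integral>\<^sup>+w. indicator X ((\<rho>)(e := h ((\<rho>)(e := w)))) \<partial>N) = (\<integral>\<^sup>+w. indicator X ((\<rho>)(e := w)) \<partial>N)" by simp
  qed
  also have "\<dots> = emeasure ?M X" by (subst int[symmetric]) auto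
  finally show "emeasure (distr ?M ?M (\<lambda>\<omega>. (\<omega>)(e := h \<omega>))) X = emeasure ?M X" .
qed simp

text \<open>
  The events for disjoint blocks are independent, so by the zero-one law infinitely many of them occur
  with probability zero or one; their probabilities do not tend to zero.
\<close>

lemma AE_infinitely_many_blocks:
  fixes B :: "nat \<Rightarrow> 'i set" and X :: "nat \<Rightarrow> 'i \<Rightarrow> 'a set"
  assumes N: "prob_space N" and B: "\<And>k. finite (B k)" "\<And>k. B k \<subseteq> F" "disjoint_family B"
    and X: "\<And>k i. i \<in> B k \<Longrightarrow> X k i \<in> sets N"
    and p: "0 < p" "\<And>k. p \<le> (\<Prod>i\<in>B k. measure N (X k i))"
  shows "AE \<omega> in PiM F (\<lambda>_. N). infinite {k. \<forall>i\<in>B k. \<omega> i \<in> X k i}"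
proof -
  let ?M = "PiM F (\<lambda>_. N)"
  interpret N: prob_space N by (rule N)
  interpret M: prob_space ?M by (rule prob_space_PiM) (rule N)
  interpret PN: product_prob_space "\<lambda>_. N" F by unfold_locales
  let ?R = "\<lambda>k. {\<omega> \<in> space ?M. \<forall>i\<in>B k. \<omega> i \<in> X k i}"
  have prob: "M.prob {\<omega> \<in> space ?M. \<forall>k\<in>J. \<forall>i\<in>B k. \<omega> i \<in> X k i} = (\<Prod>k\<in>J. \<Prod>i\<in>B k. measure N (X k i))"
    if J: "finite J" for J
  proof -
    define idx where "idx i = (THE k. i \<in> B k)" for i
    have idx: "idx i = k" if "i \<in> B k" for i k
      unfolding idx_def using B(3) that by (intro the_equality) (auto simp: disjoint_family_on_def)
    have eq: "{\<omega> \<in> space ?M. \<forall>k\<in>J. \<forall>i\<in>B k. \<omega> i \<in> X k i} = prod_emb F (\<lambda>_. N) (\<Union>k\<in>J. B k) (Pi\<^sub>E (\<Union>k\<in>J. B k) (\<lambda>i. X (idx i) i))"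
      using B(2) idx by (auto simp: prod_emb_def space_PiM PiE_iff extensional_def)
    have "M.prob {\<omega> \<in> space ?M. \<forall>k\<in>J. \<forall>i\<in>B k. \<omega> i \<in> X k i} = (\<Prod>i\<in>(\<Union>k\<in>J. B k). measure N (X (idx i) i))"
      unfolding eq using B(1,2) J X idx by (intro PN.measure_PiM_emb) auto
    also have "\<dots> = (\<Prod>k\<in>J. \<Prod>i\<in>B k. measure N (X (idx i) i))"
      using B J by (intro prod.UNION_disjoint) (auto simp: disjoint_family_on_def)
    also have "\<dots> = (\<Prod>k\<in>J. \<Prod>i\<in>B k. measure N (X k i))" using idx by (intro prod.cong) auto
    finally show ?thesis .
  qed
  have R [measurable]: "?R k \<in> sets ?M" for k
  proof -
    have "?R k = prod_emb F (\<lambda>_. N) (B k) (Pi\<^sub>E (B k) (X k))"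
      using B(2) by (auto simp: prod_emb_def space_PiM PiE_iff extensional_def)
    then show ?thesis using B(1,2) X by (auto intro!: sets_PiM_I)
  qed
  have single: "M.prob (?R k) = (\<Prod>i\<in>B k. measure N (X k i))" for k using prob[of "{k}"] by simp
  have indep: "M.indep_events ?R UNIV"
  proof (rule M.indep_eventsI)
    fix J :: "nat set" assume J: "finite J" "J \<noteq> {}"
    have "(\<Inter>k\<in>J. ?R k) = {\<omega> \<in> space ?M. \<forall>k\<in>J. \<forall>i\<in>B k. \<omega> i \<in> X k i}" using J by auto
    then show "M.prob (\<Inter>k\<in>J. ?R k) = (\<Prod>k\<in>J. M.prob (?R k))" using prob[OF J(1)] single by simp
  qed (use R in auto)
  from M.borel_0_1_law_AE[OF this]
  show ?thesis
  proof
    assume fin: "AE \<omega> in ?M. finite {k. \<forall>i\<in>B k. \<omega> i \<in> X k i}"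
    let ?T = "\<lambda>n. \<Union>k\<in>{n..}. ?R k"
    have "decseq ?T" unfolding decseq_def by (intro allI impI UN_mono) auto
    moreover have [measurable]: "?T n \<in> sets ?M" for n by measurable
    ultimately have lim: "(\<lambda>n. M.prob (?T n)) \<longlonglongrightarrow> M.prob (\<Inter>n. ?T n)"
      by (intro M.finite_Lim_measure_decseq) auto
    have "M.prob (\<Inter>n. ?T n) = 0"
    proof -
      have "AE \<omega> in ?M. \<omega> \<notin> (\<Inter>n. ?T n)" using fin
      proof eventually_elim
        case (elim \<omega>)
        then obtain n where "\<And>k. (\<forall>i\<in>B k. \<omega> i \<in> X k i) \<Longrightarrow> k < n" using finite_nat_set_iff_bounded by auto
        then show ?case by (auto intro!: exI[of _ n] simp: not_le[symmetric])
      qed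
      then show ?thesis by (subst M.prob_eq_0) auto
    qed
    moreover have "p \<le> M.prob (?T n)" for n
    proof -
      have "p \<le> M.prob (?R n)" using p(2) single by simp
      also have "\<dots> \<le> M.prob (?T n)" by (intro M.finite_measure_mono) auto
      finally show ?thesis .
    qed
    ultimately have "p \<le> 0" using LIMSEQ_le_const[OF lim] by auto
    with p(1) show ?thesis by simp
  qed simp
qed


section \<open>Gates along the graph\<close>

instance edge :: countable by countable_datatype

text \<open>
  \<open>Q\<close> is the set on which times are interchanged, by at most \<open>\<delta>0\<close>. The block that starts at level \<open>z\<close> has the
  possible gate \<open>ge z\<close> with ends \<open>gx z\<close>, \<open>gy z\<close> and sides \<open>gA z\<close>, \<open>gB z\<close>, and its fast edges are \<open>\<Gamma> z\<close>. Both seeds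
  and all edges whose times are given lie within the levels from \<open>- N0\<close> to \<open>N0\<close>.
\<close>

locale fpp_coupling = periodic_graph K L inc J + swap_space P c Q
  for K L :: nat and inc :: "nat \<Rightarrow> nat set" and J :: "(nat \<times> nat) set"
    and P :: "real measure" and c :: real and Q :: "real set" +
  fixes \<alpha> \<beta>0 \<beta>1 \<delta>0 :: real and R :: nat
    and ge :: "int \<Rightarrow> edge" and gx gy :: "int \<Rightarrow> vertex" and gA gB :: "int \<Rightarrow> vertex set" and \<Gamma> :: "int \<Rightarrow> edge set"
    and m N0 :: nat and I I' :: "vertex set"
  assumes \<alpha>: "0 \<le> \<alpha>" "\<alpha> < \<beta>0" "\<beta>0 \<le> \<beta>1" and Q: "Q \<subseteq> {0..\<alpha>}"
    and \<delta>0: "0 < \<delta>0" and overlap: "\<And>\<delta>. 0 < \<delta> \<Longrightarrow> \<delta> \<le> \<delta>0 \<Longrightarrow> 0 < emeasure lborel {t \<in> Q. t + \<delta> \<in> Q}"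
    and P\<beta>: "0 < emeasure P {\<beta>0..\<beta>1}"
    and ge: "\<And>z. ge z \<in> block z R" and gxy: "\<And>z. gx z \<in> V" "\<And>z. gy z \<in> V"
    and gA: "\<And>z. {v \<in> V. fst v \<le> z} \<subseteq> gA z" "\<And>z. gA z \<subseteq> {v \<in> V. fst v < z + int R}"
    and gB: "\<And>z. {v \<in> V. z + int R \<le> fst v} \<subseteq> gB z" "\<And>z. gB z \<subseteq> {v \<in> V. z < fst v}"
    and gates: "\<And>z \<tau>. \<forall>f\<in>E. 0 \<le> \<tau> f \<Longrightarrow> \<tau> (ge z) \<le> \<alpha> \<Longrightarrow>
         \<forall>f\<in>block z R - {ge z}. if f \<in> \<Gamma> z then \<tau> f \<le> \<alpha> else \<beta>0 \<le> \<tau> f \<and> \<tau> f \<le> \<beta>1 \<Longrightarrow>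
         gate ends E \<tau> (ge z) (gx z) (gy z) (gA z) (gB z)"
    and mN: "m \<le> N0" and I: "I \<noteq> {}" "I \<subseteq> V" "\<And>v. v \<in> I \<Longrightarrow> \<bar>fst v\<bar> \<le> int N0"
    and I': "I' \<noteq> {}" "I' \<subseteq> V" "\<And>v. v \<in> I' \<Longrightarrow> \<bar>fst v\<bar> \<le> int N0"
begin

definition Em where "Em = edges_within L inc J m"
definition F where "F = E - Em"

lemma Em_sub: "Em \<subseteq> E" by (auto simp: Em_def edges_within_def)

lemma Em_level: "f \<in> Em \<Longrightarrow> v \<in> ends f \<Longrightarrow> \<bar>fst v\<bar> \<le> int N0"
  using mN by (fastforce simp: Em_def edges_within_def)

text \<open>
  On each side, \<open>s = True\<close> being the right one, disjoint blocks follow each other outwards. The side of a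
  gate that contains the seeds is called near, the other one far.
\<close>

definition lv :: "bool \<Rightarrow> nat \<Rightarrow> int" where
  "lv s k = (if s then int N0 + 1 + int k * (int R + 1) else - (int N0 + 1 + int R) - int k * (int R + 1))"

definition cand where "cand s k = ge (lv s k)"
definition near where "near s k = (if s then gA (lv s k) else gB (lv s k))"
definition far where "far s k = (if s then gB (lv s k) else gA (lv s k))"
definition xn where "xn s k = (if s then gx (lv s k) else gy (lv s k))"
definition xf where "xf s k = (if s then gy (lv s k) else gx (lv s k))"
abbreviation blk where "blk s k \<equiv> block (lv s k) R"

text \<open>
  The level, counted outwards on side \<open>s\<close>; the \<open>k\<close>-th block ends at \<open>rim k\<close> on either side. In these terms
  the two sides can be treated at once.
\<close>

definition outer :: "bool \<Rightarrow> vertex \<Rightarrow> int" where "outer s v = (if s then fst v else - fst v)"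

definition rim :: "nat \<Rightarrow> int" where "rim k = int N0 + 1 + int R + int k * (int R + 1)"

lemma lv_range: "lv s k = (if s then rim k - int R else - rim k)"
  by (simp add: lv_def rim_def)

lemma rim_pos: "int N0 + int R < rim k" "i < k \<Longrightarrow> rim i + int R < rim k"
proof -
  have "0 \<le> int k * (int R + 1)" by simp
  then show "int N0 + int R < rim k" unfolding rim_def by linarith
  assume "i < k"
  then have "(int i + 1) * (int R + 1) \<le> int k * (int R + 1)" by (intro mult_right_mono) auto
  then show "rim i + int R < rim k" by (simp add: rim_def algebra_simps)
qed

lemma blk_outer: "f \<in> blk s k \<Longrightarrow> v \<in> ends f \<Longrightarrow> rim k - int R \<le> outer s v \<and> outer s v \<le> rim k"
  by (auto simp: block_def outer_def lv_range split: if_splits)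

lemma near_outer: "v \<in> V \<Longrightarrow> outer s v \<le> rim k - int R \<Longrightarrow> v \<in> near s k"
  using gA(1)[of "lv s k"] gB(1)[of "lv s k"] by (auto simp: near_def outer_def lv_range split: if_splits)

lemma far_outer: "v \<in> V \<Longrightarrow> rim k \<le> outer s v \<Longrightarrow> v \<in> far s k"
  using gA(1)[of "lv s k"] gB(1)[of "lv s k"] by (auto simp: far_def outer_def lv_range split: if_splits)

lemma outer_flip: "outer (\<not> s) v = - outer s v" by (simp add: outer_def)

lemma outer_level: "\<bar>fst v\<bar> \<le> int N0 \<Longrightarrow> outer s v \<le> int N0" "\<bar>fst v\<bar> \<le> int N0 \<Longrightarrow> - int N0 \<le> outer s v"
  by (auto simp: outer_def)

lemma I_near: "I \<subseteq> near s k" "I' \<subseteq> near s k"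
proof -
  have "v \<in> near s k" if "v \<in> V" "\<bar>fst v\<bar> \<le> int N0" for v
    using near_outer[OF that(1)] outer_level(1)[OF that(2), of s] rim_pos(1)[of k] by simp
  then show "I \<subseteq> near s k" "I' \<subseteq> near s k" using I I' by auto
qed

lemma ends_nonempty: "f \<in> E \<Longrightarrow> \<exists>v\<in>V. v \<in> ends f"
  using ends_doubleton by fastforce

lemma blk_F: "blk s k \<subseteq> F"
proof
  fix f assume f: "f \<in> blk s k"
  then have "f \<in> E" by (simp add: block_def)
  obtain v where v: "v \<in> ends f" using ends_nonempty[OF \<open>f \<in> E\<close>] by blast
  have "f \<notin> Em"
    using Em_level[OF _ v] blk_outer[OF f v] outer_level(1)[of v s] rim_pos(1)[of k] by linarith
  then show "f \<in> F" using \<open>f \<in> E\<close> by (simp add: F_def)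
qed

lemma cand_blk: "cand s k \<in> blk s k" by (simp add: cand_def ge)

lemma blk_disjoint:
  assumes "(s, k) \<noteq> (s', k')" shows "blk s k \<inter> blk s' k' = {}"
proof (rule ccontr)
  assume "blk s k \<inter> blk s' k' \<noteq> {}"
  then obtain f where f: "f \<in> blk s k" "f \<in> blk s' k'" by blast
  then have "f \<in> E" by (simp add: block_def)
  then obtain v where v: "v \<in> ends f" using ends_nonempty by blast
  note b = blk_outer[OF f(1) v] blk_outer[OF f(2) v]
  show False
  proof (cases "s' = s")
    case True
    then have "k < k' \<or> k' < k" using assms by auto
    then show False using b rim_pos(2)[of k k'] rim_pos(2)[of k' k] True by auto
  next
    case False
    then have "s' = (\<not> s)" by auto
    then show False using b rim_pos(1)[of k] rim_pos(1)[of k'] outer_flip[of s v] by simp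
  qed
qed

lemma cand_distinct: "(s, k) \<noteq> (s', k') \<Longrightarrow> cand s k \<notin> blk s' k'"
  using blk_disjoint[of s k s' k'] cand_blk[of s k] by auto

text \<open>
  The pattern of a block apart from the edge of its possible gate, so that moving the time of that edge
  does not affect it.
\<close>

definition good :: "bool \<Rightarrow> nat \<Rightarrow> (edge \<Rightarrow> marked) \<Rightarrow> bool" where
  "good s k \<omega> \<longleftrightarrow> (\<forall>f\<in>blk s k - {cand s k}.
     if f \<in> \<Gamma> (lv s k) then fst (\<omega> f) \<le> \<alpha> else \<beta>0 \<le> fst (\<omega> f) \<and> fst (\<omega> f) \<le> \<beta>1)"

lemma good_cong: "(\<And>f. f \<in> blk s k - {cand s k} \<Longrightarrow> \<omega> f = \<omega>' f) \<Longrightarrow> good s k \<omega> \<longleftrightarrow> good s k \<omega>'"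
  by (simp add: good_def)

text \<open>
  Negative times form a null set. They are replaced by zero in order that the results on walks apply to
  all configurations.
\<close>

definition \<tau> :: "(edge \<Rightarrow> real) \<Rightarrow> (edge \<Rightarrow> marked) \<Rightarrow> edge \<Rightarrow> real" where
  "\<tau> a \<omega> f = max 0 (if f \<in> Em then a f else if f \<in> F then fst (\<omega> f) else 0)"

lemma \<tau>_nonneg: "0 \<le> \<tau> a \<omega> f" by (simp add: \<tau>_def)

lemma \<tau>_F: "f \<in> F \<Longrightarrow> \<tau> a \<omega> f = max 0 (fst (\<omega> f))"
  by (simp add: \<tau>_def F_def)

lemma gate_good:
  assumes "good s k \<omega>" "fst (\<omega> (cand s k)) \<in> Q"
  shows "gate ends E (\<tau> a \<omega>) (cand s k) (xn s k) (xf s k) (near s k) (far s k)"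
proof -
  have "gate ends E (\<tau> a \<omega>) (ge (lv s k)) (gx (lv s k)) (gy (lv s k)) (gA (lv s k)) (gB (lv s k))"
  proof (rule gates)
    show "\<forall>f\<in>E. 0 \<le> \<tau> a \<omega> f" by (simp add: \<tau>_nonneg)
    have cF: "cand s k \<in> F" using cand_blk blk_F by blast
    show "\<tau> a \<omega> (ge (lv s k)) \<le> \<alpha>"
      using \<tau>_F[OF cF, of a \<omega>] assms(2) Q \<alpha> by (auto simp: cand_def[symmetric])
    show "\<forall>f\<in>blk s k - {ge (lv s k)}. if f \<in> \<Gamma> (lv s k) then \<tau> a \<omega> f \<le> \<alpha> else \<beta>0 \<le> \<tau> a \<omega> f \<and> \<tau> a \<omega> f \<le> \<beta>1"
    proof
      fix f assume f: "f \<in> blk s k - {ge (lv s k)}"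
      then have "f \<in> F" using blk_F by auto
      with f assms(1) \<alpha> \<tau>_F[of f a \<omega>] show "if f \<in> \<Gamma> (lv s k) then \<tau> a \<omega> f \<le> \<alpha> else \<beta>0 \<le> \<tau> a \<omega> f \<and> \<tau> a \<omega> f \<le> \<beta>1"
        by (auto simp: good_def cand_def split: if_splits)
    qed
  qed
  then show ?thesis
    by (cases s) (auto simp: cand_def xn_def xf_def near_def far_def intro: gate_sym)
qed

definition T :: "(edge \<Rightarrow> real) \<Rightarrow> (edge \<Rightarrow> marked) \<Rightarrow> vertex set \<Rightarrow> vertex \<Rightarrow> real" where
  "T a \<omega> U v = fpt ends E (\<tau> a \<omega>) U v"

lemma near_far_V: "near s k \<union> far s k \<subseteq> V"
  using gA(2)[of "lv s k"] gB(2)[of "lv s k"] by (auto simp: near_def far_def)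

lemma connected': "u \<in> near s k \<union> far s k \<Longrightarrow> v \<in> near s k \<union> far s k \<Longrightarrow> \<exists>p. walk ends E u p v"
  using near_far_V by (intro connected) auto

lemma xn_near: "good s k \<omega> \<Longrightarrow> fst (\<omega> (cand s k)) \<in> Q \<Longrightarrow> xn s k \<in> near s k"
  using gate_good[of s k \<omega> "\<lambda>_. 0"] by (simp add: gate_def)

lemma change_near:
  assumes g: "good s k \<omega>" "fst (\<omega> (cand s k)) \<in> Q" "good s k \<omega>'" "fst (\<omega>' (cand s k)) \<in> Q"
    and eq: "\<And>f. f \<in> F \<Longrightarrow> ends f \<inter> far s k = {} \<Longrightarrow> \<omega> f = \<omega>' f"
    and U: "U \<noteq> {}" "U \<subseteq> near s k" and v: "v \<in> near s k"
  shows "T a \<omega> U v = T a \<omega>' U v"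
proof -
  obtain u where u: "u \<in> U" using U by blast
  show ?thesis unfolding T_def
    by (rule gate_fpt_near[OF gate_good[OF g(1,2)] gate_good[OF g(3,4)] _ U(2) u v connected'])
      (auto simp: avoid_def \<tau>_def eq)
qed

lemma Em_near: "f \<in> Em \<Longrightarrow> ends f \<inter> near s k \<noteq> {}"
proof -
  assume f: "f \<in> Em"
  then obtain v where v: "v \<in> ends f" "v \<in> V" using ends_nonempty Em_sub by blast
  have "v \<in> near s k"
    using near_outer[OF v(2)] outer_level(1)[OF Em_level[OF f v(1)], of s] rim_pos(1)[of k] by simp
  with v show ?thesis by blast
qed

lemma change_far:
  assumes g: "good s k \<omega>" "fst (\<omega> (cand s k)) \<in> Q" "good s k \<omega>'" "fst (\<omega>' (cand s k)) \<in> Q"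
    and eq: "\<And>f. f \<in> F \<Longrightarrow> ends f \<inter> near s k = {} \<Longrightarrow> \<omega> f = \<omega>' f"
    and U: "U \<noteq> {}" "U \<subseteq> near s k" and U': "U' \<noteq> {}" "U' \<subseteq> near s k" and v: "v \<in> far s k"
  shows "T a \<omega> U v - T a' \<omega>' U' v = (T a \<omega> U (xn s k) + fst (\<omega> (cand s k))) - (T a' \<omega>' U' (xn s k) + fst (\<omega>' (cand s k)))"
proof -
  obtain u u' where u: "u \<in> U" "u' \<in> U'" using U U' by blast
  have cF: "cand s k \<in> F" using cand_blk blk_F by blast
  have e: "\<tau> a \<omega> (cand s k) = fst (\<omega> (cand s k))" "\<tau> a' \<omega>' (cand s k) = fst (\<omega>' (cand s k))"
    using \<tau>_F[OF cF] g(2,4) Q by auto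
  have eq': "\<tau> a \<omega> f = \<tau> a' \<omega>' f" if "f \<in> avoid ends E (near s k)" for f
    using that Em_near[of f s k] eq[of f] by (auto simp: avoid_def \<tau>_def)
  show ?thesis unfolding T_def e[symmetric]
    by (rule gate_fpt_far[OF gate_good[OF g(1,2)] gate_good[OF g(3,4)] _ U(2) u(1) U'(2) u(2) v connected'])
      (erule eq' | assumption)+
qed

lemma ends_cand: "ends (cand s k) \<inter> near s k \<noteq> {}" "ends (cand s k) \<inter> far s k \<noteq> {}"
proof -
  obtain b where b: "b \<in> {\<beta>0..\<beta>1}" using \<alpha> by auto
  obtain t where t: "t \<in> Q" using overlap[of \<delta>0] \<delta>0 by (metis (mono_tags, lifting) emeasure_empty empty_Collect_eq less_irrefl order_refl)
  \<comment> \<open>Some configuration that makes the block a gate; the ends of the edge are the same in all configurations.\<close>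
  define \<omega> where "\<omega> = (\<lambda>f. if f = cand s k then (t, None) else if f \<in> \<Gamma> (lv s k) then (0, None) else (b, None :: bool option))"
  have "good s k \<omega>" "fst (\<omega> (cand s k)) \<in> Q" using b t \<alpha> by (auto simp: good_def \<omega>_def)
  from gate_good[OF this] show "ends (cand s k) \<inter> near s k \<noteq> {}" "ends (cand s k) \<inter> far s k \<noteq> {}"
    by (auto simp: gate_def)
qed

text \<open>
  In front of the gate nothing changes, and the passage times beyond it pick up the change of the time
  of the gate itself.
\<close>

lemma update_change:
  assumes g: "good s k \<omega>" "fst (\<omega> (cand s k)) \<in> Q" "fst w \<in> Q" and U: "U \<noteq> {}" "U \<subseteq> near s k"
  shows "v \<in> far s k \<Longrightarrow> T a ((\<omega>)(cand s k := w)) U v = T a \<omega> U v + (fst w - fst (\<omega> (cand s k)))"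
    and "v \<in> near s k \<Longrightarrow> T a ((\<omega>)(cand s k := w)) U v = T a \<omega> U v"
proof -
  let ?\<omega> = "(\<omega>)(cand s k := w)"
  have g': "good s k ?\<omega>" "fst (?\<omega> (cand s k)) \<in> Q" using g good_cong[of s k ?\<omega> \<omega>] by auto
  have near: "T a ?\<omega> U v = T a \<omega> U v" if "v \<in> near s k" for v
    by (rule change_near[OF g' g(1,2) _ U that]) (use ends_cand[of s k] in auto)
  then show "v \<in> near s k \<Longrightarrow> T a ?\<omega> U v = T a \<omega> U v" .
  assume v: "v \<in> far s k"
  have "T a ?\<omega> U v - T a \<omega> U v = (T a ?\<omega> U (xn s k) + fst (?\<omega> (cand s k))) - (T a \<omega> U (xn s k) + fst (\<omega> (cand s k)))"
    by (rule change_far[OF g' g(1,2) _ U U v]) (use ends_cand[of s k] in auto)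
  with near[OF xn_near[OF g(1,2)]] show "T a ?\<omega> U v = T a \<omega> U v + (fst w - fst (\<omega> (cand s k)))" by simp
qed

definition far_vertex :: "bool \<Rightarrow> nat \<Rightarrow> vertex" where
  "far_vertex s n = (if s then int n else - int n, 1)"

text \<open>
  The passage times of both families are taken with the same times outside \<open>Em\<close>. The difference is
  constant beyond any gate (\<open>D_gate\<close>), so the limit exists as soon as there is a gate. Defined as a limit
  along the outward vertices, it refers to no particular gate and is thus unaffected by changes at
  gates.
\<close>

definition D :: "bool \<Rightarrow> (edge \<Rightarrow> real) \<times> (edge \<Rightarrow> real) \<Rightarrow> (edge \<Rightarrow> marked) \<Rightarrow> real" where
  "D s x \<omega> = lim (\<lambda>n. T (fst x) \<omega> I (far_vertex s n) - T (snd x) \<omega> I' (far_vertex s n))"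

lemma K_pos: "1 \<in> {1..K}" using J_sub by auto

lemma far_vertex: "far_vertex s n \<in> V" "outer s (far_vertex s n) = int n"
  using K_pos by (auto simp: far_vertex_def graph_verts_def outer_def)

lemma eventually_far: "\<forall>\<^sub>F n in sequentially. far_vertex s n \<in> far s k"
proof -
  have "far_vertex s n \<in> far s k" if "nat (rim k) \<le> n" for n
    using that by (intro far_outer far_vertex) (simp add: far_vertex)
  then show ?thesis by (auto simp: eventually_sequentially)
qed

lemma far_vertex_near: "far_vertex (\<not> s) n \<in> near s k"
proof (rule near_outer[OF far_vertex(1)])
  have "outer s (far_vertex (\<not> s) n) = - int n" using outer_flip[of "\<not> s"] far_vertex(2)[of "\<not> s" n] by simp
  then show "outer s (far_vertex (\<not> s) n) \<le> rim k - int R" using rim_pos(1)[of k] by simp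
qed

lemma lim_eventually_cong: "(\<forall>\<^sub>F n in sequentially. f n = g n) \<Longrightarrow> lim f = lim g"
  unfolding lim_def using tendsto_cong by metis

text \<open>
  Far out on side \<open>s\<close>, a change at a gate adds the same amount to both passage times, which is zero if the
  gate lies on the other side.
\<close>

lemma D_update:
  assumes g: "good s' k \<omega>" "fst (\<omega> (cand s' k)) \<in> Q" "fst w \<in> Q"
  shows "D s x ((\<omega>)(cand s' k := w)) = D s x \<omega>"
  unfolding D_def
proof (rule lim_eventually_cong)
  show "\<forall>\<^sub>F n in sequentially. T (fst x) ((\<omega>)(cand s' k := w)) I (far_vertex s n) - T (snd x) ((\<omega>)(cand s' k := w)) I' (far_vertex s n) =
     T (fst x) \<omega> I (far_vertex s n) - T (snd x) \<omega> I' (far_vertex s n)"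
  proof (cases "s' = s")
    case True
    from eventually_far[of s' k] show ?thesis unfolding True[symmetric]
      by eventually_elim (simp add: update_change(1)[OF g I(1) I_near(1)] update_change(1)[OF g I'(1) I_near(2)])
  next
    case False
    then have "far_vertex s n \<in> near s' k" for n using far_vertex_near[of s' n k] by auto
    then show ?thesis
      by (simp add: update_change(2)[OF g I(1) I_near(1)] update_change(2)[OF g I'(1) I_near(2)])
  qed
qed

lemma D_gate:
  assumes g: "good s k \<omega>" "fst (\<omega> (cand s k)) \<in> Q"
  shows "D s x \<omega> = T (fst x) \<omega> I (xn s k) - T (snd x) \<omega> I' (xn s k)"
    and "v \<in> far s k \<Longrightarrow> T (fst x) \<omega> I v - T (snd x) \<omega> I' v = D s x \<omega>"
proof -
  have far: "T (fst x) \<omega> I v - T (snd x) \<omega> I' v = T (fst x) \<omega> I (xn s k) - T (snd x) \<omega> I' (xn s k)"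
    if "v \<in> far s k" for v
    using change_far[OF g g _ I(1) I_near(1) I'(1) I_near(2) that] by simp
  have "(\<lambda>n. T (fst x) \<omega> I (far_vertex s n) - T (snd x) \<omega> I' (far_vertex s n))
      \<longlonglongrightarrow> T (fst x) \<omega> I (xn s k) - T (snd x) \<omega> I' (xn s k)"
    by (rule tendsto_eventually) (use eventually_far[of s k] in eventually_elim, auto simp: far)
  then show *: "D s x \<omega> = T (fst x) \<omega> I (xn s k) - T (snd x) \<omega> I' (xn s k)"
    unfolding D_def by (rule limI)
  show "v \<in> far s k \<Longrightarrow> T (fst x) \<omega> I v - T (snd x) \<omega> I' v = D s x \<omega>" using far * by simp
qed

definition between :: "nat \<Rightarrow> edge set" where
  "between k = {f \<in> F. \<forall>v\<in>ends f. \<forall>s. outer s v \<le> rim k}"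

lemma blk_between:
  assumes kl: "k \<le> l" shows "blk s k \<subseteq> between l"
proof
  fix f assume f: "f \<in> blk s k"
  have "rim k \<le> rim l" using rim_pos(2)[of k l] kl by (cases "k = l") auto
  then have "outer s' v \<le> rim l" if "v \<in> ends f" for v s'
    using blk_outer[OF f that] rim_pos(1)[of k] rim_pos(1)[of l] outer_flip[of s v]
    by (cases "s' = s") auto
  moreover have "f \<in> F" using f blk_F by blast
  ultimately show "f \<in> between l" by (simp add: between_def)
qed

text \<open>
  A gate on either side shields \<open>D\<close> from the times further out: by \<open>D_gate\<close> it is the difference at the near
  end of a gate, and by \<open>change_near\<close> the passage times there do not see what is beyond the gate, nor
  what is beyond the gate on the other side. The times beyond the two gates are exchanged one after the
  other, through \<open>\<omega>3\<close>.
\<close>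

lemma D_local:
  assumes g: "\<And>s. good s (k s) \<omega> \<and> fst (\<omega> (cand s (k s))) \<in> Q" "\<And>s. good s (k s) \<omega>' \<and> fst (\<omega>' (cand s (k s))) \<in> Q"
    and eq: "\<And>f. f \<in> between l \<Longrightarrow> \<omega> f = \<omega>' f" and kl: "\<And>s. k s \<le> l"
  shows "D s x \<omega> = D s x \<omega>'"
proof -
  have rl: "rim (k s) \<le> rim l" for s using rim_pos(2)[of "k s" l] kl[of s] by (cases "k s = l") auto
  define \<omega>3 where "\<omega>3 f = (if ends f \<inter> far s (k s) = {} then \<omega> f else \<omega>' f)" for f
  have agree: "\<omega>3 f = \<omega>' f" if "f \<in> F" "ends f \<inter> far (\<not> s) (k (\<not> s)) = {}" for f
  proof (cases "ends f \<inter> far s (k s) = {}")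
    case True
    have "f \<in> between l"
      unfolding between_def
    proof (intro CollectI conjI ballI allI \<open>f \<in> F\<close>)
      fix v s' assume v: "v \<in> ends f"
      then have "v \<in> V" using ends_sub \<open>f \<in> F\<close> by (auto simp: F_def)
      have "v \<notin> far s' (k s')" using True that(2) v by (cases "s' = s") auto
      with far_outer[OF \<open>v \<in> V\<close>, of "k s'" s'] show "outer s' v \<le> rim l" using rl[of s'] by linarith
    qed
    with eq show ?thesis by (simp add: \<omega>3_def)
  qed (simp add: \<omega>3_def)
  have blkb: "blk s' (k s') \<subseteq> between l" for s' by (rule blk_between[OF kl])
  have eq3: "\<omega>3 f = \<omega> f" if "f \<in> blk s' (k s')" for f s'
    using eq[of f] blkb[of s'] that by (auto simp: \<omega>3_def)
  have g3: "good s' (k s') \<omega>3 \<and> fst (\<omega>3 (cand s' (k s'))) \<in> Q" for s'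
    using g(1)[of s'] eq3[of _ s'] good_cong[of s' "k s'" \<omega>3 \<omega>] cand_blk[of s' "k s'"] by auto
  have xn: "xn s (k s) \<in> near s (k s)" using xn_near g(1)[of s] by blast
  have xn': "xn s (k s) \<in> near (\<not> s) (k (\<not> s))"
  proof (rule near_outer)
    show "xn s (k s) \<in> V" using xn near_far_V by blast
    have "xn s (k s) \<in> ends (cand s (k s))" using gate_good[of s "k s" \<omega> undefined] g(1)[of s] by (auto simp: gate_def)
    from blk_outer[OF cand_blk this] show "outer (\<not> s) (xn s (k s)) \<le> rim (k (\<not> s)) - int R"
      using rim_pos(1)[of "k s"] rim_pos(1)[of "k (\<not> s)"] by (simp add: outer_flip)
  qed
  have TT: "T a \<omega> U (xn s (k s)) = T a \<omega>' U (xn s (k s))" if U: "U \<noteq> {}" "\<And>s k. U \<subseteq> near s k" for a U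
  proof -
    have "T a \<omega> U (xn s (k s)) = T a \<omega>3 U (xn s (k s))"
      by (rule change_near[where s = s and k = "k s"]) (use g g3 xn U in \<open>auto simp: \<omega>3_def\<close>)
    also have "\<dots> = T a \<omega>' U (xn s (k s))"
      by (rule change_near[where s = "\<not> s" and k = "k (\<not> s)"]) (use g g3 xn' U agree in auto)
    finally show ?thesis .
  qed
  show ?thesis
    using D_gate(1)[of s "k s" \<omega> x] D_gate(1)[of s "k s" \<omega>' x] g[of s] TT[OF I(1) I_near(1)] TT[OF I'(1) I_near(2)] by simp
qed

end


context fpp_coupling begin

section \<open>Flipping gates\<close>

text \<open>
  The difference \<open>d\<close> is made up of \<open>stepcount d\<close> equal steps of size \<open>stepsize d \<le> \<delta>0\<close>, counted with sign.
  For \<open>d = 0\<close> no step is required and the size is arbitrary.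
\<close>

definition stepcount :: "real \<Rightarrow> int" where
  "stepcount d = (if 0 \<le> d then \<lceil>d / \<delta>0\<rceil> else - \<lceil>- d / \<delta>0\<rceil>)"

definition stepsize :: "real \<Rightarrow> real" where
  "stepsize d = (if d = 0 then \<delta>0 else d / of_int (stepcount d))"

lemma stepsize: "0 < stepsize d" "stepsize d \<le> \<delta>0" "stepsize d * of_int (stepcount d) = d"
proof -
  have pos: "0 < d / of_int \<lceil>d / \<delta>0\<rceil> \<and> d / of_int \<lceil>d / \<delta>0\<rceil> \<le> \<delta>0 \<and> 0 < \<lceil>d / \<delta>0\<rceil>" if "0 < d" for d
  proof -
    have "0 < \<lceil>d / \<delta>0\<rceil>" using that \<delta>0 by simp
    moreover have "d \<le> \<delta>0 * of_int \<lceil>d / \<delta>0\<rceil>"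
    proof -
      have "\<delta>0 * (d / \<delta>0) \<le> \<delta>0 * of_int \<lceil>d / \<delta>0\<rceil>" using \<delta>0 by (intro mult_left_mono) auto
      then show ?thesis using \<delta>0 by simp
    qed
    ultimately show ?thesis using that by (simp add: pos_divide_le_eq)
  qed
  have sc: "d < 0 \<Longrightarrow> stepcount d = - \<lceil>- d / \<delta>0\<rceil>" "0 < d \<Longrightarrow> stepcount d = \<lceil>d / \<delta>0\<rceil>" "d = 0 \<Longrightarrow> stepcount d = 0"
    by (simp_all add: stepcount_def)
  consider "d = 0" | "0 < d" | "d < 0" by linarith
  then have "0 < stepsize d \<and> stepsize d \<le> \<delta>0 \<and> stepsize d * of_int (stepcount d) = d"
  proof cases
    case 1 then show ?thesis using \<delta>0 sc by (simp add: stepsize_def)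
  next
    case 2 then show ?thesis using pos[of d] sc by (auto simp: stepsize_def)
  next
    case 3 then show ?thesis using pos[of "- d"] sc by (auto simp: stepsize_def)
  qed
  then show "0 < stepsize d" "stepsize d \<le> \<delta>0" "stepsize d * of_int (stepcount d) = d" by auto
qed

abbreviation "\<Omega> \<equiv> PiM F (\<lambda>_. marked)"
abbreviation "Fam \<equiv> PiM Em (\<lambda>_. P)"

definition dir :: "bool \<Rightarrow> (edge \<Rightarrow> real) \<times> (edge \<Rightarrow> real) \<Rightarrow> nat \<Rightarrow> (edge \<Rightarrow> marked) \<Rightarrow> int" where
  "dir s x k \<omega> = (if good s k \<omega> then shift_dir Q (stepsize (D s x \<omega>)) (\<omega> (cand s k)) else 0)"

definition flip :: "bool \<Rightarrow> (edge \<Rightarrow> real) \<times> (edge \<Rightarrow> real) \<Rightarrow> nat \<Rightarrow> (edge \<Rightarrow> marked) \<Rightarrow> edge \<Rightarrow> marked" where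
  "flip s x k \<omega> = (if good s k \<omega>
     then (\<omega>)(cand s k := swap Q (stepsize (D s x \<omega>)) (\<omega> (cand s k))) else \<omega>)"

text \<open>
  A flip either does nothing or acts at a gate and leaves it a gate.
\<close>

lemma flip_cases:
  obtains "flip s x k \<omega> = \<omega>" "dir s x k \<omega> = 0"
  | "good s k \<omega>" "fst (\<omega> (cand s k)) \<in> Q" "fst (swap Q (stepsize (D s x \<omega>)) (\<omega> (cand s k))) \<in> Q"
    "flip s x k \<omega> = (\<omega>)(cand s k := swap Q (stepsize (D s x \<omega>)) (\<omega> (cand s k)))"
proof (cases "good s k \<omega> \<and> fst (\<omega> (cand s k)) \<in> Q")
  case True
  then show ?thesis using that(2) swap_in by (simp add: flip_def)
next
  case False
  then show ?thesis using that(1) swap_outside[of "\<omega> (cand s k)" Q] by (auto simp: flip_def dir_def)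
qed

lemma D_flip: "D s' x (flip s x k \<omega>) = D s' x \<omega>"
  by (rule flip_cases[of s x k \<omega>]) (simp_all add: D_update)

lemma good_flip: "good s' k' (flip s x k \<omega>) = good s' k' \<omega>"
proof (rule good_cong)
  fix f assume "f \<in> blk s' k' - {cand s' k'}"
  then have "f \<noteq> cand s k" using cand_distinct[of s k s' k'] by (cases "(s, k) = (s', k')") auto
  then show "flip s x k \<omega> f = \<omega> f" by (simp add: flip_def)
qed

lemma dir_flip: "dir s' x i (flip s x j \<omega>) = (if s' = s \<and> i = j then - dir s' x i \<omega> else dir s' x i \<omega>)"
proof (cases "s' = s \<and> i = j")
  case True
  then show ?thesis using shift_dir_swap[OF stepsize(1)]
    by (simp add: dir_def good_flip D_flip) (simp add: flip_def)
next
  case False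
  then have "cand s' i \<noteq> cand s j" using cand_distinct[of s j s' i] cand_blk[of s' i] by auto
  then have "flip s x j \<omega> (cand s' i) = \<omega> (cand s' i)" by (simp add: flip_def)
  with False show ?thesis by (auto simp: dir_def good_flip D_flip)
qed

lemma T_flip:
  assumes U: "U \<noteq> {}" "U \<subseteq> near s k"
  shows "v \<in> far s k \<Longrightarrow> T a (flip s x k \<omega>) U v = T a \<omega> U v + stepsize (D s x \<omega>) * of_int (dir s x k \<omega>)"
    and "v \<in> near s k \<Longrightarrow> T a (flip s x k \<omega>) U v = T a \<omega> U v"
  by (rule flip_cases[of s x k \<omega>], simp_all add: update_change U fst_swap dir_def)
    (rule flip_cases[of s x k \<omega>], simp_all add: update_change U)

lemma component_measurable:
  assumes "\<omega> \<in> N \<rightarrow>\<^sub>M PiM G (\<lambda>_. marked)" "f \<in> G" shows "(\<lambda>p. \<omega> p f) \<in> N \<rightarrow>\<^sub>M marked_space"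
  using measurable_compose[OF assms(1) measurable_component_singleton[OF assms(2)]]
  by (simp add: measurable_cong_sets[OF refl sets_marked])

text \<open>
  There are only countably many walks.
\<close>

lemma T_measurable [measurable]:
  assumes a [measurable]: "a \<in> N \<rightarrow>\<^sub>M Fam" and \<omega> [measurable]: "\<omega> \<in> N \<rightarrow>\<^sub>M \<Omega>"
  shows "(\<lambda>p. T (a p) (\<omega> p) U v) \<in> borel_measurable N"
proof -
  note [measurable_cong] = setsP
  have e [measurable]: "(\<lambda>p. \<tau> (a p) (\<omega> p) f) \<in> borel_measurable N" for f
  proof -
    have "(\<lambda>p. a p f) \<in> borel_measurable N" if "f \<in> Em"
      using measurable_compose[OF a measurable_component_singleton[OF that]] by (simp add: measurable_cong_sets[OF refl setsP])
    moreover have "(\<lambda>p. fst (\<omega> p f)) \<in> borel_measurable N" if "f \<in> F"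
    proof -
      note [measurable] = component_measurable[OF \<omega> that]
      show ?thesis by measurable
    qed
    ultimately show ?thesis unfolding \<tau>_def by (cases "f \<in> Em"; cases "f \<in> F") simp_all
  qed
  have cost [measurable]: "(\<lambda>p. cost (\<tau> (a p) (\<omega> p)) w) \<in> borel_measurable N" for w :: "(edge \<times> vertex) list"
    by (induction w) auto
  show ?thesis unfolding T_def fpt_def
    by (rule borel_measurable_cINF_real) (auto intro: countable_subset[OF subset_UNIV])
qed

lemma D_measurable [measurable]:
  assumes [measurable]: "x \<in> N \<rightarrow>\<^sub>M Fam \<Otimes>\<^sub>M Fam" "\<omega> \<in> N \<rightarrow>\<^sub>M \<Omega>"
  shows "(\<lambda>p. D s (x p) (\<omega> p)) \<in> borel_measurable N"
  unfolding D_def by measurable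

lemma stepcount_measurable [measurable]: "stepcount \<in> borel \<rightarrow>\<^sub>M count_space UNIV"
  unfolding stepcount_def[abs_def] by measurable

lemma stepsize_measurable [measurable]: "stepsize \<in> borel_measurable borel"
  unfolding stepsize_def[abs_def] by measurable

lemma cand_F: "cand s k \<in> F" using cand_blk blk_F by blast

lemma good_measurable [measurable]:
  assumes \<omega>: "\<omega> \<in> N \<rightarrow>\<^sub>M PiM G (\<lambda>_. marked)" and G: "blk s k \<subseteq> G"
  shows "Measurable.pred N (\<lambda>p. good s k (\<omega> p))"
  unfolding good_def
proof (rule pred_intros_finite)
  show "finite (blk s k - {cand s k})" using finite_block by blast
  fix f assume "f \<in> blk s k - {cand s k}"
  then have "f \<in> G" using G by auto
  from component_measurable[OF \<omega> this] have [measurable]: "(\<lambda>p. \<omega> p f) \<in> N \<rightarrow>\<^sub>M marked_space" .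
  show "Measurable.pred N (\<lambda>p. if f \<in> \<Gamma> (lv s k) then fst (\<omega> p f) \<le> \<alpha> else \<beta>0 \<le> fst (\<omega> p f) \<and> fst (\<omega> p f) \<le> \<beta>1)"
    by (cases "f \<in> \<Gamma> (lv s k)") simp_all
qed

lemma dir_measurable [measurable]:
  assumes x [measurable]: "x \<in> N \<rightarrow>\<^sub>M Fam \<Otimes>\<^sub>M Fam" and \<omega> [measurable]: "\<omega> \<in> N \<rightarrow>\<^sub>M \<Omega>"
  shows "(\<lambda>p. dir s (x p) k (\<omega> p)) \<in> N \<rightarrow>\<^sub>M count_space UNIV"
proof -
  note [measurable] = good_measurable[OF \<omega> blk_F] component_measurable[OF \<omega> cand_F]
  show ?thesis unfolding dir_def by measurable
qed

lemma flip_measurable [measurable]: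
  assumes x [measurable]: "x \<in> N \<rightarrow>\<^sub>M Fam \<Otimes>\<^sub>M Fam" and \<omega> [measurable]: "\<omega> \<in> N \<rightarrow>\<^sub>M \<Omega>"
  shows "(\<lambda>p. flip s (x p) k (\<omega> p)) \<in> N \<rightarrow>\<^sub>M \<Omega>"
proof -
  note [measurable] = good_measurable[OF \<omega> blk_F] component_measurable[OF \<omega> cand_F]
  have sw: "(\<lambda>p. swap Q (stepsize (D s (x p) (\<omega> p))) (\<omega> p (cand s k))) \<in> N \<rightarrow>\<^sub>M marked_space" by measurable
  have "(\<lambda>p. (\<omega> p)(cand s k := swap Q (stepsize (D s (x p) (\<omega> p))) (\<omega> p (cand s k)))) \<in> N \<rightarrow>\<^sub>M \<Omega>"
    by (rule measurable_fun_upd[where J = F]) (use cand_F \<omega> sw in \<open>auto simp: measurable_cong_sets[OF refl sets_marked]\<close>)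
  then show ?thesis unfolding flip_def by measurable
qed

text \<open>
  The size of the step depends on the time that is moved, through \<open>D\<close>. But by \<open>D_update\<close> it takes the same
  value for all times in \<open>Q\<close>, and times outside \<open>Q\<close> stay where they are; so with the other coordinates fixed
  the flip is an interchange with constant step.
\<close>

lemma flip_pres:
  assumes x: "x \<in> space (Fam \<Otimes>\<^sub>M Fam)"
  shows "distr \<Omega> \<Omega> (flip s x k) = \<Omega>"
proof -
  let ?e = "cand s k"
  define h where "h \<omega> = (if good s k \<omega> then swap Q (stepsize (D s x \<omega>)) (\<omega> ?e) else \<omega> ?e)" for \<omega>
  have [measurable]: "(\<lambda>_. x) \<in> \<Omega> \<rightarrow>\<^sub>M Fam \<Otimes>\<^sub>M Fam" using x by simp
  have [measurable]: "(\<lambda>\<omega>. \<omega> ?e) \<in> \<Omega> \<rightarrow>\<^sub>M marked_space" "(\<lambda>\<omega>. good s k \<omega>) \<in> \<Omega> \<rightarrow>\<^sub>M count_space UNIV"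
    using component_measurable[OF measurable_ident cand_F] good_measurable[OF measurable_ident blk_F] by (simp_all add: id_def)
  have h: "h \<in> \<Omega> \<rightarrow>\<^sub>M marked" unfolding h_def[abs_def] measurable_cong_sets[OF refl sets_marked] by measurable
  obtain t0 where t0: "t0 \<in> Q"
    using overlap[of \<delta>0] \<delta>0 by (metis (mono_tags, lifting) emeasure_empty empty_Collect_eq less_irrefl order_refl)
  have fl: "flip s x k = (\<lambda>\<omega>. (\<omega>)(?e := h \<omega>))" by (auto simp: flip_def h_def)
  have "distr \<Omega> \<Omega> (\<lambda>\<omega>. (\<omega>)(?e := h \<omega>)) = \<Omega>"
  proof (rule distr_PiM_update[OF prob_marked cand_F h])
    fix \<rho> :: "edge \<Rightarrow> marked"
    have gd: "good s k ((\<rho>)(?e := w)) = good s k \<rho>" for w by (rule good_cong) auto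
    show "distr marked marked (\<lambda>w. h ((\<rho>)(?e := w))) = marked"
    proof (cases "good s k \<rho>")
      case False
      then show ?thesis by (simp add: h_def gd distr_id2)
    next
      case True
      define d where "d = stepsize (D s x ((\<rho>)(?e := (t0, None))))"
      have "h ((\<rho>)(?e := w)) = swap Q d w" for w
      proof (cases "fst w \<in> Q")
        case False then show ?thesis using swap_outside[OF False] by (simp add: h_def)
      next
        case w: True
        have "D s x (((\<rho>)(?e := (t0, None)))(?e := w)) = D s x ((\<rho>)(?e := (t0, None)))"
          by (rule D_update) (use True gd t0 w in auto)
        then show ?thesis using True gd by (simp add: h_def d_def)
      qed
      then show ?thesis using swap_preserves_marked[of d] stepsize(1) by (simp add: d_def)
    qed
  qed
  then show ?thesis unfolding fl .
qed

end


context fpp_coupling begin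

section \<open>The two families meet\<close>

lemma Q_pos: "0 < emeasure lborel Q"
proof -
  have "0 < emeasure lborel {t \<in> Q. t + \<delta>0 \<in> Q}" using overlap[of \<delta>0] \<delta>0 by simp
  also have "\<dots> \<le> emeasure lborel Q" by (rule emeasure_mono) auto
  finally show ?thesis .
qed

lemma measure_marked_fst:
  assumes [measurable]: "Y \<in> sets borel"
  shows "measure marked {w. fst w \<in> Y} = measure P Y"
proof -
  note [measurable_cong] = setsP
  have "measure P Y = measure (distr marked P fst) Y" by (simp add: distr_fst_marked)
  also have "\<dots> = measure marked (fst -` Y \<inter> space marked)" by (rule measure_distr) measurable
  also have "fst -` Y \<inter> space marked = {w. fst w \<in> Y}" by auto
  finally show ?thesis by simp
qed

lemma sets_markedI: "Measurable.pred marked_space p \<Longrightarrow> {w. p w} \<in> sets marked"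
  by (simp add: pred_def space_pair_measure)

lemma AE_good_infinite:
  assumes \<delta>: "0 < \<delta>" "\<delta> \<le> \<delta>0" and G: "\<And>k. k0 \<le> k \<Longrightarrow> blk s k \<subseteq> G"
  shows "AE \<omega> in PiM G (\<lambda>_. marked).
    infinite {k. k0 \<le> k \<and> good s k \<omega> \<and> shift_dir Q \<delta> (\<omega> (cand s k)) \<noteq> 0}"
proof -
  interpret mk: prob_space marked by (rule prob_marked)
  let ?L = "{w :: marked. fst w \<in> {..\<alpha>}}" and ?H = "{w :: marked. fst w \<in> {\<beta>0..\<beta>1}}" and ?S = "{w. shift_dir Q \<delta> w \<noteq> 0}"
  have sets: "?L \<in> sets marked" "?H \<in> sets marked" "?S \<in> sets marked"
    by (rule sets_markedI; measurable)+
  have "0 < ennreal c * emeasure lborel ({..\<alpha>} \<inter> Q)"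
  proof -
    have "{..\<alpha>} \<inter> Q = Q" using Q by auto
    then show ?thesis using Q_pos c by (simp add: ennreal_zero_less_mult_iff)
  qed
  then have "0 < emeasure P {..\<alpha>}" using dom[of "{..\<alpha>}"] by simp
  then have L: "0 < measure marked ?L" by (subst measure_marked_fst) (auto simp: emeasure_eq_measure)
  have H: "0 < measure marked ?H" using P\<beta> by (subst measure_marked_fst) (auto simp: emeasure_eq_measure)
  have S: "0 < measure marked ?S" using swap_positive[OF \<delta>(1) overlap[OF \<delta>]] by (simp add: mk.emeasure_eq_measure)
  define q where "q = min (measure marked ?L) (min (measure marked ?H) (measure marked ?S))"
  have q: "0 < q" "q \<le> measure marked ?L" "q \<le> measure marked ?H" "q \<le> measure marked ?S"
    unfolding q_def using L H S by linarith+
  have q1: "q \<le> 1" using q(2) mk.prob_le_1 by (rule order.trans)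
  define X where "X k f = (if f = cand s (k0 + k) then ?S else if f \<in> \<Gamma> (lv s (k0 + k)) then ?L else ?H)" for k f
  have "AE \<omega> in PiM G (\<lambda>_. marked). infinite {k. \<forall>f\<in>blk s (k0 + k). \<omega> f \<in> X k f}"
  proof (rule AE_infinitely_many_blocks[OF prob_marked])
    show "finite (blk s (k0 + k))" "blk s (k0 + k) \<subseteq> G" for k using finite_block G by auto
    show "disjoint_family (\<lambda>k. blk s (k0 + k))"
      unfolding disjoint_family_on_def using blk_disjoint by auto
    show "X k f \<in> sets marked" for k f using sets by (simp add: X_def)
    let ?M = "(R + 1) * (L + card J)"
    show "0 < q ^ ?M" using q by simp
    show "q ^ ?M \<le> (\<Prod>f\<in>blk s (k0 + k). measure marked (X k f))" for k
    proof -
      have "q ^ ?M \<le> q ^ card (blk s (k0 + k))" using q(1) q1 finite_block by (intro power_decreasing) auto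
      also have "\<dots> = (\<Prod>f\<in>blk s (k0 + k). q)" by simp
      also have "\<dots> \<le> (\<Prod>f\<in>blk s (k0 + k). measure marked (X k f))"
        using q by (intro prod_mono) (auto simp: X_def)
      finally show ?thesis .
    qed
  qed
  then show ?thesis
  proof eventually_elim
    case (elim \<omega>)
    have "(\<forall>f\<in>blk s (k0 + k). \<omega> f \<in> X k f) \<Longrightarrow> good s (k0 + k) \<omega> \<and> shift_dir Q \<delta> (\<omega> (cand s (k0 + k))) \<noteq> 0" for k
      using cand_blk[of s "k0 + k"] by (auto simp: good_def X_def split: if_splits)
    then have "(+) k0 ` {k. \<forall>f\<in>blk s (k0 + k). \<omega> f \<in> X k f} \<subseteq>
        {k. k0 \<le> k \<and> good s k \<omega> \<and> shift_dir Q \<delta> (\<omega> (cand s k)) \<noteq> 0}" by auto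
    moreover have "infinite ((+) k0 ` {k. \<forall>f\<in>blk s (k0 + k). \<omega> f \<in> X k f})"
      using elim by (subst finite_image_iff) auto
    ultimately show ?case using finite_subset by blast
  qed
qed

lemma AE_gate: "AE \<omega> in \<Omega>. \<exists>k. good s k \<omega> \<and> fst (\<omega> (cand s k)) \<in> Q"
  using AE_good_infinite[OF \<delta>0 order.refl blk_F, of 0 s]
proof eventually_elim
  case (elim \<omega>)
  then obtain k where "good s k \<omega>" "shift_dir Q \<delta>0 (\<omega> (cand s k)) \<noteq> 0"
    using not_finite_existsD by auto
  then show ?case using swap_outside by blast
qed

lemma blk_not_between:
  assumes kl: "l < k" shows "blk s k \<subseteq> F - between l"
proof
  fix f assume f: "f \<in> blk s k"
  then have "f \<in> E" by (simp add: block_def)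
  obtain v where v: "v \<in> ends f" using ends_nonempty[OF \<open>f \<in> E\<close>] by blast
  then have "rim l < outer s v" using blk_outer[OF f v] rim_pos(2)[OF kl] by linarith
  then have "f \<notin> between l" using v unfolding between_def mem_Collect_eq by (metis not_less)
  moreover have "f \<in> F" using f blk_F by blast
  ultimately show "f \<in> F - between l" by simp
qed

lemma infinite_measurable:
  fixes p :: "nat \<Rightarrow> 'a \<Rightarrow> bool"
  assumes [measurable]: "\<And>k. Measurable.pred N (p k)"
  shows "Measurable.pred N (\<lambda>x. infinite {k. p k x})"
  unfolding infinite_nat_iff_unbounded mem_Collect_eq by measurable

text \<open>
  For a fixed step size this is \<open>AE_good_infinite\<close>. The actual step size is random, but given a gate on each
  side it depends only on the times of the edges between them (\<open>D_local\<close>). By Fubini these may be fixed,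
  and the blocks further out are still independent with the same laws.
\<close>

lemma AE_dir_infinite:
  assumes x: "x \<in> space (Fam \<Otimes>\<^sub>M Fam)"
  shows "AE \<omega> in \<Omega>. infinite {k. dir s x k \<omega> \<noteq> 0}"
proof -
  define gt where "gt kk \<omega> \<longleftrightarrow> (\<forall>s. good s (kk s) \<omega> \<and> fst (\<omega> (cand s (kk s))) \<in> Q)" for kk :: "bool \<Rightarrow> nat" and \<omega>
  have main: "AE \<omega> in \<Omega>. gt kk \<omega> \<longrightarrow> infinite {k. dir s x k \<omega> \<noteq> 0}" for kk
  proof -
    define l where "l = max (kk True) (kk False)"
    have kl: "kk s \<le> l" for s by (cases s) (auto simp: l_def)
    define F0 where "F0 = between l"
    define F1 where "F1 = F - F0"
    let ?M0 = "PiM F0 (\<lambda>_. marked)" and ?M1 = "PiM F1 (\<lambda>_. marked)"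
    interpret M0: prob_space ?M0 by (rule prob_space_PiM) (rule prob_marked)
    interpret M1: prob_space ?M1 by (rule prob_space_PiM) (rule prob_marked)
    interpret M01: pair_sigma_finite ?M0 ?M1 ..
    have F01: "F0 \<inter> F1 = {}" "F0 \<union> F1 = F" by (auto simp: F1_def F0_def between_def)
    let ?ok = "\<lambda>\<omega>. gt kk \<omega> \<longrightarrow> infinite {k. dir s x k \<omega> \<noteq> 0}"
    have id: "(\<lambda>\<omega>. \<omega>) \<in> \<Omega> \<rightarrow>\<^sub>M \<Omega>" by simp
    have [measurable]: "Measurable.pred \<Omega> (gt kk)"
    proof -
      note [measurable] = good_measurable[OF id blk_F] component_measurable[OF id cand_F]
      have "Measurable.pred \<Omega> (\<lambda>\<omega>. good s (kk s) \<omega> \<and> fst (\<omega> (cand s (kk s))) \<in> Q)" for s by measurable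
      then have "Measurable.pred \<Omega> (\<lambda>\<omega>. \<forall>s\<in>UNIV. good s (kk s) \<omega> \<and> fst (\<omega> (cand s (kk s))) \<in> Q)"
        by (intro pred_intros_finite) auto
      then show ?thesis by (simp add: gt_def[abs_def])
    qed
    have xm: "(\<lambda>_. x) \<in> \<Omega> \<rightarrow>\<^sub>M Fam \<Otimes>\<^sub>M Fam" using x by simp
    note [measurable] = dir_measurable[OF xm id]
    have ok [measurable]: "Measurable.pred \<Omega> ?ok" by (intro pred_intros_logic infinite_measurable) measurable
    have mg [measurable]: "merge F0 F1 \<in> ?M0 \<Otimes>\<^sub>M ?M1 \<rightarrow>\<^sub>M \<Omega>"
      using measurable_merge[of F0 F1 "\<lambda>_. marked"] by (simp add: F01)
    have "AE p in ?M0 \<Otimes>\<^sub>M ?M1. ?ok (merge F0 F1 p)"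
    proof (rule M01.AE_pair_measure)
      show "{p \<in> space (?M0 \<Otimes>\<^sub>M ?M1). ?ok (merge F0 F1 p)} \<in> sets (?M0 \<Otimes>\<^sub>M ?M1)" by measurable
      show "AE \<omega>0 in ?M0. AE \<omega>1 in ?M1. ?ok (merge F0 F1 (\<omega>0, \<omega>1))"
      proof (rule AE_I2)
        fix \<omega>0 assume "\<omega>0 \<in> space ?M0"
        \<comment> \<open>Any configuration would do: it only serves to name the constant value of D.\<close>
        define base where "base = (\<lambda>f\<in>F1. (0 :: real, None :: bool option))"
        let ?m = "\<lambda>\<omega>1. merge F0 F1 (\<omega>0, \<omega>1)"
        have m0: "f \<in> F0 \<Longrightarrow> ?m \<omega>1 f = \<omega>0 f" and m1: "f \<in> F1 \<Longrightarrow> ?m \<omega>1 f = \<omega>1 f" for f \<omega>1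
          using F01 by (auto simp: merge_def)
        have inF0: "f \<in> F0" if "f \<in> blk s (kk s)" for f s using blk_between[OF kl] that by (auto simp: F0_def)
        have gt_const: "gt kk (?m \<omega>1) = gt kk (?m base)" for \<omega>1
        proof -
          have "good s (kk s) (?m \<omega>1) = good s (kk s) (?m base)" for s
          proof (rule good_cong)
            fix f assume "f \<in> blk s (kk s) - {cand s (kk s)}"
            then have "f \<in> F0" using inF0[of f s] by simp
            then show "?m \<omega>1 f = ?m base f" by (simp add: m0)
          qed
          moreover have "?m \<omega>1 (cand s (kk s)) = ?m base (cand s (kk s))" for s
            using m0[OF inF0[OF cand_blk]] by simp
          ultimately show ?thesis by (simp add: gt_def)
        qed
        show "AE \<omega>1 in ?M1. ?ok (?m \<omega>1)"
        proof (cases "gt kk (?m base)")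
          case False
          then have "\<not> gt kk (?m \<omega>1)" for \<omega>1 using gt_const[of \<omega>1] by blast
          then show ?thesis by simp
        next
          case True
          define \<delta> where "\<delta> = stepsize (D s x (?m base))"
          have D: "D s x (?m \<omega>1) = D s x (?m base)" for \<omega>1
          proof (rule D_local[where k = kk and l = l, OF _ _ _ kl])
            have "gt kk (?m \<omega>1)" using True gt_const[of \<omega>1] by blast
            then show "good s (kk s) (?m \<omega>1) \<and> fst (?m \<omega>1 (cand s (kk s))) \<in> Q" for s unfolding gt_def by blast
            show "good s (kk s) (?m base) \<and> fst (?m base (cand s (kk s))) \<in> Q" for s using True unfolding gt_def by blast
            show "?m \<omega>1 f = ?m base f" if "f \<in> between l" for f using that m0[of f] by (simp add: F0_def)
          qed
          have later: "blk s k \<subseteq> F1" if "Suc l \<le> k" for k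
            using blk_not_between[of l k s] that by (auto simp: F1_def F0_def)
          have "AE \<omega>1 in ?M1. infinite {k. Suc l \<le> k \<and> good s k \<omega>1 \<and> shift_dir Q \<delta> (\<omega>1 (cand s k)) \<noteq> 0}"
            by (rule AE_good_infinite) (use later stepsize in \<open>auto simp: \<delta>_def\<close>)
          then show ?thesis
          proof eventually_elim
            case (elim \<omega>1)
            have "dir s x k (?m \<omega>1) \<noteq> 0" if "Suc l \<le> k" "good s k \<omega>1" "shift_dir Q \<delta> (\<omega>1 (cand s k)) \<noteq> 0" for k
            proof -
              have "good s k (?m \<omega>1)" using that(2) later[OF that(1)] m1 by (subst good_cong[of s k _ \<omega>1]) auto
              moreover have "?m \<omega>1 (cand s k) = \<omega>1 (cand s k)" using later[OF that(1)] cand_blk m1 by blast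
              ultimately show ?thesis using that(3) by (simp add: dir_def D[of \<omega>1] \<delta>_def)
            qed
            then have "{k. Suc l \<le> k \<and> good s k \<omega>1 \<and> shift_dir Q \<delta> (\<omega>1 (cand s k)) \<noteq> 0} \<subseteq> {k. dir s x k (?m \<omega>1) \<noteq> 0}" by auto
            with elim show ?case using finite_subset by blast
          qed
        qed
      qed
    qed
    then have "AE \<omega> in distr (?M0 \<Otimes>\<^sub>M ?M1) \<Omega> (merge F0 F1). ?ok \<omega>"
      by (subst AE_distr_iff[OF mg]) (use ok in \<open>auto simp: pred_def\<close>)
    moreover have "distr (?M0 \<Otimes>\<^sub>M ?M1) \<Omega> (merge F0 F1) = \<Omega>"
      using distr_PiM_merge[OF prob_marked F01(1)] by (simp add: F01)
    ultimately show ?thesis by (simp only:)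
  qed
  have "AE \<omega> in \<Omega>. \<forall>ij. gt (\<lambda>s. if s then fst ij else snd ij) \<omega> \<longrightarrow> infinite {k. dir s x k \<omega> \<noteq> 0}"
    by (subst AE_all_countable) (use main in auto)
  with AE_gate[of True] AE_gate[of False] show ?thesis
  proof eventually_elim
    case (elim \<omega>)
    then obtain i j where "good True i \<omega>" "fst (\<omega> (cand True i)) \<in> Q" "good False j \<omega>" "fst (\<omega> (cand False j)) \<in> Q" by blast
    then have "gt (\<lambda>s. if s then fst (i, j) else snd (i, j)) \<omega>" by (simp add: gt_def)
    with elim(3) show ?case by blast
  qed
qed

lemma flip_walk_side:
  assumes x: "x \<in> space (Fam \<Otimes>\<^sub>M Fam)"
  shows "flip_walk \<Omega> (flip s x) (dir s x)"
proof -
  have xm: "(\<lambda>_. x) \<in> \<Omega> \<rightarrow>\<^sub>M Fam \<Otimes>\<^sub>M Fam" using x by simp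
  have id: "(\<lambda>\<omega>. \<omega>) \<in> \<Omega> \<rightarrow>\<^sub>M \<Omega>" by simp
  show ?thesis
  proof (intro flip_walk.intro flip_walk_axioms.intro)
    show "prob_space \<Omega>" by (rule prob_space_PiM) (rule prob_marked)
    show "flip s x j \<in> \<Omega> \<rightarrow>\<^sub>M \<Omega>" for j using flip_measurable[OF xm id] by simp
    show "dir s x j \<in> \<Omega> \<rightarrow>\<^sub>M count_space UNIV" for j using dir_measurable[OF xm id] by simp
    show "dir s x j \<omega> \<in> {- 1, 0, 1}" for j \<omega> using shift_dir_range by (simp add: dir_def)
  qed (use flip_pres[OF x] AE_dir_infinite[OF x] dir_flip in auto)
qed

definition target :: "bool \<Rightarrow> (edge \<Rightarrow> real) \<times> (edge \<Rightarrow> real) \<Rightarrow> (edge \<Rightarrow> marked) \<Rightarrow> int" where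
  "target s x \<omega> = stepcount (D s x \<omega>)"

definition mirror :: "bool \<Rightarrow> (edge \<Rightarrow> real) \<times> (edge \<Rightarrow> real) \<Rightarrow> (edge \<Rightarrow> marked) \<Rightarrow> edge \<Rightarrow> marked" where
  "mirror s x = flip_walk.reflect (flip s x) (dir s x) (target s x)"

definition \<Psi> :: "(edge \<Rightarrow> real) \<times> (edge \<Rightarrow> real) \<Rightarrow> (edge \<Rightarrow> marked) \<Rightarrow> edge \<Rightarrow> marked" where
  "\<Psi> x \<omega> = mirror False x (mirror True x \<omega>)"

lemma target_measurable:
  assumes x: "x \<in> space (Fam \<Otimes>\<^sub>M Fam)"
  shows "target s x \<in> \<Omega> \<rightarrow>\<^sub>M count_space UNIV"
proof -
  have [measurable]: "(\<lambda>_. x) \<in> \<Omega> \<rightarrow>\<^sub>M Fam \<Otimes>\<^sub>M Fam" using x by simp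
  show ?thesis unfolding target_def[abs_def] by measurable
qed

lemma mirror_pres:
  assumes x: "x \<in> space (Fam \<Otimes>\<^sub>M Fam)"
  shows "mirror s x \<in> \<Omega> \<rightarrow>\<^sub>M \<Omega>" "distr \<Omega> \<Omega> (mirror s x) = \<Omega>"
proof -
  interpret fw: flip_walk \<Omega> "flip s x" "dir s x" by (rule flip_walk_side[OF x])
  have inv: "\<forall>j. \<forall>\<omega>\<in>space \<Omega>. target s x (flip s x j \<omega>) = target s x \<omega>" by (simp add: target_def D_flip)
  show "mirror s x \<in> \<Omega> \<rightarrow>\<^sub>M \<Omega>" "distr \<Omega> \<Omega> (mirror s x) = \<Omega>"
    unfolding mirror_def
    using fw.reflect_meas[OF target_measurable[OF x] inv] fw.reflect_pres[OF target_measurable[OF x] inv] by auto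
qed

lemma \<Psi>_pres:
  assumes x: "x \<in> space (Fam \<Otimes>\<^sub>M Fam)"
  shows "\<Psi> x \<in> \<Omega> \<rightarrow>\<^sub>M \<Omega>" "distr \<Omega> \<Omega> (\<Psi> x) = \<Omega>"
proof -
  note m = mirror_pres[OF x]
  have \<Psi>: "\<Psi> x = mirror False x \<circ> mirror True x" by (auto simp: \<Psi>_def)
  show "\<Psi> x \<in> \<Omega> \<rightarrow>\<^sub>M \<Omega>" unfolding \<Psi> by (rule measurable_comp[OF m(1) m(1)])
  have "distr \<Omega> \<Omega> (\<Psi> x) = distr (distr \<Omega> \<Omega> (mirror True x)) \<Omega> (mirror False x)"
    unfolding \<Psi> by (rule distr_distr[symmetric]) (use m in auto)
  then show "distr \<Omega> \<Omega> (\<Psi> x) = \<Omega>" by (simp add: m(2))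
qed

abbreviation turns where "turns s x k \<equiv> flip_walk.\<Theta> (flip s x) k"
abbreviation walk_pos where "walk_pos s x k \<omega> \<equiv> flip_walk.S (dir s x) k \<omega>"

text \<open>
  Flips on one side influence neither the differences nor the steps on the other side, so the two
  reflections can be carried out one after the other.
\<close>

lemma other_side:
  assumes x: "x \<in> space (Fam \<Otimes>\<^sub>M Fam)"
  shows "D s' x (turns s x k \<omega>) = D s' x \<omega>" and "s' \<noteq> s \<Longrightarrow> dir s' x i (turns s x k \<omega>) = dir s' x i \<omega>"
proof -
  interpret fw: flip_walk \<Omega> "flip s x" "dir s x" by (rule flip_walk_side[OF x])
  show "D s' x (fw.\<Theta> k \<omega>) = D s' x \<omega>" by (induction k) (simp_all add: D_flip)
  show "s' \<noteq> s \<Longrightarrow> dir s' x i (fw.\<Theta> k \<omega>) = dir s' x i \<omega>" by (induction k) (simp_all add: dir_flip)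
qed

text \<open>
  Reversing the first \<open>k\<close> steps moves the passage times beyond the first \<open>k\<close> blocks by \<open>stepsize\<close> times the
  position of the walk.
\<close>

lemma T_turns:
  assumes x: "x \<in> space (Fam \<Otimes>\<^sub>M Fam)" and \<omega>: "\<omega> \<in> space \<Omega>"
    and U: "U \<noteq> {}" "\<And>s k. U \<subseteq> near s k"
  shows "(\<And>j. j < k \<Longrightarrow> v \<in> far s j) \<Longrightarrow>
      T a (turns s x k \<omega>) U v = T a \<omega> U v + stepsize (D s x \<omega>) * of_int (walk_pos s x k \<omega>)"
    and "(\<And>j. j < k \<Longrightarrow> v \<in> near s j) \<Longrightarrow> T a (turns s x k \<omega>) U v = T a \<omega> U v"
proof -
  interpret fw: flip_walk \<Omega> "flip s x" "dir s x" by (rule flip_walk_side[OF x])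
  show "T a (fw.\<Theta> k \<omega>) U v = T a \<omega> U v + stepsize (D s x \<omega>) * of_int (fw.S k \<omega>)"
    if "\<And>j. j < k \<Longrightarrow> v \<in> far s j" using that
  proof (induction k)
    case 0 then show ?case by (simp add: fw.S_def)
  next
    case (Suc k)
    then have v: "v \<in> far s k" by auto
    have "T a (fw.\<Theta> (Suc k) \<omega>) U v = T a (fw.\<Theta> k \<omega>) U v + stepsize (D s x (fw.\<Theta> k \<omega>)) * of_int (dir s x k (fw.\<Theta> k \<omega>))"
      using T_flip(1)[OF U(1) U(2) v] by simp
    also have "dir s x k (fw.\<Theta> k \<omega>) = dir s x k \<omega>" using fw.\<xi>_\<Theta>[OF \<omega>, of k k] by simp
    finally show ?case using Suc by (simp add: other_side(1)[OF x] fw.S_def algebra_simps)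
  qed
  show "T a (fw.\<Theta> k \<omega>) U v = T a \<omega> U v" if "\<And>j. j < k \<Longrightarrow> v \<in> near s j" using that
    by (induction k) (simp_all add: T_flip(2)[OF U(1) U(2)])
qed

lemma rim_mono: "i \<le> k \<Longrightarrow> rim i \<le> rim k"
  using rim_pos(2)[of i k] by (cases "i = k") auto

text \<open>
  When the walk on a side reaches its target, the flips have added \<open>D\<close> to the passage times of the second
  family on that side, which is exactly what they lacked.
\<close>

lemma AE_coalesce:
  assumes x: "x \<in> space (Fam \<Otimes>\<^sub>M Fam)"
  shows "AE \<omega> in \<Omega>. \<exists>M::nat. \<forall>v\<in>V. int M \<le> \<bar>fst v\<bar> \<longrightarrow> T (fst x) \<omega> I v = T (snd x) (\<Psi> x \<omega>) I' v"
proof -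
  interpret r: flip_walk \<Omega> "flip True x" "dir True x" by (rule flip_walk_side[OF x])
  interpret l: flip_walk \<Omega> "flip False x" "dir False x" by (rule flip_walk_side[OF x])
  have inv: "\<forall>j. \<forall>\<omega>\<in>space \<Omega>. target s x (flip s x j \<omega>) = target s x \<omega>" for s by (simp add: target_def D_flip)
  from r.AE_first_hit[OF target_measurable[OF x] inv] l.AE_first_hit[OF target_measurable[OF x] inv]
    AE_gate[of True] AE_gate[of False] AE_space
  show ?thesis
  proof eventually_elim
    case (elim \<omega>)
    obtain kr kl where kr: "r.first_hit (target True x) kr \<omega>" and kl: "l.first_hit (target False x) kl \<omega>" using elim by blast
    obtain gr gl where gr: "good True gr \<omega>" "fst (\<omega> (cand True gr)) \<in> Q" and gl: "good False gl \<omega>" "fst (\<omega> (cand False gl)) \<in> Q"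
      using elim by blast
    define \<omega>' where "\<omega>' = r.\<Theta> kr \<omega>"
    have \<omega>': "\<omega>' \<in> space \<Omega>" unfolding \<omega>'_def by (rule r.\<Theta>_space[OF elim(5)])
    have dirl: "dir False x i \<omega>' = dir False x i \<omega>" for i unfolding \<omega>'_def by (rule other_side(2)[OF x]) simp
    have Sl: "l.S k \<omega>' = l.S k \<omega>" for k by (simp add: l.S_def dirl)
    have D': "D s x \<omega>' = D s x \<omega>" for s unfolding \<omega>'_def by (rule other_side(1)[OF x])
    have "l.first_hit (target False x) kl \<omega>'" using kl by (simp add: l.first_hit_def Sl target_def D')
    then have \<Psi>: "\<Psi> x \<omega> = l.\<Theta> kl \<omega>'"
      using r.reflect_first_hit[OF kr] l.reflect_first_hit by (simp add: \<Psi>_def mirror_def \<omega>'_def)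
    have hitr: "stepsize (D True x \<omega>) * of_int (r.S kr \<omega>) = D True x \<omega>"
      using kr stepsize(3) by (simp add: r.first_hit_def target_def)
    have hitl: "stepsize (D False x \<omega>) * of_int (l.S kl \<omega>) = D False x \<omega>"
      using kl stepsize(3) by (simp add: l.first_hit_def target_def)
    define k where "k = max (max kr kl) (max gr gl)"
    have grk: "gr \<le> k" and glk: "gl \<le> k" by (simp_all add: k_def)
    have ins: "v \<in> far s j" if "v \<in> V" "rim k \<le> outer s v" "j \<le> k" for v s j
      using far_outer[OF that(1), of j s] that rim_mono[OF that(3)] by simp
    have out: "v \<in> near (\<not> s) j" if "v \<in> V" "rim k \<le> outer s v" for v s j
      using near_outer[OF that(1), of "\<not> s" j] that rim_pos(1)[of j] rim_pos(1)[of k] by (simp add: outer_flip)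
    have "T (fst x) \<omega> I v = T (snd x) (\<Psi> x \<omega>) I' v" if v: "v \<in> V" "rim k \<le> \<bar>fst v\<bar>" for v
    proof (cases "0 \<le> fst v")
      case True
      then have o: "rim k \<le> outer True v" using v by (simp add: outer_def)
      have "T (snd x) (\<Psi> x \<omega>) I' v = T (snd x) \<omega>' I' v" unfolding \<Psi>
        by (rule T_turns(2)[OF x \<omega>' I'(1) I_near(2)]) (use out[OF v(1) o] in simp)
      also have "\<dots> = T (snd x) \<omega> I' v + stepsize (D True x \<omega>) * of_int (r.S kr \<omega>)" unfolding \<omega>'_def
        by (rule T_turns(1)[OF x elim(5) I'(1) I_near(2)]) (use ins[OF v(1) o] in \<open>simp add: k_def\<close>)
      also have "stepsize (D True x \<omega>) * of_int (r.S kr \<omega>) = D True x \<omega>" by (rule hitr)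
      also have "T (snd x) \<omega> I' v + D True x \<omega> = T (fst x) \<omega> I v"
        using D_gate(2)[OF gr ins[OF v(1) o grk], of x] by simp
      finally show ?thesis by simp
    next
      case False
      then have o: "rim k \<le> outer False v" using v by (simp add: outer_def)
      have "T (snd x) (\<Psi> x \<omega>) I' v = T (snd x) \<omega>' I' v + stepsize (D False x \<omega>') * of_int (l.S kl \<omega>')" unfolding \<Psi>
        by (rule T_turns(1)[OF x \<omega>' I'(1) I_near(2)]) (use ins[OF v(1) o] in \<open>simp add: k_def\<close>)
      also have "stepsize (D False x \<omega>') * of_int (l.S kl \<omega>') = D False x \<omega>" by (simp add: D' Sl hitl)
      also have "T (snd x) \<omega>' I' v = T (snd x) \<omega> I' v" unfolding \<omega>'_def
        by (rule T_turns(2)[OF x elim(5) I'(1) I_near(2)]) (use out[OF v(1) o] in simp)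
      also have "T (snd x) \<omega> I' v + D False x \<omega> = T (fst x) \<omega> I v"
        using D_gate(2)[OF gl ins[OF v(1) o glk], of x] by simp
      finally show ?thesis by simp
    qed
    then show ?case by (intro exI[of _ "nat (rim k)"]) (use rim_pos(1)[of k] in auto)
  qed
qed

lemma \<Psi>_measurable:
  assumes x [measurable]: "x \<in> N \<rightarrow>\<^sub>M Fam \<Otimes>\<^sub>M Fam" and \<omega> [measurable]: "\<omega> \<in> N \<rightarrow>\<^sub>M \<Omega>"
  shows "(\<lambda>p. \<Psi> (x p) (\<omega> p)) \<in> N \<rightarrow>\<^sub>M \<Omega>"
proof -
  have fw: "flip_walk \<Omega> (flip s (x p)) (dir s (x p))" if "p \<in> space N" for s p
    by (rule flip_walk_side[OF measurable_space[OF x that]])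
  have mir: "(\<lambda>p. mirror s (x p) (\<omega> p)) \<in> N \<rightarrow>\<^sub>M \<Omega>" if \<omega> [measurable]: "\<omega> \<in> N \<rightarrow>\<^sub>M \<Omega>" for s \<omega>
  proof -
    have S [measurable]: "(\<lambda>p. walk_pos s (x p) k (\<omega> p)) \<in> N \<rightarrow>\<^sub>M count_space UNIV" for k
    proof -
      have "(\<lambda>p. \<Sum>j<k. dir s (x p) j (\<omega> p)) \<in> N \<rightarrow>\<^sub>M count_space UNIV"
        by (induction k) (simp_all add: measurable_compose_countable)
      moreover have "walk_pos s (x p) k (\<omega> p) = (\<Sum>j<k. dir s (x p) j (\<omega> p))" if "p \<in> space N" for p
        by (rule flip_walk.S_def[OF fw[OF that]])
      ultimately show ?thesis
        by (subst measurable_cong[where g = "\<lambda>p. \<Sum>j<k. dir s (x p) j (\<omega> p)"]) auto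
    qed
    have turns: "(\<lambda>p. turns s (x p) k (\<omega> p)) \<in> N \<rightarrow>\<^sub>M \<Omega>" for k
    proof (induction k)
      case 0
      have "turns s (x p) 0 (\<omega> p) = \<omega> p" if "p \<in> space N" for p
        by (rule flip_walk.\<Theta>.simps(1)[OF fw[OF that]])
      with \<omega> show ?case by (subst measurable_cong[where g = \<omega>]) auto
    next
      case (Suc k)
      have "turns s (x p) (Suc k) (\<omega> p) = flip s (x p) k (turns s (x p) k (\<omega> p))" if "p \<in> space N" for p
        by (rule flip_walk.\<Theta>.simps(2)[OF fw[OF that]])
      with flip_measurable[OF x Suc] show ?case
        by (subst measurable_cong[where g = "\<lambda>p. flip s (x p) k (turns s (x p) k (\<omega> p))"]) auto
    qed
    let ?hit = "\<lambda>p k. walk_pos s (x p) k (\<omega> p) = target s (x p) (\<omega> p)"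
    have tg [measurable]: "(\<lambda>p. target s (x p) (\<omega> p)) \<in> N \<rightarrow>\<^sub>M count_space UNIV" unfolding target_def by measurable
    have [measurable]: "(\<lambda>p. LEAST k. ?hit p k) \<in> N \<rightarrow>\<^sub>M count_space UNIV" by measurable
    have [measurable]: "(\<lambda>p. turns s (x p) (LEAST k. ?hit p k) (\<omega> p)) \<in> N \<rightarrow>\<^sub>M \<Omega>"
      by (rule measurable_compose_countable[of "\<lambda>k p. turns s (x p) k (\<omega> p)", OF turns]) measurable
    have "(\<lambda>p. if \<exists>k. ?hit p k then turns s (x p) (LEAST k. ?hit p k) (\<omega> p) else \<omega> p) \<in> N \<rightarrow>\<^sub>M \<Omega>" by measurable
    moreover have "mirror s (x p) (\<omega> p) = (if \<exists>k. ?hit p k then turns s (x p) (LEAST k. ?hit p k) (\<omega> p) else \<omega> p)"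
      if "p \<in> space N" for p
      unfolding mirror_def by (rule flip_walk.reflect_def[OF fw[OF that]])
    ultimately show ?thesis
      by (subst measurable_cong[where g = "\<lambda>p. if \<exists>k. ?hit p k then turns s (x p) (LEAST k. ?hit p k) (\<omega> p) else \<omega> p"]) auto
  qed
  show ?thesis unfolding \<Psi>_def by (intro mir \<omega>)
qed

end


section \<open>The coupling kernel\<close>

lemma fpt_cong:
  assumes "\<And>f. f \<in> E \<Longrightarrow> \<tau> f = \<tau>' f"
  shows "fpt ends E \<tau> U v = fpt ends E \<tau>' U v"
proof -
  have "cost \<tau> p = cost \<tau>' p" if "walk ends E u p v" for u p
    using that assms by (induction ends E u p v rule: walk.induct) auto
  then show ?thesis unfolding fpt_def by (intro INF_cong) auto
qed

text \<open>
  The marginal of the kernel at \<open>x\<close> depends on \<open>x\<close> only through the component \<open>\<pi> x\<close>, whose law under \<open>Q\<close> is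
  known; so the joint law of the two components of \<open>x\<close> does not enter.
\<close>

lemma bind_marginal:
  assumes Q: "prob_space Q" "sets Q = sets S" and N: "N \<in> S \<rightarrow>\<^sub>M prob_algebra R"
    and p: "p \<in> R \<rightarrow>\<^sub>M R'" and \<pi>: "\<pi> \<in> S \<rightarrow>\<^sub>M S'" "distr Q S' \<pi> = S'"
    and g: "g \<in> S' \<Otimes>\<^sub>M M \<rightarrow>\<^sub>M R'" "sigma_finite_measure M" "distr (S' \<Otimes>\<^sub>M M) R' g = R'"
    and marg: "\<And>x. x \<in> space S \<Longrightarrow> distr (N x) R' p = distr M R' (\<lambda>b. g (\<pi> x, b))"
  shows "distr (Q \<bind> N) R' p = R'"
proof (rule measure_eqI)
  interpret Q: prob_space Q by (rule Q)
  interpret M: sigma_finite_measure M by (rule g)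
  have NS: "N \<in> Q \<rightarrow>\<^sub>M subprob_algebra R"
    using measurable_prob_algebraD[OF N] by (simp add: measurable_cong_sets[OF Q(2) refl])
  note [measurable] = p \<pi>(1) g(1) NS
  have \<pi>Q [measurable]: "\<pi> \<in> Q \<rightarrow>\<^sub>M S'" using \<pi>(1) by (simp add: measurable_cong_sets[OF Q(2) refl])
  have spQ: "space Q = space S" by (rule sets_eq_imp_space_eq[OF Q(2)])
  have ne: "space Q \<noteq> {}" by (rule Q.not_empty)
  fix X assume "X \<in> sets (distr (Q \<bind> N) R' p)"
  then have X [measurable]: "X \<in> sets R'" by simp
  have gX [measurable]: "g -` X \<inter> space (S' \<Otimes>\<^sub>M M) \<in> sets (S' \<Otimes>\<^sub>M M)" by measurable
  have "emeasure (distr (Q \<bind> N) R' p) X = emeasure (Q \<bind> (\<lambda>x. distr (N x) R' p)) X"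
    by (subst distr_bind[OF NS ne p]) simp
  also have "\<dots> = (\<integral>\<^sup>+x. emeasure (distr (N x) R' p) X \<partial>Q)"
    by (rule emeasure_bind[OF ne _ X]) (rule measurable_compose[OF NS measurable_distr[OF p]])
  also have "\<dots> = (\<integral>\<^sup>+x. emeasure M (Pair (\<pi> x) -` (g -` X \<inter> space (S' \<Otimes>\<^sub>M M))) \<partial>Q)"
  proof (rule nn_integral_cong)
    fix x assume x: "x \<in> space Q"
    then have \<pi>x: "\<pi> x \<in> space S'" using \<pi>Q by (rule measurable_space[rotated])
    have "(\<lambda>b. g (\<pi> x, b)) \<in> M \<rightarrow>\<^sub>M R'" using \<pi>x by measurable
    then show "emeasure (distr (N x) R' p) X = emeasure M (Pair (\<pi> x) -` (g -` X \<inter> space (S' \<Otimes>\<^sub>M M)))"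
      using x \<pi>x spQ by (subst marg) (auto simp: emeasure_distr space_pair_measure intro!: arg_cong2[where f = emeasure])
  qed
  also have "\<dots> = (\<integral>\<^sup>+y. emeasure M (Pair y -` (g -` X \<inter> space (S' \<Otimes>\<^sub>M M))) \<partial>distr Q S' \<pi>)"
    by (rule nn_integral_distr[symmetric]) (use M.measurable_emeasure_Pair[OF gX] in auto)
  also have "\<dots> = emeasure (S' \<Otimes>\<^sub>M M) (g -` X \<inter> space (S' \<Otimes>\<^sub>M M))"
    unfolding \<pi>(2) by (rule M.emeasure_pair_measure_alt[symmetric]) (rule gX)
  also have "\<dots> = emeasure (distr (S' \<Otimes>\<^sub>M M) R' g) X" by (rule emeasure_distr[symmetric]) measurable
  finally show "emeasure (distr (Q \<bind> N) R' p) X = emeasure R' X" by (simp add: g(3))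
qed simp

context fpp_coupling begin

abbreviation "PF \<equiv> PiM F (\<lambda>_. P)"
abbreviation "PE \<equiv> PiM (Em \<union> F) (\<lambda>_. P)"

definition times :: "(edge \<Rightarrow> marked) \<Rightarrow> edge \<Rightarrow> real" where
  "times \<omega> = (\<lambda>f\<in>F. fst (\<omega> f))"

lemma Em_F: "Em \<union> F = E" "Em \<inter> F = {}" using Em_sub by (auto simp: F_def)

lemma prob_P: "prob_space P" by (rule prob_space_axioms)

lemma times_measurable [measurable]: "times \<in> \<Omega> \<rightarrow>\<^sub>M PF"
proof -
  have "(\<lambda>\<omega>. fst (\<omega> f)) \<in> \<Omega> \<rightarrow>\<^sub>M P" if "f \<in> F" for f
  proof -
    have "(\<lambda>\<omega>. \<omega> f) \<in> \<Omega> \<rightarrow>\<^sub>M marked_space" using component_measurable[of "\<lambda>\<omega>. \<omega>" \<Omega> F f] that by simp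
    then show ?thesis using setsP by (simp add: measurable_cong_sets[OF refl setsP])
  qed
  then show ?thesis unfolding times_def[abs_def] by (rule measurable_restrict)
qed

lemma distr_times: "distr \<Omega> PF times = PF"
proof -
  have "fst \<in> marked \<rightarrow>\<^sub>M P" by (simp add: measurable_cong_sets[OF sets_marked setsP])
  from distr_PiM_map[OF prob_marked this, of F] show ?thesis by (simp add: times_def[abs_def] distr_fst_marked)
qed

definition \<kappa> :: "(edge \<Rightarrow> real) \<times> (edge \<Rightarrow> real) \<Rightarrow> ((edge \<Rightarrow> real) \<times> (edge \<Rightarrow> real)) measure" where
  "\<kappa> x = distr \<Omega> (PF \<Otimes>\<^sub>M PF) (\<lambda>\<omega>. (times \<omega>, times (\<Psi> x \<omega>)))"

lemma prob_\<Omega>: "prob_space \<Omega>" by (rule prob_space_PiM) (rule prob_marked)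

lemma \<Omega>_const: "(\<lambda>_. \<Omega>) \<in> N \<rightarrow>\<^sub>M prob_algebra \<Omega>"
  using prob_\<Omega> by (intro measurable_const) (simp add: space_prob_algebra)

lemma pair_measurable [measurable]:
  "(\<lambda>(x, \<omega>). (times \<omega>, times (\<Psi> x \<omega>))) \<in> (Fam \<Otimes>\<^sub>M Fam) \<Otimes>\<^sub>M \<Omega> \<rightarrow>\<^sub>M PF \<Otimes>\<^sub>M PF"
proof -
  have [measurable]: "(\<lambda>p. \<Psi> (fst p) (snd p)) \<in> (Fam \<Otimes>\<^sub>M Fam) \<Otimes>\<^sub>M \<Omega> \<rightarrow>\<^sub>M \<Omega>"
    by (rule \<Psi>_measurable) auto
  show ?thesis unfolding split_def by measurable
qed

lemma pair_measurable':
  assumes x: "x \<in> space (Fam \<Otimes>\<^sub>M Fam)"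
  shows "(\<lambda>\<omega>. (times \<omega>, times (\<Psi> x \<omega>))) \<in> \<Omega> \<rightarrow>\<^sub>M PF \<Otimes>\<^sub>M PF"
  using \<Psi>_pres(1)[OF x] by measurable

lemma distr_times_\<Psi>:
  assumes x: "x \<in> space (Fam \<Otimes>\<^sub>M Fam)"
  shows "distr \<Omega> PF (\<lambda>\<omega>. times (\<Psi> x \<omega>)) = PF"
proof -
  have "distr \<Omega> PF (\<lambda>\<omega>. times (\<Psi> x \<omega>)) = distr (distr \<Omega> \<Omega> (\<Psi> x)) PF times"
    using \<Psi>_pres(1)[OF x] by (subst distr_distr) (auto simp: comp_def)
  then show ?thesis by (simp add: \<Psi>_pres(2)[OF x] distr_times)
qed

lemma coupling_\<kappa>: "coupling_given P Em F \<kappa>"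
  unfolding coupling_given_def
proof (intro conjI ballI)
  show "\<kappa> \<in> Fam \<Otimes>\<^sub>M Fam \<rightarrow>\<^sub>M prob_algebra (PF \<Otimes>\<^sub>M PF)"
    unfolding \<kappa>_def[abs_def] by (rule measurable_distr_prob_space2[OF \<Omega>_const pair_measurable])
  fix x assume x: "x \<in> space (Fam \<Otimes>\<^sub>M Fam)"
  have "distr (\<kappa> x) PF fst = PF" "distr (\<kappa> x) PF snd = PF"
    unfolding \<kappa>_def using pair_measurable'[OF x]
    by (simp_all add: distr_distr comp_def distr_times distr_times_\<Psi>[OF x])
  then show "is_coupling PF PF (\<kappa> x)" by (simp add: is_coupling_def \<kappa>_def)
qed

text \<open>
  The two complete families, when those on \<open>Em\<close> are \<open>x\<close> and the randomness outside is \<open>\<omega>\<close>.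
\<close>

definition full :: "(edge \<Rightarrow> real) \<times> (edge \<Rightarrow> real) \<Rightarrow> (edge \<Rightarrow> marked) \<Rightarrow> (edge \<Rightarrow> real) \<times> (edge \<Rightarrow> real)" where
  "full x \<omega> = (merge Em F (fst x, times \<omega>), merge Em F (snd x, times (\<Psi> x \<omega>)))"

lemma full_measurable: "(\<lambda>(x, \<omega>). full x \<omega>) \<in> (Fam \<Otimes>\<^sub>M Fam) \<Otimes>\<^sub>M \<Omega> \<rightarrow>\<^sub>M PE \<Otimes>\<^sub>M PE"
proof -
  have [measurable]: "(\<lambda>p. \<Psi> (fst p) (snd p)) \<in> (Fam \<Otimes>\<^sub>M Fam) \<Otimes>\<^sub>M \<Omega> \<rightarrow>\<^sub>M \<Omega>"
    by (rule \<Psi>_measurable) auto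
  show ?thesis unfolding split_def full_def by measurable
qed

lemma full_measurable':
  assumes x: "x \<in> space (Fam \<Otimes>\<^sub>M Fam)"
  shows "full x \<in> \<Omega> \<rightarrow>\<^sub>M PE \<Otimes>\<^sub>M PE"
  using measurable_compose[OF measurable_Pair1'[OF x, of \<Omega>] full_measurable] by simp

lemma kernel_full: "(\<lambda>x. distr \<Omega> (PE \<Otimes>\<^sub>M PE) (full x)) \<in> Fam \<Otimes>\<^sub>M Fam \<rightarrow>\<^sub>M prob_algebra (PE \<Otimes>\<^sub>M PE)"
  by (rule measurable_distr_prob_space2[OF \<Omega>_const full_measurable])

context
  fixes G
  assumes G: "is_coupling Fam Fam G"
begin

lemma sets_G: "sets G = sets (Fam \<Otimes>\<^sub>M Fam)" and G_fst: "distr G Fam fst = Fam" and G_snd: "distr G Fam snd = Fam"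
  using G by (auto simp: is_coupling_def)

lemma fst_snd_G: "fst \<in> G \<rightarrow>\<^sub>M Fam" "snd \<in> G \<rightarrow>\<^sub>M Fam"
  by (simp_all add: measurable_cong_sets[OF sets_G refl])

lemma prob_G: "prob_space G"
proof
  interpret Fam: prob_space Fam by (rule prob_space_PiM) (rule prob_P)
  have "emeasure G (space G) = emeasure (distr G Fam fst) (space Fam)"
    using measurable_space[OF fst_snd_G(1)] by (subst emeasure_distr[OF fst_snd_G(1)]) (auto intro!: arg_cong2[where f = emeasure])
  then show "emeasure G (space G) = 1" by (simp add: G_fst Fam.emeasure_space_1)
qed

lemma joint_law_eq: "joint_law P Em F G \<kappa> = G \<bind> (\<lambda>x. distr \<Omega> (PE \<Otimes>\<^sub>M PE) (full x))"
  unfolding joint_law_def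
proof (rule bind_cong[OF refl])
  fix x assume "x \<in> space G"
  then have x: "x \<in> space (Fam \<Otimes>\<^sub>M Fam)" using sets_eq_imp_space_eq[OF sets_G] by simp
  obtain a a' where aa: "x = (a, a')" by (cases x)
  have a: "a \<in> space Fam" "a' \<in> space Fam" using x by (auto simp: aa space_pair_measure)
  have "(\<lambda>_. a) \<in> PF \<Otimes>\<^sub>M PF \<rightarrow>\<^sub>M Fam" "(\<lambda>_. a') \<in> PF \<Otimes>\<^sub>M PF \<rightarrow>\<^sub>M Fam" using a by simp_all
  then have "(\<lambda>p. (merge Em F (a, fst p), merge Em F (a', snd p))) \<in> PF \<Otimes>\<^sub>M PF \<rightarrow>\<^sub>M PE \<Otimes>\<^sub>M PE"
    by (intro measurable_Pair measurable_compose[OF _ measurable_merge] measurable_fst measurable_snd)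
  note m = distr_distr[OF this pair_measurable'[OF x]]
  show "(case x of (a, a') \<Rightarrow> distr (\<kappa> (a, a')) (PE \<Otimes>\<^sub>M PE) (\<lambda>(b, b'). (merge Em F (a, b), merge Em F (a', b')))) = distr \<Omega> (PE \<Otimes>\<^sub>M PE) (full x)"
    using m unfolding aa \<kappa>_def full_def[abs_def] split_def by (simp add: comp_def)
qed

lemma joint_law_coupling: "is_coupling PE PE (joint_law P Em F G \<kappa>)"
  unfolding is_coupling_def joint_law_eq
proof (intro conjI)
  have sp: "space G \<noteq> {}" using prob_space.not_empty[OF prob_G] .
  have "sets (distr \<Omega> (PE \<Otimes>\<^sub>M PE) (full x)) = sets (PE \<Otimes>\<^sub>M PE)" for x by simp
  then show "sets (G \<bind> (\<lambda>x. distr \<Omega> (PE \<Otimes>\<^sub>M PE) (full x))) = sets (PE \<Otimes>\<^sub>M PE)"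
    by (intro sets_bind sp) auto
  have PF: "sigma_finite_measure PF" by (intro prob_space_imp_sigma_finite prob_space_PiM) (rule prob_P)
  note merge = measurable_merge[of Em F "\<lambda>_. P"] and mp = distr_PiM_merge[OF prob_P Em_F(2)]
  show "distr (G \<bind> (\<lambda>x. distr \<Omega> (PE \<Otimes>\<^sub>M PE) (full x))) PE fst = PE"
  proof (rule bind_marginal[OF prob_G sets_G kernel_full _ _ G_fst merge PF mp])
    fix x assume x: "x \<in> space (Fam \<Otimes>\<^sub>M Fam)"
    then have a: "fst x \<in> space Fam" by (auto simp: space_pair_measure)
    have [measurable]: "(\<lambda>b. merge Em F (fst x, b)) \<in> PF \<rightarrow>\<^sub>M PE"
      by (rule measurable_compose[OF measurable_Pair1'[OF a] merge])
    have "distr (distr \<Omega> (PE \<Otimes>\<^sub>M PE) (full x)) PE fst = distr \<Omega> PE (\<lambda>\<omega>. merge Em F (fst x, times \<omega>))"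
      using full_measurable'[OF x] by (simp add: distr_distr comp_def full_def)
    also have "\<dots> = distr (distr \<Omega> PF times) PE (\<lambda>b. merge Em F (fst x, b))"
      by (subst distr_distr) (auto simp: comp_def)
    finally show "distr (distr \<Omega> (PE \<Otimes>\<^sub>M PE) (full x)) PE fst = distr PF PE (\<lambda>b. merge Em F (fst x, b))"
      by (simp add: distr_times)
  qed auto
  show "distr (G \<bind> (\<lambda>x. distr \<Omega> (PE \<Otimes>\<^sub>M PE) (full x))) PE snd = PE"
  proof (rule bind_marginal[OF prob_G sets_G kernel_full _ _ G_snd merge PF mp])
    fix x assume x: "x \<in> space (Fam \<Otimes>\<^sub>M Fam)"
    then have a: "snd x \<in> space Fam" by (auto simp: space_pair_measure)
    have [measurable]: "(\<lambda>b. merge Em F (snd x, b)) \<in> PF \<rightarrow>\<^sub>M PE"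
      by (rule measurable_compose[OF measurable_Pair1'[OF a] merge])
    have [measurable]: "\<Psi> x \<in> \<Omega> \<rightarrow>\<^sub>M \<Omega>" by (rule \<Psi>_pres(1)[OF x])
    have "distr (distr \<Omega> (PE \<Otimes>\<^sub>M PE) (full x)) PE snd = distr \<Omega> PE (\<lambda>\<omega>. merge Em F (snd x, times (\<Psi> x \<omega>)))"
      using full_measurable'[OF x] by (simp add: distr_distr comp_def full_def)
    also have "\<dots> = distr (distr \<Omega> PF (\<lambda>\<omega>. times (\<Psi> x \<omega>))) PE (\<lambda>b. merge Em F (snd x, b))"
      by (subst distr_distr) (auto simp: comp_def)
    finally show "distr (distr \<Omega> (PE \<Otimes>\<^sub>M PE) (full x)) PE snd = distr PF PE (\<lambda>b. merge Em F (snd x, b))"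
      by (simp add: distr_times_\<Psi>[OF x])
  qed auto
qed

end

end


context fpp_coupling begin

section \<open>Almost sure agreement\<close>

text \<open>
  A measurable event that implies the conclusion. The wet regions for all real times do not appear in
  it; they are dealt with in \<open>coalesce_wet\<close>.
\<close>

definition coalesce :: "(edge \<Rightarrow> real) \<times> (edge \<Rightarrow> real) \<Rightarrow> bool" where
  "coalesce z \<longleftrightarrow> (\<forall>f\<in>E. 0 \<le> fst z f \<and> 0 \<le> snd z f) \<and>
     (\<exists>M::nat. \<forall>v\<in>V. int M \<le> \<bar>fst v\<bar> \<longrightarrow>
        fpt ends E (\<lambda>f. max 0 (fst z f)) I v = fpt ends E (\<lambda>f. max 0 (snd z f)) I' v)"

lemma coalesce_measurable: "Measurable.pred (PE \<Otimes>\<^sub>M PE) coalesce"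
proof -
  have comp: "(\<lambda>t. t f) \<in> borel_measurable PE" if "f \<in> E" for f
    using measurable_component_singleton[of f "Em \<union> F" "\<lambda>_. P"] that
    by (simp add: Em_F measurable_cong_sets[OF refl setsP])
  have fpt: "(\<lambda>t. fpt ends E (\<lambda>f. max 0 (t f)) U v) \<in> borel_measurable PE" for U v
  proof -
    have cost: "(\<lambda>t. cost (\<lambda>f. max 0 (t f)) p) \<in> borel_measurable PE" if "walk ends E u p v" for u p
      using that
    proof (induction p arbitrary: u)
      case (Cons a p)
      obtain f w where a: "a = (f, w)" by (cases a)
      with Cons.prems have f: "f \<in> E" and p: "walk ends E w p v" by simp_all
      show ?case using comp[OF f] Cons.IH[OF p] by (simp add: a)
    qed simp
    show ?thesis unfolding fpt_def
      by (rule borel_measurable_cINF_real) (use cost in \<open>auto intro: countable_subset[OF subset_UNIV]\<close>)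
  qed
  have "Measurable.pred (PE \<Otimes>\<^sub>M PE) (\<lambda>z. 0 \<le> fst z f)" "Measurable.pred (PE \<Otimes>\<^sub>M PE) (\<lambda>z. 0 \<le> snd z f)"
    if "f \<in> E" for f
  proof -
    note [measurable] = measurable_compose[OF measurable_fst comp[OF that]] measurable_compose[OF measurable_snd comp[OF that]]
    show "Measurable.pred (PE \<Otimes>\<^sub>M PE) (\<lambda>z. 0 \<le> fst z f)" "Measurable.pred (PE \<Otimes>\<^sub>M PE) (\<lambda>z. 0 \<le> snd z f)"
      by measurable
  qed
  moreover have "Measurable.pred (PE \<Otimes>\<^sub>M PE) (\<lambda>z. fpt ends E (\<lambda>f. max 0 (fst z f)) I v = fpt ends E (\<lambda>f. max 0 (snd z f)) I' v)" for v
    using measurable_compose[OF measurable_fst fpt[of I v]] measurable_compose[OF measurable_snd fpt[of I' v]] by measurable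
  ultimately show ?thesis unfolding coalesce_def[abs_def]
    by (intro pred_intros_logic pred_intros_countable pred_intros_countable_bounded) auto
qed

context
  fixes G
  assumes G: "is_coupling Fam Fam G" and nonneg: "AE t in P. 0 \<le> t"
begin

lemma AE_nonneg: "countable H \<Longrightarrow> AE b in PiM H (\<lambda>_. P). \<forall>f\<in>H. 0 \<le> b f"
  by (subst AE_ball_countable) (auto intro!: AE_PiM_component prob_P nonneg)

lemma AE_coalesce_joint: "AE z in joint_law P Em F G \<kappa>. coalesce z"
proof -
  note sG = sets_G[OF G]
  have sp: "space G = space (Fam \<Otimes>\<^sub>M Fam)" by (rule sets_eq_imp_space_eq[OF sG])
  have ker: "(\<lambda>x. distr \<Omega> (PE \<Otimes>\<^sub>M PE) (full x)) \<in> G \<rightarrow>\<^sub>M subprob_algebra (PE \<Otimes>\<^sub>M PE)"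
    using measurable_prob_algebraD[OF kernel_full] by (simp add: measurable_cong_sets[OF sG refl])
  have nnG: "AE x in G. \<forall>f\<in>Em. 0 \<le> fst x f" "AE x in G. \<forall>f\<in>Em. 0 \<le> snd x f"
  proof -
    have nn: "AE b in Fam. \<forall>f\<in>Em. 0 \<le> b f" by (rule AE_nonneg) (auto intro: countable_subset[OF subset_UNIV])
    show "AE x in G. \<forall>f\<in>Em. 0 \<le> fst x f" by (rule AE_distrD[OF fst_snd_G(1)[OF G]]) (simp only: G_fst[OF G] nn)
    show "AE x in G. \<forall>f\<in>Em. 0 \<le> snd x f" by (rule AE_distrD[OF fst_snd_G(2)[OF G]]) (simp only: G_snd[OF G] nn)
  qed
  have "AE x in G. AE z in distr \<Omega> (PE \<Otimes>\<^sub>M PE) (full x). coalesce z"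
    using nnG AE_space
  proof eventually_elim
    case (elim x)
    then have x: "x \<in> space (Fam \<Otimes>\<^sub>M Fam)" by (simp add: sp)
    have nnF: "AE b in PF. \<forall>f\<in>F. 0 \<le> b f" by (rule AE_nonneg) (auto intro: countable_subset[OF subset_UNIV])
    have t\<Psi>: "(\<lambda>\<omega>. times (\<Psi> x \<omega>)) \<in> \<Omega> \<rightarrow>\<^sub>M PF" by (rule measurable_compose[OF \<Psi>_pres(1)[OF x] times_measurable])
    have "AE \<omega> in \<Omega>. \<forall>f\<in>F. 0 \<le> times \<omega> f"
      by (rule AE_distrD[OF times_measurable]) (simp only: distr_times nnF)
    moreover have "AE \<omega> in \<Omega>. \<forall>f\<in>F. 0 \<le> times (\<Psi> x \<omega>) f"
      by (rule AE_distrD[OF t\<Psi>]) (simp only: distr_times_\<Psi>[OF x] nnF)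
    ultimately have "AE \<omega> in \<Omega>. coalesce (full x \<omega>)"
      using AE_coalesce[OF x]
    proof eventually_elim
      case e: (elim \<omega>)
      have T: "T a \<omega> U v = fpt ends E (\<lambda>f. max 0 (merge Em F (a, times \<omega>) f)) U v" for a \<omega> U v
        unfolding T_def by (rule fpt_cong) (auto simp: \<tau>_def merge_def times_def F_def)
      have nn: "0 \<le> merge Em F (a, b) f" if "\<forall>f\<in>Em. 0 \<le> a f" "\<forall>f\<in>F. 0 \<le> b f" "f \<in> E" for a b and f
        using that by (auto simp: merge_def F_def)
      show ?case unfolding coalesce_def full_def fst_conv snd_conv T[symmetric]
        using e(3) nn[OF elim(1) e(1)] nn[OF elim(2) e(2)] by blast
    qed
    then show "AE z in distr \<Omega> (PE \<Otimes>\<^sub>M PE) (full x). coalesce z"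
      by (subst AE_distr_iff[OF full_measurable'[OF x]]) (use coalesce_measurable in \<open>auto simp: pred_def\<close>)
  qed
  then show ?thesis unfolding joint_law_eq[OF G]
    by (subst AE_bind[OF ker]) (use coalesce_measurable in auto)
qed

end

text \<open>
  The passage times differ at most on the finite set \<open>C\<close>, all of which is wet in both processes from time \<open>B\<close>
  on.
\<close>

lemma coalesce_wet:
  assumes "coalesce z"
  shows "\<exists>N::nat. (\<forall>n\<ge>int N. \<forall>i\<in>{1..K}.
      passage_time V E ends (fst z) I {(n, i)} = passage_time V E ends (snd z) I' {(n, i)}) \<and>
    (\<forall>t\<ge>real N. wet_region V E ends (fst z) I t = wet_region V E ends (snd z) I' t)"
proof -
  let ?p = "\<lambda>v. passage_time V E ends (fst z) I {v}" and ?p' = "\<lambda>v. passage_time V E ends (snd z) I' {v}"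
  obtain M :: nat where M: "\<And>v. v \<in> V \<Longrightarrow> int M \<le> \<bar>fst v\<bar> \<Longrightarrow>
      fpt ends E (\<lambda>f. max 0 (fst z f)) I v = fpt ends E (\<lambda>f. max 0 (snd z f)) I' v"
    using assms unfolding coalesce_def by blast
  have p: "?p v = fpt ends E (\<lambda>f. max 0 (fst z f)) I v" "?p' v = fpt ends E (\<lambda>f. max 0 (snd z f)) I' v" for v
  proof -
    have "passage_time V E ends t U {v} = fpt ends E (\<lambda>f. max 0 (t f)) U v" if t: "\<forall>f\<in>E. 0 \<le> t f" and U: "U \<subseteq> V" for t U
    proof -
      have "passage_time V E ends t U {v} = fpt ends E t U v"
        by (rule passage_time_eq_fpt) (erule bspec[OF t] ends_sub | rule U)+
      also have "\<dots> = fpt ends E (\<lambda>f. max 0 (t f)) U v" by (rule fpt_cong) (simp add: t max_absorb2)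
      finally show ?thesis .
    qed
    note pt = this
    have "\<forall>f\<in>E. 0 \<le> fst z f" "\<forall>f\<in>E. 0 \<le> snd z f" using assms by (auto simp: coalesce_def)
    from pt[OF this(1) I(2)] pt[OF this(2) I'(2)] show "?p v = fpt ends E (\<lambda>f. max 0 (fst z f)) I v"
      "?p' v = fpt ends E (\<lambda>f. max 0 (snd z f)) I' v" by blast+
  qed
  have eq: "?p v = ?p' v" if "v \<in> V" "int M \<le> \<bar>fst v\<bar>" for v using M[OF that] by (simp add: p)
  define C where "C = {v \<in> V. \<bar>fst v\<bar> < int M}"
  have "C \<subseteq> {- int M..int M} \<times> {1..K}" by (auto simp: C_def graph_verts_def)
  then have finC: "finite C" by (rule finite_subset) simp
  define B where "B = (\<Sum>v\<in>C. \<bar>?p v\<bar> + \<bar>?p' v\<bar>)"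
  have B: "?p v \<le> B" "?p' v \<le> B" if "v \<in> C" for v
  proof -
    have "\<bar>?p v\<bar> + \<bar>?p' v\<bar> \<le> B" unfolding B_def using finC that
      by (intro member_le_sum) auto
    then show "?p v \<le> B" "?p' v \<le> B" by linarith+
  qed
  define N where "N = max M (nat \<lceil>B\<rceil>)"
  have "B \<le> real N" unfolding N_def by linarith
  have "wet_region V E ends (fst z) I t = wet_region V E ends (snd z) I' t" if "real N \<le> t" for t
    unfolding wet_region_def
  proof (rule Collect_cong, rule conj_cong[OF refl])
    fix v assume v: "v \<in> V"
    show "(?p v \<le> t) = (?p' v \<le> t)"
    proof (cases "v \<in> C")
      case True
      with B[OF True] \<open>B \<le> real N\<close> that show ?thesis by linarith
    next
      case False
      then show ?thesis using eq[OF v] v by (simp add: C_def)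
    qed
  qed
  moreover have "?p (n, i) = ?p' (n, i)" if "int N \<le> n" "i \<in> {1..K}" for n i
    by (rule eq) (use that in \<open>auto simp: N_def graph_verts_def\<close>)
  ultimately show ?thesis by (intro exI[of _ N]) auto
qed

lemma exists_coupling:
  assumes nonneg: "AE t in P. 0 \<le> t"
  shows "\<exists>\<kappa>. coupling_given P Em (E - Em) \<kappa> \<and>
    (\<forall>G. is_coupling (PiM Em (\<lambda>_. P)) (PiM Em (\<lambda>_. P)) G \<longrightarrow>
       is_coupling (PiM E (\<lambda>_. P)) (PiM E (\<lambda>_. P)) (joint_law P Em (E - Em) G \<kappa>) \<and>
       (AE (\<tau>, \<tau>') in joint_law P Em (E - Em) G \<kappa>. \<exists>N::nat.
          (\<forall>n\<ge>int N. \<forall>i\<in>{1..K}.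
             passage_time V E ends \<tau> I {(n, i)} = passage_time V E ends \<tau>' I' {(n, i)}) \<and>
          (\<forall>t\<ge>real N. wet_region V E ends \<tau> I t = wet_region V E ends \<tau>' I' t)))"
proof (intro exI[of _ \<kappa>] conjI allI impI)
  show "coupling_given P Em (E - Em) \<kappa>" using coupling_\<kappa> by (simp add: F_def)
  fix G assume G: "is_coupling (PiM Em (\<lambda>_. P)) (PiM Em (\<lambda>_. P)) G"
  show "is_coupling (PiM E (\<lambda>_. P)) (PiM E (\<lambda>_. P)) (joint_law P Em (E - Em) G \<kappa>)"
    using joint_law_coupling[OF G] unfolding Em_F(1) by (simp add: F_def)
  show "AE (\<tau>, \<tau>') in joint_law P Em (E - Em) G \<kappa>. \<exists>N::nat.
          (\<forall>n\<ge>int N. \<forall>i\<in>{1..K}.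
             passage_time V E ends \<tau> I {(n, i)} = passage_time V E ends \<tau>' I' {(n, i)}) \<and>
          (\<forall>t\<ge>real N. wet_region V E ends \<tau> I t = wet_region V E ends \<tau>' I' t)"
    using AE_coalesce_joint[OF G nonneg] unfolding F_def
  proof eventually_elim
    case (elim z)
    show ?case unfolding split_beta using coalesce_wet[OF elim] by simp
  qed
qed

end

theorem proposition6p1:
  fixes K L m :: nat and inc :: "nat \<Rightarrow> nat set" and J :: "(nat \<times> nat) set"
    and P :: "real measure" and I I' :: "vertex set"
  defines "V \<equiv> graph_verts K"
    and "E \<equiv> graph_edges L J"
    and "ends \<equiv> edge_ends inc"
    and "Em \<equiv> edges_within L inc J m"
  assumes "essentially_1d_periodic K L inc J"
    and "finite I" "I \<noteq> {}" "I \<subseteq> V"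
    and "finite I'" "I' \<noteq> {}" "I' \<subseteq> V"
    and "real_distribution P" "AE x in P. 0 \<le> x"
    and "has_ac_component P"
  shows "\<exists>\<kappa>. coupling_given P Em (E - Em) \<kappa> \<and>
    (\<forall>Q. is_coupling (PiM Em (\<lambda>_. P)) (PiM Em (\<lambda>_. P)) Q \<longrightarrow>
       is_coupling (PiM E (\<lambda>_. P)) (PiM E (\<lambda>_. P)) (joint_law P Em (E - Em) Q \<kappa>) \<and>
       (AE (\<tau>, \<tau>') in joint_law P Em (E - Em) Q \<kappa>. \<exists>N::nat.
          (\<forall>n\<ge>int N. \<forall>i\<in>{1..K}.
             passage_time V E ends \<tau> I {(n, i)} = passage_time V E ends \<tau>' I' {(n, i)}) \<and>
          (\<forall>t\<ge>real N. wet_region V E ends \<tau> I t = wet_region V E ends \<tau>' I' t)))"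
proof -
  interpret periodic_graph K L inc J by unfold_locales fact
  interpret real_distribution P by fact
  obtain c Q \<alpha> \<beta>0 \<beta>1 where PQ: "0 < c" "compact Q" "Q \<subseteq> {0..\<alpha>}" "0 \<le> \<alpha>" "\<alpha> < \<beta>0" "\<beta>0 \<le> \<beta>1"
    "0 < emeasure lborel Q" "\<And>X. X \<in> sets borel \<Longrightarrow> ennreal c * emeasure lborel (X \<inter> Q) \<le> emeasure P X"
    "0 < emeasure P {\<beta>0..\<beta>1}"
    using ac_component_structure[OF assms(12-14)] by blast
  obtain \<delta>0 where \<delta>0: "0 < \<delta>0" "\<And>\<delta>. 0 < \<delta> \<Longrightarrow> \<delta> \<le> \<delta>0 \<Longrightarrow> 0 < emeasure lborel {t \<in> Q. t + \<delta> \<in> Q}"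
    using positive_overlap[OF PQ(2,7)] by blast
  obtain R where "\<forall>z. \<exists>e x y A B \<Gamma>. e \<in> block z R \<and> x \<in> graph_verts K \<and> y \<in> graph_verts K \<and>
      {v \<in> graph_verts K. fst v \<le> z} \<subseteq> A \<and> A \<subseteq> {v \<in> graph_verts K. fst v < z + int R} \<and>
      {v \<in> graph_verts K. z + int R \<le> fst v} \<subseteq> B \<and> B \<subseteq> {v \<in> graph_verts K. z < fst v} \<and>
      (\<forall>\<tau>. (\<forall>f\<in>graph_edges L J. 0 \<le> \<tau> f) \<longrightarrow> \<tau> e \<le> \<alpha> \<longrightarrow>
         (\<forall>f\<in>block z R - {e}. if f \<in> \<Gamma> then \<tau> f \<le> \<alpha> else \<beta>0 \<le> \<tau> f \<and> \<tau> f \<le> \<beta>1) \<longrightarrow>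
         gate (edge_ends inc) (graph_edges L J) \<tau> e x y A B)"
    using block_gate[OF PQ(4-6)] by blast
  then obtain ge gx gy gA gB \<Gamma> where blocks: "\<forall>z. ge z \<in> block z R \<and> gx z \<in> graph_verts K \<and> gy z \<in> graph_verts K \<and>
      {v \<in> graph_verts K. fst v \<le> z} \<subseteq> gA z \<and> gA z \<subseteq> {v \<in> graph_verts K. fst v < z + int R} \<and>
      {v \<in> graph_verts K. z + int R \<le> fst v} \<subseteq> gB z \<and> gB z \<subseteq> {v \<in> graph_verts K. z < fst v} \<and>
      (\<forall>\<tau>. (\<forall>f\<in>graph_edges L J. 0 \<le> \<tau> f) \<longrightarrow> \<tau> (ge z) \<le> \<alpha> \<longrightarrow>
         (\<forall>f\<in>block z R - {ge z}. if f \<in> \<Gamma> z then \<tau> f \<le> \<alpha> else \<beta>0 \<le> \<tau> f \<and> \<tau> f \<le> \<beta>1) \<longrightarrow>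
         gate (edge_ends inc) (graph_edges L J) \<tau> (ge z) (gx z) (gy z) (gA z) (gB z))"
    unfolding choice_iff by blast
  \<comment> \<open>Beyond level N0 there are neither seeds nor edges with given times.\<close>
  define N0 where "N0 = m + (\<Sum>v\<in>I \<union> I'. nat \<bar>fst v\<bar>)"
  have N0: "\<bar>fst v\<bar> \<le> int N0" if "v \<in> I \<union> I'" for v
  proof -
    have "nat \<bar>fst v\<bar> \<le> (\<Sum>v\<in>I \<union> I'. nat \<bar>fst v\<bar>)"
      using that assms(6,9) by (intro member_le_sum) auto
    then show ?thesis unfolding N0_def by linarith
  qed
  interpret fpp_coupling K L inc J P c Q \<alpha> \<beta>0 \<beta>1 \<delta>0 R ge gx gy gA gB \<Gamma> m N0 I I'
  proof unfold_locales
    show "sets P = sets borel" by simp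
    show "Q \<in> sets borel" using PQ(2) by (simp add: borel_compact)
    show "emeasure lborel Q < \<infinity>" using emeasure_compact_finite[OF PQ(2)] .
    show "gate (edge_ends inc) (graph_edges L J) \<tau> (ge z) (gx z) (gy z) (gA z) (gB z)"
      if "\<forall>f\<in>graph_edges L J. 0 \<le> \<tau> f" "\<tau> (ge z) \<le> \<alpha>"
        "\<forall>f\<in>block z R - {ge z}. if f \<in> \<Gamma> z then \<tau> f \<le> \<alpha> else \<beta>0 \<le> \<tau> f \<and> \<tau> f \<le> \<beta>1" for z \<tau>
      using blocks that by blast
    show "m \<le> N0" by (simp add: N0_def)
  qed (use PQ \<delta>0 blocks N0 assms(7,8,10,11) in \<open>auto simp: V_def\<close>)
  show ?thesis using exists_coupling[OF assms(13)] unfolding assms(1-4) Em_def .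
qed

end
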